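(* Let $(E,\|\cdot\|)$ be a $\mathcal{T}_{\varepsilon,\lambda}$-complete random normed module over $\mathbb{K}$ with base $(\Omega,\mathcal{F},P)$ and let $G$ be an $L^0$-convexly compact subset of $E$ with random normal structure. Then every isometric mapping $T:G\to G$ (namely, $\|Tx-Ty\|=\|x-y\|$ for any $x,y\in G$) has a fixed point in $C(G,G)$.
   Context: $(\Omega,\mathcal{F},P)$ is a probability space and $\mathbb{K}\in\{\mathbb{R},\mathbb{C}\}$. $L^0(\mathcal{F},\mathbb{K})$ is the algebra of a.s.-equivalence classes of $\mathbb{K}$-valued $\mathcal{F}$-measurable random variables, $L^0(\mathcal{F})=L^0(\mathcal{F},\mathbb{R})$, ordered by $\xi\le\eta$ iff $\xi\leq\eta$ a.s., and $L^0_+(\mathcal{F})=\{\xi\in L^0(\mathcal{F}):\xi\ge 0\}$. $\bigvee,\bigwedge$ denote supremum and infimum in the complete lattice $\bar L^0(\mathcal{F})$ of classes of extended real-valued random variables. $\xi>\eta$ means $\xi\ge\eta$ and $\xi\ne\eta$; "$\xi>\eta$ on $A$" means $\xi(\omega)>\eta(\omega)$ for almost all $\omega\in A$; $(\xi>\eta)=\{\omega:\xi(\omega)>\eta(\omega)\}$ (up to null sets). A random normed module (RN module) over $\mathbb{K}$ with base $(\Omega,\mathcal{F},P)$ is an $L^0(\mathcal{F},\mathbb{K})$-module $E$ with a map $\|\cdot\|:E\to L^0_+(\mathcal{F})$ such that $\|\xi x\|=|\xi|\|x\|$, $\|x+y\|\le\|x\|+\|y\|$, and $\|x\|=0$ implies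 $x=\theta$ (the null element). The $(\varepsilon,\lambda)$-topology $\mathcal{T}_{\varepsilon,\lambda}$ is the metrizable linear topology with local base at $\theta$ the sets $\{x: P\{\|x\|<\varepsilon\}>1-\lambda\}$, $\varepsilon>0$, $0<\lambda<1$ ($x_n\to x$ iff $\|x_n-x\|\to0$ in probability). $G\subset E$ is a.s. bounded if $\bigvee\{\|g\|:g\in G\}\in L^0_+(\mathcal F)$, and $L^0$-convex if $\xi x+(1-\xi)y\in G$ for all $x,y\in G$ and $\xi\in L^0_+(\mathcal F)$ with $0\le\xi\le1$. A nonempty $\mathcal{T}_{\varepsilon,\lambda}$-closed $L^0$-convex $G\subset E$ is $L^0$-convexly compact if every family of $\mathcal{T}_{\varepsilon,\lambda}$-closed $L^0$-convex subsets of $G$ with the finite intersection property has nonempty intersection (such $G$ is automatically a.s. bounded). For $H\subset E$ nonempty a.s. bounded and $G\subset E$ nonempty, $R(H,x)=\bigvee\{\|x-y\|:y\in H\}$ for $x\in E$, $R(H,G)=\bigwedge\{R(H,x):x\in G\}$, and $C(H,G)=\{x\in G:R(H,x)=R(H,G)\}$; $C(G,G)$ is the random Chebyshev center of $G$. $D(H)=\bigvee\{\|x-y\|:x,y\in H\}$. A nonempty $\mathcal{T}_{\varepsilon,\lambda}$-closed $L^0$-convex $G\subset E$ has random normal structure if for each a.s. bounded $\mathcal{T}_{\varepsilon,\lambda}$-closed $L^0$-convex $H\subset G$ with $D(H)>0$ there is $z\in H$ with $R(H,z)<D(H)$ on $(D(H)>0)$. *)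

theory Defs
  imports "HOL-Probability.Probability" "HOL-Algebra.Module" "HOL-Algebra.Complete_Lattice"
begin

section \<open>Almost sure equivalence classes of random variables\<close>

definition L0_class :: "'w measure \<Rightarrow> ('w \<Rightarrow> 'b::topological_space) \<Rightarrow> ('w \<Rightarrow> 'b) set" where
  "L0_class M f = {g \<in> borel_measurable M. AE w in M. g w = f w}"

text \<open>At value type \<^typ>\<open>real\<close> this is $L^0(\mathcal F)$, at \<^typ>\<open>ereal\<close> it is
  $\bar L^0(\mathcal F)$. For $L^0(\mathcal F,\mathbb K)$ the scalar field is a type \<open>'k\<close> of class
  \<^class>\<open>real_normed_field\<close> and \<^class>\<open>second_countable_topology\<close>, which has \<^typ>\<open>real\<close> and
  \<^typ>\<open>complex\<close> as instances. By the Gelfand--Mazur theorem every \<^class>\<open>real_normed_field\<close> is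
  isometrically isomorphic to one of these two, so \<open>'k\<close> ranges exactly over
  $\mathbb K \in \{\mathbb R, \mathbb C\}$.\<close>

definition L0 :: "'w measure \<Rightarrow> ('w \<Rightarrow> 'b::topological_space) set set" where
  "L0 M = L0_class M ` borel_measurable M"

text \<open>Operations and relations are lifted to classes through all representatives; for the
  operations used below the class obtained does not depend on the representative.\<close>

definition L0_map :: "'w measure \<Rightarrow> ('a \<Rightarrow> 'b::topological_space) \<Rightarrow> ('w \<Rightarrow> 'a) set \<Rightarrow> ('w \<Rightarrow> 'b) set"
  where "L0_map M h a = (\<Union>f\<in>a. L0_class M (\<lambda>w. h (f w)))"

definition L0_map2 :: "'w measure \<Rightarrow> ('a \<Rightarrow> 'b \<Rightarrow> 'c::topological_space) \<Rightarrow>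
    ('w \<Rightarrow> 'a) set \<Rightarrow> ('w \<Rightarrow> 'b) set \<Rightarrow> ('w \<Rightarrow> 'c) set"
  where "L0_map2 M h a b = (\<Union>f\<in>a. \<Union>g\<in>b. L0_class M (\<lambda>w. h (f w) (g w)))"

definition L0_le :: "'w measure \<Rightarrow> ('w \<Rightarrow> 'b::order) set \<Rightarrow> ('w \<Rightarrow> 'b) set \<Rightarrow> bool" where
  "L0_le M a b \<longleftrightarrow> (\<forall>f\<in>a. \<forall>g\<in>b. AE w in M. f w \<le> g w)"

definition L0_less_on :: "'w measure \<Rightarrow> 'w set \<Rightarrow> ('w \<Rightarrow> 'b::order) set \<Rightarrow> ('w \<Rightarrow> 'b) set \<Rightarrow> bool" where
  "L0_less_on M A a b \<longleftrightarrow> (\<forall>f\<in>a. \<forall>g\<in>b. AE w in M. w \<in> A \<longrightarrow> f w < g w)"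

definition L0_plus :: "'w measure \<Rightarrow> ('w \<Rightarrow> real) set set" where
  "L0_plus M = {a \<in> L0 M. L0_le M (L0_class M (\<lambda>_. 0)) a}"

definition L0_ring :: "'w measure \<Rightarrow> ('w \<Rightarrow> 'k::{real_normed_field, second_countable_topology}) set ring"
  where "L0_ring M = \<lparr>carrier = L0 M,
     monoid.mult = L0_map2 M (*), one = L0_class M (\<lambda>_. 1),
     zero = L0_class M (\<lambda>_. 0), add = L0_map2 M (+)\<rparr>"

definition L0bar :: "'w measure \<Rightarrow> ('w \<Rightarrow> ereal) set gorder" where
  "L0bar M = \<lparr>carrier = L0 M, eq = (=), le = L0_le M\<rparr>"


section \<open>Random normed modules\<close>

record ('w, 'k, 'e) rn_module = "(('w \<Rightarrow> 'k) set, 'e) module" +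
  rnorm :: "'e \<Rightarrow> ('w \<Rightarrow> real) set"

locale random_normed_module =
  prob_space M + module "L0_ring M" E
  for M :: "'w measure"
    and E :: "('w, 'k::{real_normed_field, second_countable_topology}, 'e) rn_module" +
  assumes rnorm_closed: "x \<in> carrier E \<Longrightarrow> rnorm E x \<in> L0_plus M"
    and rnorm_smult: "\<lbrakk>\<xi> \<in> L0 M; x \<in> carrier E\<rbrakk> \<Longrightarrow>
      rnorm E (\<xi> \<odot>\<^bsub>E\<^esub> x) = L0_map2 M (*) (L0_map M norm \<xi>) (rnorm E x)"
    and rnorm_triangle: "\<lbrakk>x \<in> carrier E; y \<in> carrier E\<rbrakk> \<Longrightarrow>
      L0_le M (rnorm E (x \<oplus>\<^bsub>E\<^esub> y)) (L0_map2 M (+) (rnorm E x) (rnorm E y))"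
    and rnorm_eq_zero: "\<lbrakk>x \<in> carrier E; rnorm E x = L0_class M (\<lambda>_. 0)\<rbrakk> \<Longrightarrow> x = \<zero>\<^bsub>E\<^esub>"

definition rn_nbhd :: "'w measure \<Rightarrow> ('w, 'k, 'e) rn_module \<Rightarrow> real \<Rightarrow> real \<Rightarrow> 'e set" where
  "rn_nbhd M E \<epsilon> l =
     {x \<in> carrier E. \<forall>f \<in> rnorm E x. measure M {w \<in> space M. f w < \<epsilon>} > 1 - l}"

text \<open>The translation-invariant topology on the carrier with the sets \<^const>\<open>rn_nbhd\<close> as local
  base at the null element.\<close>

definition eps_lambda_topology :: "'w measure \<Rightarrow> ('w, 'k, 'e) rn_module \<Rightarrow> 'e topology" where
  "eps_lambda_topology M E = topology (\<lambda>U. U \<subseteq> carrier E \<and>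
     (\<forall>x\<in>U. \<exists>\<epsilon>>0. \<exists>l>0. l < 1 \<and> (\<forall>y\<in>carrier E. y \<ominus>\<^bsub>E\<^esub> x \<in> rn_nbhd M E \<epsilon> l \<longrightarrow> y \<in> U)))"

text \<open>The topology is metrizable, so completeness is sequential completeness.\<close>

definition rn_complete :: "'w measure \<Rightarrow> ('w, 'k, 'e) rn_module \<Rightarrow> bool" where
  "rn_complete M E \<longleftrightarrow> (\<forall>s :: nat \<Rightarrow> 'e. range s \<subseteq> carrier E \<longrightarrow>
     (\<forall>\<epsilon>>0. \<forall>l>0. l < 1 \<longrightarrow> (\<exists>N. \<forall>m\<ge>N. \<forall>n\<ge>N. s m \<ominus>\<^bsub>E\<^esub> s n \<in> rn_nbhd M E \<epsilon> l)) \<longrightarrow>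
     (\<exists>x\<in>carrier E. limitin (eps_lambda_topology M E) s x sequentially))"

definition L0_convex :: "'w measure \<Rightarrow>
    ('w, 'k::{real_normed_field, second_countable_topology}, 'e) rn_module \<Rightarrow> 'e set \<Rightarrow> bool" where
  "L0_convex M E G \<longleftrightarrow> (\<forall>x\<in>G. \<forall>y\<in>G. \<forall>\<xi>\<in>L0_plus M. L0_le M \<xi> (L0_class M (\<lambda>_. 1)) \<longrightarrow>
     L0_map M of_real \<xi> \<odot>\<^bsub>E\<^esub> x \<oplus>\<^bsub>E\<^esub> L0_map M (\<lambda>t. of_real (1 - t)) \<xi> \<odot>\<^bsub>E\<^esub> y \<in> G)"

definition L0_convexly_compact :: "'w measure \<Rightarrow>
    ('w, 'k::{real_normed_field, second_countable_topology}, 'e) rn_module \<Rightarrow> 'e set \<Rightarrow> bool" where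
  "L0_convexly_compact M E G \<longleftrightarrow>
     G \<noteq> {} \<and> closedin (eps_lambda_topology M E) G \<and> L0_convex M E G \<and>
     (\<forall>\<A>. (\<forall>A\<in>\<A>. A \<subseteq> G \<and> closedin (eps_lambda_topology M E) A \<and> L0_convex M E A) \<longrightarrow>
        (\<forall>\<F>\<subseteq>\<A>. finite \<F> \<longrightarrow> \<Inter>\<F> \<noteq> {}) \<longrightarrow> \<Inter>\<A> \<noteq> {})"

text \<open>\<^term>\<open>L0_map M ereal\<close> is the inclusion of $L^0(\mathcal F)$ into $\bar L^0(\mathcal F)$, where
  all suprema and infima are taken.\<close>

definition as_bounded :: "'w measure \<Rightarrow> ('w, 'k, 'e) rn_module \<Rightarrow> 'e set \<Rightarrow> bool" where
  "as_bounded M E G \<longleftrightarrow>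
     \<Squnion>\<^bsub>L0bar M\<^esub> ((\<lambda>g. L0_map M ereal (rnorm E g)) ` G) \<in> L0_map M ereal ` L0_plus M"

definition rdist :: "'w measure \<Rightarrow> ('w, 'k, 'e) rn_module \<Rightarrow> 'e \<Rightarrow> 'e \<Rightarrow> ('w \<Rightarrow> ereal) set" where
  "rdist M E x y = L0_map M ereal (rnorm E (x \<ominus>\<^bsub>E\<^esub> y))"

definition radius_at :: "'w measure \<Rightarrow> ('w, 'k, 'e) rn_module \<Rightarrow> 'e set \<Rightarrow> 'e \<Rightarrow> ('w \<Rightarrow> ereal) set" where
  "radius_at M E H x = \<Squnion>\<^bsub>L0bar M\<^esub> {rdist M E x y |y. y \<in> H}"

definition radius :: "'w measure \<Rightarrow> ('w, 'k, 'e) rn_module \<Rightarrow> 'e set \<Rightarrow> 'e set \<Rightarrow> ('w \<Rightarrow> ereal) set" where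
  "radius M E H G = \<Sqinter>\<^bsub>L0bar M\<^esub> {radius_at M E H x |x. x \<in> G}"

definition chebyshev_center :: "'w measure \<Rightarrow> ('w, 'k, 'e) rn_module \<Rightarrow> 'e set \<Rightarrow> 'e set \<Rightarrow> 'e set" where
  "chebyshev_center M E H G = {x \<in> G. radius_at M E H x = radius M E H G}"

definition diam :: "'w measure \<Rightarrow> ('w, 'k, 'e) rn_module \<Rightarrow> 'e set \<Rightarrow> ('w \<Rightarrow> ereal) set" where
  "diam M E H = \<Squnion>\<^bsub>L0bar M\<^esub> {rdist M E x y |x y. x \<in> H \<and> y \<in> H}"

definition random_normal_structure :: "'w measure \<Rightarrow>
    ('w, 'k::{real_normed_field, second_countable_topology}, 'e) rn_module \<Rightarrow> 'e set \<Rightarrow> bool" where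
  "random_normal_structure M E G \<longleftrightarrow>
     G \<noteq> {} \<and> closedin (eps_lambda_topology M E) G \<and> L0_convex M E G \<and>
     (\<forall>H\<subseteq>G. as_bounded M E H \<and> closedin (eps_lambda_topology M E) H \<and> L0_convex M E H \<and>
        L0_class M (\<lambda>_. 0) \<sqsubset>\<^bsub>L0bar M\<^esub> diam M E H \<longrightarrow>
        (\<exists>z\<in>H. \<forall>d\<in>diam M E H.
           L0_less_on M {w \<in> space M. 0 < d w} (radius_at M E H z) (diam M E H)))"


section \<open>Well-definedness\<close>

lemma L0_class_cong:
  assumes "AE w in M. f w = g w"
  shows "L0_class M f = L0_class M g"
proof -
  have "(AE w in M. h w = f w) \<longleftrightarrow> (AE w in M. h w = g w)" for h
  proof
    assume "AE w in M. h w = f w"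
    with assms show "AE w in M. h w = g w" by eventually_elim simp
  next
    assume "AE w in M. h w = g w"
    with assms show "AE w in M. h w = f w" by eventually_elim simp
  qed
  then show ?thesis by (simp add: L0_class_def)
qed

lemma L0_map_class:
  assumes "f \<in> borel_measurable M"
  shows "L0_map M h (L0_class M f) = L0_class M (\<lambda>w. h (f w))"
proof -
  have "L0_class M (\<lambda>w. h (f' w)) = L0_class M (\<lambda>w. h (f w))" if "f' \<in> L0_class M f" for f'
    by (rule L0_class_cong) (use that in \<open>auto simp: L0_class_def\<close>)
  moreover have "f \<in> L0_class M f" using assms by (simp add: L0_class_def)
  ultimately show ?thesis unfolding L0_map_def by blast
qed

lemma L0_map2_class:
  assumes "f \<in> borel_measurable M" "g \<in> borel_measurable M"
  shows "L0_map2 M h (L0_class M f) (L0_class M g) = L0_class M (\<lambda>w. h (f w) (g w))"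
proof -
  have "L0_class M (\<lambda>w. h (f' w) (g' w)) = L0_class M (\<lambda>w. h (f w) (g w))"
    if "f' \<in> L0_class M f" "g' \<in> L0_class M g" for f' g'
  proof -
    have "AE w in M. h (f' w) (g' w) = h (f w) (g w)"
      using that unfolding L0_class_def by auto
    then show ?thesis by (rule L0_class_cong)
  qed
  moreover have "f \<in> L0_class M f" "g \<in> L0_class M g" using assms by (simp_all add: L0_class_def)
  ultimately show ?thesis unfolding L0_map2_def by blast
qed

lemma L0_ring_cring:
  "cring (L0_ring M :: ('w \<Rightarrow> 'k::{real_normed_field, second_countable_topology}) set ring)"
proof (intro cringI abelian_groupI comm_monoidI)
  fix a :: "('w \<Rightarrow> 'k) set"
  assume "a \<in> carrier (L0_ring M)"
  then obtain f where f: "f \<in> borel_measurable M" "a = L0_class M f"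
    by (auto simp: L0_ring_def L0_def)
  show "\<exists>y\<in>carrier (L0_ring M). y \<oplus>\<^bsub>L0_ring M\<^esub> a = \<zero>\<^bsub>L0_ring M\<^esub>"
    using f by (intro bexI[of _ "L0_class M (\<lambda>w. - f w)"])
      (auto simp: L0_ring_def L0_def L0_map2_class)
qed (auto simp: L0_ring_def L0_def L0_map2_class algebra_simps)

lemma (in random_normed_module) openin_eps_lambda_topology:
  "openin (eps_lambda_topology M E) U \<longleftrightarrow> U \<subseteq> carrier E \<and>
     (\<forall>x\<in>U. \<exists>\<epsilon>>0. \<exists>l>0. l < 1 \<and> (\<forall>y\<in>carrier E. y \<ominus>\<^bsub>E\<^esub> x \<in> rn_nbhd M E \<epsilon> l \<longrightarrow> y \<in> U))"
proof -
  have mono: "rn_nbhd M E \<epsilon> l \<subseteq> rn_nbhd M E \<epsilon>' l'" if "\<epsilon> \<le> \<epsilon>'" "l \<le> l'" for \<epsilon> \<epsilon>' l l'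
  proof
    fix x assume x: "x \<in> rn_nbhd M E \<epsilon> l"
    have "measure M {w \<in> space M. f w < \<epsilon>'} > 1 - l'" if f: "f \<in> rnorm E x" for f
    proof -
      have "f \<in> borel_measurable M"
        using f x rnorm_closed[of x]
        by (auto simp: rn_nbhd_def L0_plus_def L0_def L0_class_def)
      then have "measure M {w \<in> space M. f w < \<epsilon>} \<le> measure M {w \<in> space M. f w < \<epsilon>'}"
        using \<open>\<epsilon> \<le> \<epsilon>'\<close> by (intro finite_measure_mono) auto
      moreover have "1 - l < measure M {w \<in> space M. f w < \<epsilon>}"
        using x f by (auto simp: rn_nbhd_def)
      ultimately show ?thesis using \<open>l \<le> l'\<close> by linarith
    qed
    then show "x \<in> rn_nbhd M E \<epsilon>' l'" using x by (auto simp: rn_nbhd_def)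
  qed
  let ?P = "\<lambda>U. U \<subseteq> carrier E \<and>
     (\<forall>x\<in>U. \<exists>\<epsilon>>0. \<exists>l>0. l < 1 \<and> (\<forall>y\<in>carrier E. y \<ominus>\<^bsub>E\<^esub> x \<in> rn_nbhd M E \<epsilon> l \<longrightarrow> y \<in> U))"
  have "istopology ?P"
    unfolding istopology_def
  proof (intro conjI allI impI)
    fix S T assume S: "?P S" and T: "?P T"
    show "S \<inter> T \<subseteq> carrier E" using S by blast
    show "\<forall>x\<in>S \<inter> T. \<exists>\<epsilon>>0. \<exists>l>0. l < 1 \<and>
        (\<forall>y\<in>carrier E. y \<ominus>\<^bsub>E\<^esub> x \<in> rn_nbhd M E \<epsilon> l \<longrightarrow> y \<in> S \<inter> T)"
    proof
      fix x assume x: "x \<in> S \<inter> T"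
      obtain e1 l1 where 1: "e1 > 0" "l1 > 0" "l1 < 1"
        "\<And>y. y \<in> carrier E \<Longrightarrow> y \<ominus>\<^bsub>E\<^esub> x \<in> rn_nbhd M E e1 l1 \<Longrightarrow> y \<in> S"
        using S x by blast
      obtain e2 l2 where 2: "e2 > 0" "l2 > 0" "l2 < 1"
        "\<And>y. y \<in> carrier E \<Longrightarrow> y \<ominus>\<^bsub>E\<^esub> x \<in> rn_nbhd M E e2 l2 \<Longrightarrow> y \<in> T"
        using T x by blast
      show "\<exists>\<epsilon>>0. \<exists>l>0. l < 1 \<and>
          (\<forall>y\<in>carrier E. y \<ominus>\<^bsub>E\<^esub> x \<in> rn_nbhd M E \<epsilon> l \<longrightarrow> y \<in> S \<inter> T)"
        using 1 2 mono[of "min e1 e2" e1 "min l1 l2" l1] mono[of "min e1 e2" e2 "min l1 l2" l2]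
        by (intro exI[of _ "min e1 e2"] conjI exI[of _ "min l1 l2"]) auto
    qed
  next
    fix \<K> assume K: "\<forall>K\<in>\<K>. ?P K"
    show "\<Union>\<K> \<subseteq> carrier E" using K by blast
    show "\<forall>x\<in>\<Union>\<K>. \<exists>\<epsilon>>0. \<exists>l>0. l < 1 \<and>
        (\<forall>y\<in>carrier E. y \<ominus>\<^bsub>E\<^esub> x \<in> rn_nbhd M E \<epsilon> l \<longrightarrow> y \<in> \<Union>\<K>)"
    proof
      fix x assume "x \<in> \<Union>\<K>"
      then obtain K where "K \<in> \<K>" "x \<in> K" by blast
      with K show "\<exists>\<epsilon>>0. \<exists>l>0. l < 1 \<and>
          (\<forall>y\<in>carrier E. y \<ominus>\<^bsub>E\<^esub> x \<in> rn_nbhd M E \<epsilon> l \<longrightarrow> y \<in> \<Union>\<K>)"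
        by (meson UnionI)
    qed
  qed
  then show ?thesis by (simp add: eps_lambda_topology_def topology_inverse')
qed

end

theory Submission
  imports Defs
begin

text \<open>The setting is classical once classes are replaced by representatives: elements of the module
  have a random norm \<open>nrm\<close>, and all statements are about almost sure inequalities between random
  variables.

  The fixed point comes from a random version of Kirk's theorem: a nonexpansive self-map of a
  nonempty closed convex subset of \<open>G\<close> has a fixed point, because a minimal invariant set has a
  nondiametral point unless it is a single point (\<open>random_Kirk\<close>). To obtain a fixed point in the
  Chebyshev center, let \<open>r\<close> be the minimal radius of \<open>G\<close>, which is attained because the radii at
  the points of \<open>G\<close> form a downward directed family (\<open>chebyshev_center_nonempty\<close>). As \<open>T\<close> need not be
  onto, the center is not visibly invariant. But the set of all points from which some iterated
  image \<open>(T ^^ n) ` G\<close> is within distance \<open>r\<close> is invariant, convex and contains the center. A fixed point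
  in its closure is as far from \<open>(T ^^ n) y\<close> as from \<open>y\<close>, for each \<open>y \<in> G\<close>, so it lies in the center
  (\<open>isometry_fixed_point_in_center\<close>).

  Normal structure speaks only about almost surely bounded sets, so convexly compact sets have to
  be shown to be bounded (\<open>convexly_compact_as_bounded\<close>). This is done without duality, in the manner
  of the open mapping theorem. A Baire argument, in which nested copies of \<open>G\<close> have a common point by
  convex compactness, gives an approximate bound (\<open>convexly_compact_Baire\<close>). Iterating it turns the
  approximate bound into an exact one, up to a limit vector \<open>y\<close> such that \<open>G\<close> contains a ray in
  direction \<open>y\<close>, and a convexly compact set contains no ray in a nonzero direction
  (\<open>convexly_compact_no_ray\<close>). The bound is first obtained in probability. It becomes almost sure because the norms of the elements of a convex
  set form an upward directed family (\<open>as_boundedI\<close>).\<close>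


section \<open>Classes of random variables through representatives\<close>

lemma L0_class_eq_iff:
  assumes "f \<in> borel_measurable M"
  shows "L0_class M f = L0_class M g \<longleftrightarrow> (AE w in M. f w = g w)"
proof
  assume "L0_class M f = L0_class M g"
  moreover have "f \<in> L0_class M f" using assms by (simp add: L0_class_def)
  ultimately have "f \<in> L0_class M g" by simp
  then show "AE w in M. f w = g w" by (simp add: L0_class_def)
qed (rule L0_class_cong)

lemma L0_le_class_iff:
  assumes "f \<in> borel_measurable M" "g \<in> borel_measurable M"
  shows "L0_le M (L0_class M f) (L0_class M g) \<longleftrightarrow> (AE w in M. f w \<le> g w)"
proof
  assume "L0_le M (L0_class M f) (L0_class M g)"
  then show "AE w in M. f w \<le> g w" using assms by (auto simp: L0_le_def L0_class_def)
next
  assume le: "AE w in M. f w \<le> g w"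
  show "L0_le M (L0_class M f) (L0_class M g)"
    unfolding L0_le_def
  proof (intro ballI)
    fix f' g' assume "f' \<in> L0_class M f" "g' \<in> L0_class M g"
    then have "AE w in M. f' w = f w" "AE w in M. g' w = g w" by (auto simp: L0_class_def)
    then show "AE w in M. f' w \<le> g' w" using le by eventually_elim simp
  qed
qed

lemma L0_class_in_L0: "f \<in> borel_measurable M \<Longrightarrow> L0_class M f \<in> L0 M"
  by (simp add: L0_def)

lemma L0_class_in_L0_plus:
  "f \<in> borel_measurable M \<Longrightarrow> AE w in M. 0 \<le> f w \<Longrightarrow> L0_class M f \<in> L0_plus M"
  by (simp add: L0_plus_def L0_class_in_L0 L0_le_class_iff)

lemma L0_plusE:
  assumes "a \<in> L0_plus M"
  obtains f where "f \<in> borel_measurable M" "a = L0_class M f" "\<And>w. 0 \<le> f w"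
proof -
  obtain g where g: "g \<in> borel_measurable M" "a = L0_class M g"
    using assms by (auto simp: L0_plus_def L0_def)
  have "AE w in M. 0 \<le> g w"
    using assms g by (simp add: L0_plus_def L0_le_class_iff)
  then have "AE w in M. g w = \<bar>g w\<bar>" by eventually_elim simp
  with g show thesis using that[of "\<lambda>w. \<bar>g w\<bar>"] by (simp add: L0_class_eq_iff)
qed


section \<open>The module operations through representatives\<close>

context random_normed_module
begin

definition nrm :: "'e \<Rightarrow> 'w \<Rightarrow> real" where
  "nrm x = (SOME f. f \<in> borel_measurable M \<and> rnorm E x = L0_class M f \<and> (\<forall>w. 0 \<le> f w))"

lemma nrm:
  assumes "x \<in> carrier E"
  shows nrm_measurable [measurable]: "nrm x \<in> borel_measurable M"
    and rnorm_nrm: "rnorm E x = L0_class M (nrm x)"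
    and nrm_nonneg: "0 \<le> nrm x w"
proof -
  have "\<exists>f. f \<in> borel_measurable M \<and> rnorm E x = L0_class M f \<and> (\<forall>w. 0 \<le> f w)"
    using rnorm_closed[OF assms] by (metis L0_plusE)
  from someI_ex[OF this] show "nrm x \<in> borel_measurable M" "rnorm E x = L0_class M (nrm x)"
    "0 \<le> nrm x w" by (auto simp: nrm_def)
qed

text \<open>Convexity, rays and dilations involve only real-valued random coefficients, so the copy
  of the reals inside the scalar field suffices.\<close>

definition scale :: "('w \<Rightarrow> real) \<Rightarrow> 'e \<Rightarrow> 'e" where
  "scale f x = L0_class M (\<lambda>w. of_real (f w) :: 'k) \<odot>\<^bsub>E\<^esub> x"

definition mix :: "('w \<Rightarrow> real) \<Rightarrow> 'e \<Rightarrow> 'e \<Rightarrow> 'e" where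
  "mix f x y = scale f x \<oplus>\<^bsub>E\<^esub> scale (\<lambda>w. 1 - f w) y"

lemma of_real_measurable:
  "f \<in> borel_measurable M \<Longrightarrow> (\<lambda>w. of_real (f w) :: 'k) \<in> borel_measurable M"
  by measurable

lemma of_real_class_carrier:
  "f \<in> borel_measurable M \<Longrightarrow> L0_class M (\<lambda>w. of_real (f w) :: 'k) \<in> carrier (L0_ring M)"
  by (simp add: L0_ring_def L0_class_in_L0 of_real_measurable)

lemma scale_closed [simp, intro]:
  "f \<in> borel_measurable M \<Longrightarrow> x \<in> carrier E \<Longrightarrow> scale f x \<in> carrier E"
  unfolding scale_def by (intro smult_closed of_real_class_carrier)

lemma mix_closed [simp, intro]:
  "f \<in> borel_measurable M \<Longrightarrow> x \<in> carrier E \<Longrightarrow> y \<in> carrier E \<Longrightarrow> mix f x y \<in> carrier E"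
  unfolding mix_def by auto

lemma scale_distrib_right:
  assumes "f \<in> borel_measurable M" "x \<in> carrier E" "y \<in> carrier E"
  shows "scale f (x \<oplus>\<^bsub>E\<^esub> y) = scale f x \<oplus>\<^bsub>E\<^esub> scale f y"
  unfolding scale_def using assms by (intro smult_r_distr of_real_class_carrier)

lemma scale_distrib_left:
  assumes "f \<in> borel_measurable M" "g \<in> borel_measurable M" "x \<in> carrier E"
  shows "scale (\<lambda>w. f w + g w) x = scale f x \<oplus>\<^bsub>E\<^esub> scale g x"
proof -
  have "L0_class M (\<lambda>w. of_real (f w + g w) :: 'k)
      = L0_class M (\<lambda>w. of_real (f w)) \<oplus>\<^bsub>L0_ring M\<^esub> L0_class M (\<lambda>w. of_real (g w))"
    using assms by (simp add: L0_ring_def L0_map2_class of_real_measurable)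
  then show ?thesis unfolding scale_def
    using smult_l_distr[OF of_real_class_carrier[OF assms(1)] of_real_class_carrier[OF assms(2)] assms(3)]
    by simp
qed

lemma scale_scale:
  assumes "f \<in> borel_measurable M" "g \<in> borel_measurable M" "x \<in> carrier E"
  shows "scale f (scale g x) = scale (\<lambda>w. f w * g w) x"
proof -
  have "L0_class M (\<lambda>w. of_real (f w * g w) :: 'k)
      = L0_class M (\<lambda>w. of_real (f w)) \<otimes>\<^bsub>L0_ring M\<^esub> L0_class M (\<lambda>w. of_real (g w))"
    using assms by (simp add: L0_ring_def L0_map2_class of_real_measurable)
  then show ?thesis unfolding scale_def
    using smult_assoc1[OF of_real_class_carrier[OF assms(1)] of_real_class_carrier[OF assms(2)] assms(3)]
    by simp
qed

lemma scale_one [simp]: "x \<in> carrier E \<Longrightarrow> scale (\<lambda>_. 1) x = x"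
  using smult_one by (simp add: scale_def L0_ring_def)

lemma scale_zero [simp]: "x \<in> carrier E \<Longrightarrow> scale (\<lambda>_. 0) x = \<zero>\<^bsub>E\<^esub>"
  using smult_l_null by (simp add: scale_def L0_ring_def)

lemma scale_uminus:
  assumes "f \<in> borel_measurable M" "x \<in> carrier E"
  shows "scale (\<lambda>w. - f w) x = \<ominus>\<^bsub>E\<^esub> scale f x"
proof -
  have "scale (\<lambda>w. - f w) x \<oplus>\<^bsub>E\<^esub> scale f x = \<zero>\<^bsub>E\<^esub>"
    using scale_distrib_left[of "\<lambda>w. - f w" f x] assms by simp
  then show ?thesis using assms by (intro M.minus_equality[symmetric]) auto
qed

lemma scale_minus_right:
  assumes "f \<in> borel_measurable M" "x \<in> carrier E" "y \<in> carrier E"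
  shows "scale f (x \<ominus>\<^bsub>E\<^esub> y) = scale f x \<ominus>\<^bsub>E\<^esub> scale f y"
proof -
  have "scale f (\<ominus>\<^bsub>E\<^esub> y) = \<ominus>\<^bsub>E\<^esub> scale f y"
    unfolding scale_def using assms by (intro smult_r_minus of_real_class_carrier)
  then show ?thesis using assms by (simp add: a_minus_def scale_distrib_right)
qed

lemma mix_same [simp]:
  assumes "f \<in> borel_measurable M" "x \<in> carrier E"
  shows "mix f x x = x"
  using scale_distrib_left[of f "\<lambda>w. 1 - f w" x] assms by (simp add: mix_def)

lemma add_minus_add:
  assumes "a \<in> carrier E" "b \<in> carrier E" "c \<in> carrier E" "d \<in> carrier E"
  shows "(a \<oplus>\<^bsub>E\<^esub> b) \<ominus>\<^bsub>E\<^esub> (c \<oplus>\<^bsub>E\<^esub> d) = (a \<ominus>\<^bsub>E\<^esub> c) \<oplus>\<^bsub>E\<^esub> (b \<ominus>\<^bsub>E\<^esub> d)"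
  using assms by (simp add: a_minus_def M.minus_add M.a_ac)

lemma minus_triangle:
  assumes "a \<in> carrier E" "b \<in> carrier E" "c \<in> carrier E"
  shows "a \<ominus>\<^bsub>E\<^esub> c = (a \<ominus>\<^bsub>E\<^esub> b) \<oplus>\<^bsub>E\<^esub> (b \<ominus>\<^bsub>E\<^esub> c)"
  using assms by (simp add: a_minus_def M.a_assoc M.r_neg1)

lemma mix_minus_mix:
  assumes "f \<in> borel_measurable M" "x \<in> carrier E" "y \<in> carrier E" "a \<in> carrier E" "b \<in> carrier E"
  shows "mix f x y \<ominus>\<^bsub>E\<^esub> mix f a b = mix f (x \<ominus>\<^bsub>E\<^esub> a) (y \<ominus>\<^bsub>E\<^esub> b)"
  using assms by (simp add: mix_def add_minus_add scale_minus_right)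

lemma nrm_scale:
  assumes "f \<in> borel_measurable M" "x \<in> carrier E"
  shows "AE w in M. nrm (scale f x) w = \<bar>f w\<bar> * nrm x w"
proof -
  let ?f = "\<lambda>w. of_real (f w) :: 'k"
  have [measurable]: "?f \<in> borel_measurable M" "nrm x \<in> borel_measurable M"
    using assms by (auto intro: of_real_measurable)
  have "L0_class M (nrm (scale f x)) = L0_map2 M (*) (L0_map M norm (L0_class M ?f)) (rnorm E x)"
    using rnorm_smult[OF L0_class_in_L0[of ?f] assms(2)] assms
    by (simp add: rnorm_nrm[symmetric] scale_def[symmetric])
  also have "\<dots> = L0_class M (\<lambda>w. \<bar>f w\<bar> * nrm x w)"
    using assms by (simp add: L0_map_class L0_map2_class rnorm_nrm)
  finally show ?thesis using assms by (simp add: L0_class_eq_iff)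
qed

lemma nrm_add_le:
  assumes "x \<in> carrier E" "y \<in> carrier E"
  shows "AE w in M. nrm (x \<oplus>\<^bsub>E\<^esub> y) w \<le> nrm x w + nrm y w"
  using rnorm_triangle[OF assms] assms by (simp add: rnorm_nrm L0_map2_class L0_le_class_iff)

lemma nrm_zero: "AE w in M. nrm \<zero>\<^bsub>E\<^esub> w = 0"
  using nrm_scale[of "\<lambda>_. 0" "\<zero>\<^bsub>E\<^esub>"] by simp

lemma nrm_eq_zero:
  assumes "x \<in> carrier E" "AE w in M. nrm x w = 0"
  shows "x = \<zero>\<^bsub>E\<^esub>"
  using assms by (intro rnorm_eq_zero) (simp_all add: rnorm_nrm L0_class_eq_iff)

lemma nrm_uminus:
  assumes "x \<in> carrier E"
  shows "AE w in M. nrm (\<ominus>\<^bsub>E\<^esub> x) w = nrm x w"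
  using nrm_scale[of "\<lambda>_. -1" x] scale_uminus[of "\<lambda>_. 1" x] assms by simp

lemma minus_minus_eq:
  assumes "x \<in> carrier E" "y \<in> carrier E"
  shows "\<ominus>\<^bsub>E\<^esub> (x \<ominus>\<^bsub>E\<^esub> y) = y \<ominus>\<^bsub>E\<^esub> x"
  using assms by (simp add: a_minus_def M.minus_add M.a_comm)

lemma nrm_minus_commute:
  assumes "x \<in> carrier E" "y \<in> carrier E"
  shows "AE w in M. nrm (x \<ominus>\<^bsub>E\<^esub> y) w = nrm (y \<ominus>\<^bsub>E\<^esub> x) w"
  using nrm_uminus[of "y \<ominus>\<^bsub>E\<^esub> x"] assms by (simp add: minus_minus_eq)

lemma nrm_minus_triangle:
  assumes "a \<in> carrier E" "b \<in> carrier E" "c \<in> carrier E"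
  shows "AE w in M. nrm (a \<ominus>\<^bsub>E\<^esub> c) w \<le> nrm (a \<ominus>\<^bsub>E\<^esub> b) w + nrm (b \<ominus>\<^bsub>E\<^esub> c) w"
  using nrm_add_le[of "a \<ominus>\<^bsub>E\<^esub> b" "b \<ominus>\<^bsub>E\<^esub> c"] assms minus_triangle[OF assms] by simp

lemma nrm_mix_le:
  assumes "f \<in> borel_measurable M" "\<And>w. 0 \<le> f w \<and> f w \<le> 1" "x \<in> carrier E" "y \<in> carrier E"
  shows "AE w in M. nrm (mix f x y) w \<le> f w * nrm x w + (1 - f w) * nrm y w"
proof -
  have [measurable]: "f \<in> borel_measurable M" by fact
  have "AE w in M. nrm (mix f x y) w \<le> nrm (scale f x) w + nrm (scale (\<lambda>w. 1 - f w) y) w"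
    unfolding mix_def using assms by (intro nrm_add_le) auto
  moreover have "AE w in M. nrm (scale f x) w = \<bar>f w\<bar> * nrm x w"
    using assms by (intro nrm_scale) auto
  moreover have "AE w in M. nrm (scale (\<lambda>w. 1 - f w) y) w = \<bar>1 - f w\<bar> * nrm y w"
    using assms by (intro nrm_scale) auto
  ultimately show ?thesis by eventually_elim (use assms(2) in auto)
qed

lemma rnorm_eq_iff:
  assumes "x \<in> carrier E" "y \<in> carrier E"
  shows "rnorm E x = rnorm E y \<longleftrightarrow> (AE w in M. nrm x w = nrm y w)"
  using assms by (simp add: rnorm_nrm L0_class_eq_iff)

lemma L0_convexD:
  assumes "L0_convex M E G" "x \<in> G" "y \<in> G" "f \<in> borel_measurable M"
    "\<And>w. 0 \<le> f w \<and> f w \<le> 1"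
  shows "mix f x y \<in> G"
proof -
  have "L0_class M f \<in> L0_plus M" "L0_le M (L0_class M f) (L0_class M (\<lambda>_. 1))"
    using assms by (auto intro!: L0_class_in_L0_plus simp: L0_le_class_iff)
  with assms show ?thesis
    unfolding L0_convex_def mix_def scale_def by (fastforce simp: L0_map_class)
qed

lemma L0_convexI:
  assumes G: "G \<subseteq> carrier E"
    and mix: "\<And>x y f. x \<in> G \<Longrightarrow> y \<in> G \<Longrightarrow> f \<in> borel_measurable M
      \<Longrightarrow> (\<And>w. 0 \<le> f w \<and> f w \<le> 1) \<Longrightarrow> mix f x y \<in> G"
  shows "L0_convex M E G"
  unfolding L0_convex_def
proof (intro ballI impI)
  fix x y \<xi>
  assume xy: "x \<in> G" "y \<in> G" and \<xi>: "\<xi> \<in> L0_plus M" "L0_le M \<xi> (L0_class M (\<lambda>_. 1))"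
  obtain f where f: "f \<in> borel_measurable M" "\<xi> = L0_class M f" "\<And>w. 0 \<le> f w"
    using L0_plusE[OF \<xi>(1)] by metis
  define g where "g w = min 1 (f w)" for w
  have [measurable]: "g \<in> borel_measurable M" unfolding g_def using f by measurable
  have "AE w in M. f w \<le> 1" using \<xi>(2) f by (simp add: L0_le_class_iff)
  then have "AE w in M. f w = g w" by eventually_elim (simp add: g_def)
  then have \<xi>g: "\<xi> = L0_class M g" using f by (simp add: L0_class_eq_iff)
  have "mix g x y \<in> G" using xy f(3) by (intro mix) (auto simp: g_def)
  then show "L0_map M of_real \<xi> \<odot>\<^bsub>E\<^esub> x \<oplus>\<^bsub>E\<^esub> L0_map M (\<lambda>t. of_real (1 - t)) \<xi> \<odot>\<^bsub>E\<^esub> y \<in> G"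
    by (simp add: \<xi>g mix_def scale_def L0_map_class)
qed

end

section \<open>The topology of convergence in probability\<close>

lemma (in prob_space) expectation_min_le_add:
  fixes u v t :: "'a \<Rightarrow> real"
  assumes [measurable]: "u \<in> borel_measurable M" "v \<in> borel_measurable M" "t \<in> borel_measurable M"
    and nonneg: "\<And>w. 0 \<le> u w" "\<And>w. 0 \<le> v w" "\<And>w. 0 \<le> t w"
    and le: "AE w in M. u w \<le> v w + t w"
  shows "expectation (\<lambda>w. min 1 (u w)) \<le> expectation (\<lambda>w. min 1 (v w)) + expectation (\<lambda>w. min 1 (t w))"
proof -
  have int: "integrable M (\<lambda>w. min 1 (h w))" if [measurable]: "h \<in> borel_measurable M"
    and "\<And>w. 0 \<le> h w" for h :: "'a \<Rightarrow> real"
    by (rule integrable_const_bound[of _ 1]) (use that in auto)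
  have "expectation (\<lambda>w. min 1 (u w)) \<le> expectation (\<lambda>w. min 1 (v w) + min 1 (t w))"
  proof (rule integral_mono_AE)
    show "AE w in M. min 1 (u w) \<le> min 1 (v w) + min 1 (t w)"
      using le
    proof eventually_elim
      case (elim w)
      then show ?case using nonneg(2)[of w] nonneg(3)[of w] by (auto simp: min_def)
    qed
  qed (use nonneg int in auto)
  also have "\<dots> = expectation (\<lambda>w. min 1 (v w)) + expectation (\<lambda>w. min 1 (t w))"
    using nonneg int by simp
  finally show ?thesis .
qed

text \<open>An inequality that holds up to random errors of arbitrarily small size in probability
  holds exactly: the truncated excess of \<open>f\<close> over \<open>r\<close> has expectation zero. The bound \<open>r\<close> may be
  infinite, because radii of sets that are not known to be bounded occur below.\<close>

lemma (in prob_space) AE_le_if_le_add_small: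
  fixes f :: "'a \<Rightarrow> real" and r :: "'a \<Rightarrow> ereal"
  assumes [measurable]: "f \<in> borel_measurable M" "r \<in> borel_measurable M"
    and small: "\<And>e. 0 < e \<Longrightarrow> \<exists>u\<in>borel_measurable M. (\<forall>w. 0 \<le> u w)
      \<and> expectation (\<lambda>w. min 1 (u w)) < e \<and> (AE w in M. ereal (f w) \<le> r w + ereal (u w))"
  shows "AE w in M. ereal (f w) \<le> r w"
proof -
  define D where "D w = real_of_ereal (min 1 (max 0 (ereal (f w) - r w)))" for w
  have [measurable]: "D \<in> borel_measurable M" unfolding D_def by measurable
  have D01: "0 \<le> D w \<and> D w \<le> 1" for w
    unfolding D_def by (cases "ereal (f w) - r w") (auto simp: min_def max_def)
  have intD: "integrable M D"
    by (rule integrable_const_bound[of _ 1]) (use D01 in auto)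
  have "expectation D \<le> 0"
  proof (rule field_le_epsilon)
    fix e :: real assume "0 < e"
    then obtain u where u: "u \<in> borel_measurable M" "\<And>w. 0 \<le> u w"
      "expectation (\<lambda>w. min 1 (u w)) < e" "AE w in M. ereal (f w) \<le> r w + ereal (u w)"
      using small by blast
    have "expectation D \<le> expectation (\<lambda>w. min 1 (u w))"
    proof (rule integral_mono_AE)
      show "integrable M (\<lambda>w. min 1 (u w))"
        by (rule integrable_const_bound[of _ 1]) (use u in auto)
      show "AE w in M. D w \<le> min 1 (u w)"
        using u(4)
      proof eventually_elim
        case (elim w)
        then show ?case using u(2)[of w] unfolding D_def
          by (cases "r w") (auto simp: min_def max_def)
      qed
    qed (rule intD)
    with u(3) show "expectation D \<le> 0 + e" by simp
  qed
  moreover have "0 \<le> expectation D" using D01 by simp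
  ultimately have "AE w in M. D w = 0"
    using integral_nonneg_eq_0_iff_AE[OF intD] D01 by simp
  then show ?thesis
  proof eventually_elim
    case (elim w)
    then show ?case unfolding D_def by (cases "r w") (auto simp: min_def max_def split: if_splits)
  qed
qed

context random_normed_module
begin

text \<open>\<open>gauge 1\<close> is the usual F-norm that metrizes convergence in probability. The factor \<open>c\<close> is
  kept as a parameter because an F-norm is not homogeneous: a set is bounded in probability if
  \<open>gauge c\<close> is uniformly small on it for small \<open>c\<close>.\<close>

definition gauge :: "real \<Rightarrow> 'e \<Rightarrow> real" where
  "gauge c x = expectation (\<lambda>w. min 1 (c * nrm x w))"

lemma gauge_le_add:
  assumes "x \<in> carrier E" "y \<in> carrier E" "z \<in> carrier E" "0 \<le> c" "0 \<le> d" "0 \<le> e"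
    and "AE w in M. c * nrm x w \<le> d * nrm y w + e * nrm z w"
  shows "gauge c x \<le> gauge d y + gauge e z"
proof -
  have [measurable]: "nrm x \<in> borel_measurable M" "nrm y \<in> borel_measurable M" "nrm z \<in> borel_measurable M"
    using assms by auto
  show ?thesis unfolding gauge_def
    by (rule expectation_min_le_add) (use assms in \<open>simp_all add: nrm_nonneg\<close>)
qed

lemma gauge_zero: "gauge c \<zero>\<^bsub>E\<^esub> = 0"
proof -
  have "gauge c \<zero>\<^bsub>E\<^esub> = expectation (\<lambda>w. 0)"
    unfolding gauge_def
    by (rule integral_cong_AE) (use nrm_zero nrm_measurable[OF M.zero_closed] in auto)
  then show ?thesis by simp
qed

lemma gauge_le:
  assumes "x \<in> carrier E" "y \<in> carrier E" "0 \<le> c" "0 \<le> d"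
    and "AE w in M. c * nrm x w \<le> d * nrm y w"
  shows "gauge c x \<le> gauge d y"
proof -
  have "AE w in M. c * nrm x w \<le> d * nrm y w + 0 * nrm \<zero>\<^bsub>E\<^esub> w"
    using assms(5) by simp
  from gauge_le_add[OF assms(1,2) M.zero_closed assms(3,4) order_refl this]
  show ?thesis by (simp add: gauge_zero)
qed

lemma gauge_minus_triangle:
  assumes "a \<in> carrier E" "b \<in> carrier E" "c \<in> carrier E" "0 \<le> k"
  shows "gauge k (a \<ominus>\<^bsub>E\<^esub> c) \<le> gauge k (a \<ominus>\<^bsub>E\<^esub> b) + gauge k (b \<ominus>\<^bsub>E\<^esub> c)"
proof (rule gauge_le_add)
  show "AE w in M. k * nrm (a \<ominus>\<^bsub>E\<^esub> c) w \<le> k * nrm (a \<ominus>\<^bsub>E\<^esub> b) w + k * nrm (b \<ominus>\<^bsub>E\<^esub> c) w"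
    using nrm_minus_triangle[OF assms(1-3)]
    by eventually_elim (use assms(4) in \<open>simp add: mult_left_mono flip: distrib_left\<close>)
qed (use assms in auto)

lemma gauge_minus_commute:
  assumes "a \<in> carrier E" "b \<in> carrier E" "0 \<le> k"
  shows "gauge k (a \<ominus>\<^bsub>E\<^esub> b) = gauge k (b \<ominus>\<^bsub>E\<^esub> a)"
proof (rule antisym)
  show "gauge k (a \<ominus>\<^bsub>E\<^esub> b) \<le> gauge k (b \<ominus>\<^bsub>E\<^esub> a)"
    by (rule gauge_le) (use assms nrm_minus_commute[of a b] in auto)
  show "gauge k (b \<ominus>\<^bsub>E\<^esub> a) \<le> gauge k (a \<ominus>\<^bsub>E\<^esub> b)"
    by (rule gauge_le) (use assms nrm_minus_commute[of a b] in auto)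
qed

lemma gauge_tendsto_0:
  assumes "x \<in> carrier E" "c \<longlonglongrightarrow> 0" "\<And>n. 0 \<le> c n"
  shows "(\<lambda>n. gauge (c n) x) \<longlonglongrightarrow> 0"
proof -
  have [measurable]: "nrm x \<in> borel_measurable M" using assms by simp
  have "(\<lambda>n. expectation (\<lambda>w. min 1 (c n * nrm x w))) \<longlonglongrightarrow> expectation (\<lambda>w. 0)"
  proof (rule integral_dominated_convergence[where w = "\<lambda>_. 1"])
    show "AE w in M. (\<lambda>n. min 1 (c n * nrm x w)) \<longlonglongrightarrow> 0"
    proof (rule AE_I2)
      fix w
      have "(\<lambda>n. min 1 (c n * nrm x w)) \<longlonglongrightarrow> min 1 (0 * nrm x w)"
        by (intro tendsto_intros assms)
      then show "(\<lambda>n. min 1 (c n * nrm x w)) \<longlonglongrightarrow> 0" by simp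
    qed
    show "AE w in M. norm (min 1 (c n * nrm x w)) \<le> 1" for n
      using assms(3)[of n] nrm_nonneg[OF assms(1)] by (simp add: abs_of_nonneg)
  qed auto
  then show ?thesis by (simp add: gauge_def)
qed

text \<open>Markov's inequality for the truncated norm. Together with the converse estimate below it shows
  that the balls of \<open>gauge 1\<close> and the base neighbourhoods of the topology refine each other.\<close>

lemma prob_nrm_ge_le_gauge:
  assumes "x \<in> carrier E" "0 < e" "e \<le> 1" "0 \<le> c"
  shows "e * prob {w \<in> space M. e \<le> c * nrm x w} \<le> gauge c x"
proof -
  let ?A = "{w \<in> space M. e \<le> c * nrm x w}"
  have [measurable]: "nrm x \<in> borel_measurable M" using assms by simp
  have "e * prob ?A = expectation (\<lambda>w. e * indicator ?A w)" by simp
  also have "\<dots> \<le> gauge c x" unfolding gauge_def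
  proof (rule integral_mono)
    show "integrable M (\<lambda>w. min 1 (c * nrm x w))"
      by (rule integrable_const_bound[of _ 1]) (use assms nrm_nonneg[of x] in auto)
    show "e * indicator ?A w \<le> min 1 (c * nrm x w)" for w
      using assms nrm_nonneg[of x w] by (auto simp: indicator_def)
  qed (auto simp: less_top[symmetric])
  finally show ?thesis .
qed

lemma gauge_le_of_nbhd:
  assumes "x \<in> rn_nbhd M E e l" "0 < e"
  shows "gauge 1 x \<le> e + l"
proof -
  have x: "x \<in> carrier E" using assms by (simp add: rn_nbhd_def)
  have [measurable]: "nrm x \<in> borel_measurable M" using x by simp
  let ?A = "{w \<in> space M. nrm x w < e}"
  have "nrm x \<in> rnorm E x" using x by (simp add: rnorm_nrm L0_class_def)
  then have l: "1 - l < prob ?A" using assms by (auto simp: rn_nbhd_def)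
  have "gauge 1 x \<le> expectation (\<lambda>w. e + indicator (space M - ?A) w)"
    unfolding gauge_def
  proof (rule integral_mono)
    show "integrable M (\<lambda>w. min 1 (1 * nrm x w))"
      by (rule integrable_const_bound[of _ 1]) (use x nrm_nonneg[of x] in auto)
    show "min 1 (1 * nrm x w) \<le> e + indicator (space M - ?A) w" if "w \<in> space M" for w
      using assms that by (auto simp: indicator_def)
  qed (auto simp: less_top[symmetric])
  also have "\<dots> = e + prob (space M - ?A)"
    by (subst Bochner_Integration.integral_add) (auto simp: prob_space less_top[symmetric])
  also have "\<dots> = e + (1 - prob ?A)" by (subst prob_compl) auto
  finally show ?thesis using l by simp
qed

lemma nbhd_of_gauge_less:
  assumes "x \<in> carrier E" "gauge 1 x < min e 1 * l" "0 < e"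
  shows "x \<in> rn_nbhd M E e l"
proof -
  define d where "d = min e 1"
  have d: "0 < d" "d \<le> e" "d \<le> 1" using assms by (auto simp: d_def)
  have "1 - l < prob {w \<in> space M. f w < e}" if f: "f \<in> rnorm E x" for f
  proof -
    have [measurable]: "f \<in> borel_measurable M" "nrm x \<in> borel_measurable M"
      using f assms by (auto simp: rnorm_nrm L0_class_def)
    have eq: "AE w in M. f w = nrm x w" using f assms by (simp add: rnorm_nrm L0_class_def)
    have "d * prob {w \<in> space M. d \<le> nrm x w} \<le> gauge 1 x"
      using prob_nrm_ge_le_gauge[OF assms(1) d(1,3), of 1] by simp
    also have "gauge 1 x < d * l" using assms(2) by (simp add: d_def)
    finally have "prob {w \<in> space M. d \<le> nrm x w} < l"
      using d(1) by (metis mult_less_cancel_left_pos)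
    moreover have "{w \<in> space M. d \<le> nrm x w} = space M - {w \<in> space M. nrm x w < d}" by auto
    then have "prob {w \<in> space M. d \<le> nrm x w} = 1 - prob {w \<in> space M. nrm x w < d}"
      by (simp add: prob_compl)
    moreover have "prob {w \<in> space M. nrm x w < d} = prob {w \<in> space M. f w < d}"
      by (rule finite_measure_eq_AE) (use eq in auto)
    moreover have "prob {w \<in> space M. f w < d} \<le> prob {w \<in> space M. f w < e}"
      using d by (intro finite_measure_mono) auto
    ultimately show ?thesis by simp
  qed
  then show ?thesis using assms by (simp add: rn_nbhd_def)
qed

definition cl :: "'e set \<Rightarrow> 'e set" where
  "cl A = {x \<in> carrier E. \<forall>e>0. \<exists>a\<in>A. gauge 1 (x \<ominus>\<^bsub>E\<^esub> a) < e}"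

lemma topspace_eps_lambda [simp]: "topspace (eps_lambda_topology M E) = carrier E"
proof
  show "topspace (eps_lambda_topology M E) \<subseteq> carrier E"
    unfolding topspace_def by (auto simp: openin_eps_lambda_topology)
  have "openin (eps_lambda_topology M E) (carrier E)"
    unfolding openin_eps_lambda_topology by (auto intro!: exI[of _ 1] exI[of _ "1/2"])
  then show "carrier E \<subseteq> topspace (eps_lambda_topology M E)" by (rule openin_subset)
qed

lemma openin_gauge_ball:
  assumes "x \<in> carrier E"
  shows "openin (eps_lambda_topology M E) {y \<in> carrier E. gauge 1 (y \<ominus>\<^bsub>E\<^esub> x) < e}"
  unfolding openin_eps_lambda_topology
proof (intro conjI ballI)
  fix y assume y: "y \<in> {y \<in> carrier E. gauge 1 (y \<ominus>\<^bsub>E\<^esub> x) < e}"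
  define d where "d = min (1/2) ((e - gauge 1 (y \<ominus>\<^bsub>E\<^esub> x)) / 3)"
  have d: "0 < d" "d < 1" "gauge 1 (y \<ominus>\<^bsub>E\<^esub> x) + 2 * d < e"
    using y by (auto simp: d_def min_def field_simps)
  have "gauge 1 (z \<ominus>\<^bsub>E\<^esub> x) < e" if z: "z \<in> carrier E" "z \<ominus>\<^bsub>E\<^esub> y \<in> rn_nbhd M E d d" for z
    using gauge_le_of_nbhd[OF z(2) d(1)] gauge_minus_triangle[of z y x 1] z y assms d by auto
  then show "\<exists>\<epsilon>>0. \<exists>l>0. l < 1 \<and> (\<forall>z\<in>carrier E. z \<ominus>\<^bsub>E\<^esub> y \<in> rn_nbhd M E \<epsilon> l \<longrightarrow>
      z \<in> {y \<in> carrier E. gauge 1 (y \<ominus>\<^bsub>E\<^esub> x) < e})"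
    using d by (intro exI[of _ d]) auto
qed auto

lemma closedin_iff_cl:
  "closedin (eps_lambda_topology M E) A \<longleftrightarrow> A \<subseteq> carrier E \<and> cl A \<subseteq> A"
proof (intro iffI conjI)
  assume cA: "closedin (eps_lambda_topology M E) A"
  then show A: "A \<subseteq> carrier E" using closedin_subset by fastforce
  show "cl A \<subseteq> A"
  proof
    fix x assume x: "x \<in> cl A"
    show "x \<in> A"
    proof (rule ccontr)
      assume "x \<notin> A"
      then have xA: "x \<in> carrier E - A" using x by (simp add: cl_def)
      have "openin (eps_lambda_topology M E) (carrier E - A)"
        using cA by (simp add: closedin_def)
      then have "\<exists>e>0. \<exists>l>0. l < 1 \<and>
          (\<forall>y\<in>carrier E. y \<ominus>\<^bsub>E\<^esub> x \<in> rn_nbhd M E e l \<longrightarrow> y \<in> carrier E - A)"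
        using xA unfolding openin_eps_lambda_topology by (elim conjE bspec)
      then obtain e l where el: "0 < e" "0 < l" "l < 1"
        "\<And>y. y \<in> carrier E \<Longrightarrow> y \<ominus>\<^bsub>E\<^esub> x \<in> rn_nbhd M E e l \<Longrightarrow> y \<notin> A"
        by blast
      have "0 < min e 1 * l" using el by simp
      then obtain a where a: "a \<in> A" "gauge 1 (x \<ominus>\<^bsub>E\<^esub> a) < min e 1 * l"
        using x unfolding cl_def by blast
      have xE: "x \<in> carrier E" "a \<in> carrier E" using x a A by (auto simp: cl_def)
      then have "a \<ominus>\<^bsub>E\<^esub> x \<in> rn_nbhd M E e l"
        using a el gauge_minus_commute[of x a 1] by (intro nbhd_of_gauge_less) auto
      then show False using el(4)[of a] a xE by auto
    qed
  qed
next
  assume A: "A \<subseteq> carrier E \<and> cl A \<subseteq> A"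
  have "openin (eps_lambda_topology M E) (carrier E - A)"
    unfolding openin_eps_lambda_topology
  proof (intro conjI ballI)
    fix x assume x: "x \<in> carrier E - A"
    then have "x \<notin> cl A" using A by blast
    then have "\<not> (\<forall>e>0. \<exists>a\<in>A. gauge 1 (x \<ominus>\<^bsub>E\<^esub> a) < e)" using x by (simp add: cl_def)
    then obtain e where e: "0 < e" "\<And>a. a \<in> A \<Longrightarrow> e \<le> gauge 1 (x \<ominus>\<^bsub>E\<^esub> a)"
      by (meson not_less)
    define d where "d = min (1/2) (e / 3)"
    have d: "0 < d" "d < 1" "2 * d < e" using e by (auto simp: d_def)
    have "y \<notin> A" if y: "y \<in> carrier E" "y \<ominus>\<^bsub>E\<^esub> x \<in> rn_nbhd M E d d" for y
      using gauge_le_of_nbhd[OF y(2) d(1)] e(2)[of y] d gauge_minus_commute[of x y 1] x y by auto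
    then show "\<exists>\<epsilon>>0. \<exists>l>0. l < 1 \<and> (\<forall>y\<in>carrier E. y \<ominus>\<^bsub>E\<^esub> x \<in> rn_nbhd M E \<epsilon> l \<longrightarrow> y \<in> carrier E - A)"
      using d by (intro exI[of _ d]) auto
  qed auto
  then show "closedin (eps_lambda_topology M E) A" using A by (simp add: closedin_def)
qed

lemma cl_superset:
  assumes "A \<subseteq> carrier E"
  shows "A \<subseteq> cl A"
proof
  fix x assume "x \<in> A"
  moreover from this have "x \<ominus>\<^bsub>E\<^esub> x = \<zero>\<^bsub>E\<^esub>" using assms by (auto simp: a_minus_def M.r_neg)
  ultimately show "x \<in> cl A" using assms by (auto simp: cl_def gauge_zero intro!: bexI[of _ x])
qed

lemma closedin_cl:
  assumes "A \<subseteq> carrier E"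
  shows "closedin (eps_lambda_topology M E) (cl A)"
  unfolding closedin_iff_cl
proof (intro conjI subsetI)
  fix x assume x: "x \<in> cl (cl A)"
  have "\<exists>a\<in>A. gauge 1 (x \<ominus>\<^bsub>E\<^esub> a) < e" if e: "0 < e" for e
  proof -
    have e2: "0 < e / 2" using e by simp
    obtain b where b: "b \<in> cl A" "gauge 1 (x \<ominus>\<^bsub>E\<^esub> b) < e / 2"
      using x e2 unfolding cl_def[of "cl A"] by blast
    obtain a where a: "a \<in> A" "gauge 1 (b \<ominus>\<^bsub>E\<^esub> a) < e / 2"
      using b(1) e2 unfolding cl_def by blast
    show ?thesis
      using a b assms x gauge_minus_triangle[of x b a 1] by (intro bexI[of _ a]) (auto simp: cl_def)
  qed
  then show "x \<in> cl A" using x by (auto simp: cl_def)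
qed (auto simp: cl_def)

lemma cl_minimal:
  assumes "A \<subseteq> B" "closedin (eps_lambda_topology M E) B"
  shows "cl A \<subseteq> B"
proof -
  have "cl A \<subseteq> cl B" using assms(1) unfolding cl_def by blast
  then show ?thesis using assms(2) by (auto simp: closedin_iff_cl)
qed

lemma cl_nrm_le:
  assumes x: "x \<in> cl A" and A: "A \<subseteq> carrier E" and y: "y \<in> carrier E"
    and [measurable]: "r \<in> borel_measurable M"
    and le: "\<And>a. a \<in> A \<Longrightarrow> AE w in M. ereal (nrm (a \<ominus>\<^bsub>E\<^esub> y) w) \<le> r w"
  shows "AE w in M. ereal (nrm (x \<ominus>\<^bsub>E\<^esub> y) w) \<le> r w"
proof (rule AE_le_if_le_add_small)
  have xE: "x \<in> carrier E" using x by (simp add: cl_def)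
  show "nrm (x \<ominus>\<^bsub>E\<^esub> y) \<in> borel_measurable M" using xE y by simp
  fix e :: real assume "0 < e"
  then obtain a where a: "a \<in> A" "gauge 1 (x \<ominus>\<^bsub>E\<^esub> a) < e" using x by (auto simp: cl_def)
  have aE: "a \<in> carrier E" using a A by auto
  have "AE w in M. ereal (nrm (x \<ominus>\<^bsub>E\<^esub> y) w) \<le> r w + ereal (nrm (x \<ominus>\<^bsub>E\<^esub> a) w)"
    using nrm_minus_triangle[OF xE aE y] le[OF a(1)]
  proof eventually_elim
    case (elim w)
    then show ?case by (cases "r w") auto
  qed
  then show "\<exists>u\<in>borel_measurable M. (\<forall>w. 0 \<le> u w) \<and> expectation (\<lambda>w. min 1 (u w)) < e
      \<and> (AE w in M. ereal (nrm (x \<ominus>\<^bsub>E\<^esub> y) w) \<le> r w + ereal (u w))"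
    using a xE aE by (intro bexI[of _ "nrm (x \<ominus>\<^bsub>E\<^esub> a)"]) (auto simp: nrm_nonneg gauge_def)
qed fact

lemma L0_convex_cl:
  assumes A: "A \<subseteq> carrier E" "L0_convex M E A"
  shows "L0_convex M E (cl A)"
proof (rule L0_convexI)
  fix x y and f :: "'w \<Rightarrow> real" assume xy: "x \<in> cl A" "y \<in> cl A"
    and f: "f \<in> borel_measurable M" "\<And>w. 0 \<le> f w \<and> f w \<le> 1"
  have E: "x \<in> carrier E" "y \<in> carrier E" using xy by (auto simp: cl_def)
  have "\<exists>a\<in>A. gauge 1 (mix f x y \<ominus>\<^bsub>E\<^esub> a) < e" if e: "0 < e" for e
  proof -
    have e2: "0 < e / 2" using e by simp
    obtain a b where ab: "a \<in> A" "gauge 1 (x \<ominus>\<^bsub>E\<^esub> a) < e / 2" "b \<in> A" "gauge 1 (y \<ominus>\<^bsub>E\<^esub> b) < e / 2"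
      using xy e2 unfolding cl_def by blast
    have abE: "a \<in> carrier E" "b \<in> carrier E" using ab A by auto
    have "gauge 1 (mix f x y \<ominus>\<^bsub>E\<^esub> mix f a b) \<le> gauge 1 (x \<ominus>\<^bsub>E\<^esub> a) + gauge 1 (y \<ominus>\<^bsub>E\<^esub> b)"
    proof (rule gauge_le_add)
      have "AE w in M. nrm (mix f x y \<ominus>\<^bsub>E\<^esub> mix f a b) w
          \<le> f w * nrm (x \<ominus>\<^bsub>E\<^esub> a) w + (1 - f w) * nrm (y \<ominus>\<^bsub>E\<^esub> b) w"
        using nrm_mix_le[OF f, of "x \<ominus>\<^bsub>E\<^esub> a" "y \<ominus>\<^bsub>E\<^esub> b"] E abE f mix_minus_mix[of f x y a b] by simp
      then show "AE w in M. 1 * nrm (mix f x y \<ominus>\<^bsub>E\<^esub> mix f a b) w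
          \<le> 1 * nrm (x \<ominus>\<^bsub>E\<^esub> a) w + 1 * nrm (y \<ominus>\<^bsub>E\<^esub> b) w"
      proof eventually_elim
        case (elim w)
        have "f w * nrm (x \<ominus>\<^bsub>E\<^esub> a) w \<le> 1 * nrm (x \<ominus>\<^bsub>E\<^esub> a) w"
          "(1 - f w) * nrm (y \<ominus>\<^bsub>E\<^esub> b) w \<le> 1 * nrm (y \<ominus>\<^bsub>E\<^esub> b) w"
          using f E abE by (intro mult_right_mono; simp add: nrm_nonneg)+
        then show ?case using elim by simp
      qed
    qed (use E abE f in auto)
    then show ?thesis using ab f L0_convexD[OF A(2) ab(1,3) f(1)] f(2) by (intro bexI[of _ "mix f a b"]) auto
  qed
  then show "mix f x y \<in> cl A" using E f by (auto simp: cl_def)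
qed (auto simp: cl_def)

lemma gauge_complete:
  fixes s :: "nat \<Rightarrow> 'e"
  assumes "rn_complete M E" "\<And>n. s n \<in> carrier E"
    and "\<And>e. 0 < e \<Longrightarrow> \<exists>N. \<forall>m\<ge>N. \<forall>n\<ge>N. gauge 1 (s m \<ominus>\<^bsub>E\<^esub> s n) < e"
  shows "\<exists>x\<in>carrier E. \<forall>e>0. \<exists>N. \<forall>n\<ge>N. gauge 1 (s n \<ominus>\<^bsub>E\<^esub> x) < e"
proof -
  have "\<exists>N. \<forall>m\<ge>N. \<forall>n\<ge>N. s m \<ominus>\<^bsub>E\<^esub> s n \<in> rn_nbhd M E \<epsilon> l" if el: "0 < \<epsilon>" "0 < l" for \<epsilon> l
  proof -
    have "0 < min \<epsilon> 1 * l" using el by simp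
    then obtain N where N: "\<And>m n. m \<ge> N \<Longrightarrow> n \<ge> N \<Longrightarrow> gauge 1 (s m \<ominus>\<^bsub>E\<^esub> s n) < min \<epsilon> 1 * l"
      using assms(3) by blast
    have "s m \<ominus>\<^bsub>E\<^esub> s n \<in> rn_nbhd M E \<epsilon> l" if "m \<ge> N" "n \<ge> N" for m n
      using N[OF that] el assms(2) by (intro nbhd_of_gauge_less) auto
    then show ?thesis by blast
  qed
  then obtain x where x: "x \<in> carrier E" "limitin (eps_lambda_topology M E) s x sequentially"
    using assms(1)[unfolded rn_complete_def, rule_format, of s] assms(2) by blast
  have "\<exists>N. \<forall>n\<ge>N. gauge 1 (s n \<ominus>\<^bsub>E\<^esub> x) < e" if "0 < e" for e
  proof -
    have "x \<ominus>\<^bsub>E\<^esub> x = \<zero>\<^bsub>E\<^esub>" using x by (simp add: a_minus_def M.r_neg)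
    then have "x \<in> {y \<in> carrier E. gauge 1 (y \<ominus>\<^bsub>E\<^esub> x) < e}"
      using x that by (simp add: gauge_zero)
    then show ?thesis
      using x(2) openin_gauge_ball[OF x(1), of e] unfolding limitin_def eventually_sequentially by blast
  qed
  then show ?thesis using x by blast
qed

text \<open>The finite intersection property is always applied to downward directed families: nested
  sequences, chains, and sublevel sets of a function whose values form a downward directed family.\<close>

lemma convexly_compact_directed_Inter:
  assumes G: "L0_convexly_compact M E G"
    and sub: "\<And>A. A \<in> \<A> \<Longrightarrow> A \<noteq> {} \<and> A \<subseteq> G \<and> closedin (eps_lambda_topology M E) A \<and> L0_convex M E A"
    and dir: "\<And>A B. A \<in> \<A> \<Longrightarrow> B \<in> \<A> \<Longrightarrow> \<exists>C\<in>\<A>. C \<subseteq> A \<inter> B"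
  shows "\<Inter>\<A> \<noteq> {}"
proof -
  have lower: "\<F> \<noteq> {} \<longrightarrow> (\<exists>C\<in>\<A>. C \<subseteq> \<Inter>\<F>)" if "finite \<F>" "\<F> \<subseteq> \<A>" for \<F>
    using that
  proof (induction rule: finite_induct)
    case (insert A \<F>)
    show ?case
    proof (cases "\<F> = {}")
      case True
      then show ?thesis using insert.prems by auto
    next
      case False
      then obtain C where "C \<in> \<A>" "C \<subseteq> \<Inter>\<F>" using insert by auto
      moreover from this obtain D where "D \<in> \<A>" "D \<subseteq> A \<inter> C" using dir[of A C] insert.prems by auto
      ultimately show ?thesis by auto
    qed
  qed simp
  have "\<Inter>\<F> \<noteq> {}" if fin: "finite \<F>" "\<F> \<subseteq> \<A>" for \<F>
  proof (cases "\<F> = {}")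
    case False
    then obtain C where "C \<in> \<A>" "C \<subseteq> \<Inter>\<F>" using lower[OF fin] False by blast
    then show ?thesis using sub by blast
  qed simp
  moreover have "(\<forall>A\<in>\<A>. A \<subseteq> G \<and> closedin (eps_lambda_topology M E) A \<and> L0_convex M E A) \<longrightarrow>
      (\<forall>\<F>\<subseteq>\<A>. finite \<F> \<longrightarrow> \<Inter>\<F> \<noteq> {}) \<longrightarrow> \<Inter>\<A> \<noteq> {}"
    using G unfolding L0_convexly_compact_def by (elim conjE allE[of _ \<A>])
  ultimately show ?thesis using sub by simp
qed

lemma convexly_compact_subset:
  assumes "L0_convexly_compact M E G" "H \<subseteq> G" "H \<noteq> {}"
    "closedin (eps_lambda_topology M E) H" "L0_convex M E H"
  shows "L0_convexly_compact M E H"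
  unfolding L0_convexly_compact_def
proof (intro conjI allI impI)
  fix \<A> assume "\<forall>A\<in>\<A>. A \<subseteq> H \<and> closedin (eps_lambda_topology M E) A \<and> L0_convex M E A"
    and "\<forall>\<F>\<subseteq>\<A>. finite \<F> \<longrightarrow> \<Inter>\<F> \<noteq> {}"
  moreover from this have "\<forall>A\<in>\<A>. A \<subseteq> G \<and> closedin (eps_lambda_topology M E) A \<and> L0_convex M E A"
    using assms by blast
  moreover have "(\<forall>A\<in>\<A>. A \<subseteq> G \<and> closedin (eps_lambda_topology M E) A \<and> L0_convex M E A) \<longrightarrow>
      (\<forall>\<F>\<subseteq>\<A>. finite \<F> \<longrightarrow> \<Inter>\<F> \<noteq> {}) \<longrightarrow> \<Inter>\<A> \<noteq> {}"
    using assms(1) unfolding L0_convexly_compact_def by (elim conjE allE[of _ \<A>])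
  ultimately show "\<Inter>\<A> \<noteq> {}" by (elim mp[THEN mp])
qed (use assms in auto)

lemma convexly_compact_carrier:
  "L0_convexly_compact M E G \<Longrightarrow> G \<subseteq> carrier E"
  by (simp add: L0_convexly_compact_def closedin_iff_cl)

lemma closedin_Inter_carrier:
  assumes "\<A> \<noteq> {}" "\<And>A. A \<in> \<A> \<Longrightarrow> closedin (eps_lambda_topology M E) A"
  shows "closedin (eps_lambda_topology M E) (\<Inter>\<A>)"
  using assms by (intro closedin_Inter) auto

lemma L0_convex_Inter:
  assumes "\<And>A. A \<in> \<A> \<Longrightarrow> L0_convex M E A"
  shows "L0_convex M E (\<Inter>\<A>)"
  unfolding L0_convex_def
proof (intro ballI impI InterI)
  fix x y \<xi> A
  assume "x \<in> \<Inter>\<A>" "y \<in> \<Inter>\<A>" "\<xi> \<in> L0_plus M" "L0_le M \<xi> (L0_class M (\<lambda>_. 1))" "A \<in> \<A>"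
  then show "L0_map M of_real \<xi> \<odot>\<^bsub>E\<^esub> x \<oplus>\<^bsub>E\<^esub> L0_map M (\<lambda>t. of_real (1 - t)) \<xi> \<odot>\<^bsub>E\<^esub> y \<in> A"
    using assms[of A] unfolding L0_convex_def by blast
qed

definition ball_in :: "'e set \<Rightarrow> 'e \<Rightarrow> ('w \<Rightarrow> ereal) \<Rightarrow> 'e set" where
  "ball_in G x r = {y \<in> G. AE w in M. ereal (nrm (y \<ominus>\<^bsub>E\<^esub> x) w) \<le> r w}"

lemma closedin_ball_in:
  assumes G: "closedin (eps_lambda_topology M E) G" and "x \<in> carrier E" "r \<in> borel_measurable M"
  shows "closedin (eps_lambda_topology M E) (ball_in G x r)"
proof -
  have GE: "G \<subseteq> carrier E" using G by (simp add: closedin_iff_cl)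
  have "y \<in> ball_in G x r" if y: "y \<in> cl (ball_in G x r)" for y
  proof -
    have "y \<in> G" using cl_minimal[OF _ G, of "ball_in G x r"] y by (auto simp: ball_in_def)
    moreover have "AE w in M. ereal (nrm (y \<ominus>\<^bsub>E\<^esub> x) w) \<le> r w"
      using y GE assms by (intro cl_nrm_le[OF y]) (auto simp: ball_in_def)
    ultimately show ?thesis by (simp add: ball_in_def)
  qed
  moreover have "ball_in G x r \<subseteq> carrier E" using GE by (auto simp: ball_in_def)
  ultimately show ?thesis by (simp add: closedin_iff_cl subset_iff)
qed

lemma L0_convex_ball_in:
  assumes G: "L0_convex M E G" "G \<subseteq> carrier E" and x: "x \<in> carrier E"
  shows "L0_convex M E (ball_in G x r)"
proof (rule L0_convexI)
  show "ball_in G x r \<subseteq> carrier E" using G(2) by (auto simp: ball_in_def)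
  fix y z and f :: "'w \<Rightarrow> real" assume yz: "y \<in> ball_in G x r" "z \<in> ball_in G x r"
    and f: "f \<in> borel_measurable M" "\<And>w. 0 \<le> f w \<and> f w \<le> 1"
  have yzG: "y \<in> G" "z \<in> G" using yz by (auto simp: ball_in_def)
  have E: "y \<in> carrier E" "z \<in> carrier E" using yzG G by auto
  have "mix f y z \<ominus>\<^bsub>E\<^esub> x = mix f (y \<ominus>\<^bsub>E\<^esub> x) (z \<ominus>\<^bsub>E\<^esub> x)"
    using mix_minus_mix[of f y z x x] f E x by simp
  then have "AE w in M. nrm (mix f y z \<ominus>\<^bsub>E\<^esub> x) w
      \<le> f w * nrm (y \<ominus>\<^bsub>E\<^esub> x) w + (1 - f w) * nrm (z \<ominus>\<^bsub>E\<^esub> x) w"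
    using nrm_mix_le[OF f, of "y \<ominus>\<^bsub>E\<^esub> x" "z \<ominus>\<^bsub>E\<^esub> x"] E x by simp
  moreover have "AE w in M. ereal (nrm (y \<ominus>\<^bsub>E\<^esub> x) w) \<le> r w" "AE w in M. ereal (nrm (z \<ominus>\<^bsub>E\<^esub> x) w) \<le> r w"
    using yz by (auto simp: ball_in_def)
  ultimately have "AE w in M. ereal (nrm (mix f y z \<ominus>\<^bsub>E\<^esub> x) w) \<le> r w"
  proof eventually_elim
    case (elim w)
    have "f w * nrm (y \<ominus>\<^bsub>E\<^esub> x) w + (1 - f w) * nrm (z \<ominus>\<^bsub>E\<^esub> x) w
        \<le> max (nrm (y \<ominus>\<^bsub>E\<^esub> x) w) (nrm (z \<ominus>\<^bsub>E\<^esub> x) w)"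
      using f(2)[of w] by (intro convex_bound_le) auto
    then have "nrm (mix f y z \<ominus>\<^bsub>E\<^esub> x) w \<le> max (nrm (y \<ominus>\<^bsub>E\<^esub> x) w) (nrm (z \<ominus>\<^bsub>E\<^esub> x) w)"
      using elim(1) by linarith
    then show ?case using elim(2,3) by (cases "r w") (auto simp: le_max_iff_disj)
  qed
  then show "mix f y z \<in> ball_in G x r"
    using L0_convexD[OF G(1) yzG f(1)] f(2) by (simp add: ball_in_def)
qed

end

section \<open>Essential suprema and random radii\<close>

definition is_esssup :: "'w measure \<Rightarrow> ('w \<Rightarrow> ereal) set \<Rightarrow> ('w \<Rightarrow> ereal) \<Rightarrow> bool" where
  "is_esssup M F s \<longleftrightarrow> s \<in> borel_measurable M \<and> (\<forall>f\<in>F. AE w in M. f w \<le> s w)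
     \<and> (\<forall>t\<in>borel_measurable M. (\<forall>f\<in>F. AE w in M. f w \<le> t w) \<longrightarrow> (AE w in M. s w \<le> t w))"

text \<open>Among the unions of countable subfamilies one has maximal probability, and adding a further
  member of the family to it cannot increase this probability.\<close>

lemma (in prob_space) countable_essential_union:
  assumes "\<A> \<subseteq> events"
  shows "\<exists>\<C>\<subseteq>\<A>. countable \<C> \<and> (\<forall>A\<in>\<A>. AE w in M. w \<in> A \<longrightarrow> w \<in> \<Union>\<C>)"
proof -
  let ?S = "{\<C>. \<C> \<subseteq> \<A> \<and> countable \<C>}"
  define m where "m = (SUP \<C>\<in>?S. prob (\<Union>\<C>))"
  have bdd: "bdd_above ((\<lambda>\<C>. prob (\<Union>\<C>)) ` ?S)" by (rule bdd_aboveI[of _ 1]) auto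
  have ne: "?S \<noteq> {}" by auto
  have "\<exists>\<C>\<in>?S. m - 1 / real (Suc n) < prob (\<Union>\<C>)" for n
    using less_cSUP_iff[OF ne bdd, of "m - 1 / real (Suc n)"] by (simp add: m_def)
  then obtain \<C> where \<C>: "\<And>n. \<C> n \<in> ?S" "\<And>n. m - 1 / real (Suc n) < prob (\<Union>(\<C> n))"
    by metis
  define \<D> where "\<D> = (\<Union>n. \<C> n)"
  have \<D>: "\<D> \<subseteq> \<A>" "countable \<D>" using \<C>(1) by (auto simp: \<D>_def)
  have meas: "\<Union>\<B> \<in> events" if "\<B> \<subseteq> \<A>" "countable \<B>" for \<B>
    using that assms by (intro sets.countable_Union) auto
  have "m \<le> prob (\<Union>\<D>)"
  proof (rule LIMSEQ_le_const2)
    have "(\<lambda>n. m - 1 / real (Suc n)) \<longlonglongrightarrow> m - 0" by (intro tendsto_intros LIMSEQ_Suc[OF lim_1_over_n])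
    then show "(\<lambda>n. m - 1 / real (Suc n)) \<longlonglongrightarrow> m" by simp
    have "prob (\<Union>(\<C> n)) \<le> prob (\<Union>\<D>)" for n
      using meas[OF \<D>] by (intro finite_measure_mono) (auto simp: \<D>_def)
    then show "\<exists>N. \<forall>n\<ge>N. m - 1 / real (Suc n) \<le> prob (\<Union>\<D>)"
      using \<C>(2) by (meson less_imp_le order_trans)
  qed
  have "AE w in M. w \<in> A \<longrightarrow> w \<in> \<Union>\<D>" if A: "A \<in> \<A>" for A
  proof -
    have "insert A \<D> \<in> ?S" using A \<D> by auto
    then have "prob (\<Union>(insert A \<D>)) \<le> m" unfolding m_def by (intro cSUP_upper bdd)
    then have "prob (\<Union>\<D> \<union> (A - \<Union>\<D>)) \<le> prob (\<Union>\<D>)"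
      using \<open>m \<le> prob (\<Union>\<D>)\<close> by (simp add: Un_commute)
    moreover have "prob (\<Union>\<D> \<union> (A - \<Union>\<D>)) = prob (\<Union>\<D>) + prob (A - \<Union>\<D>)"
      using meas[OF \<D>] A assms by (intro finite_measure_Union) auto
    ultimately have "prob (A - \<Union>\<D>) = 0" by (simp add: measure_le_0_iff)
    then have "AE w in M. w \<notin> A - \<Union>\<D>"
      using meas[OF \<D>] A assms by (subst (asm) prob_eq_0) auto
    then show ?thesis by eventually_elim auto
  qed
  with \<D> show ?thesis by blast
qed

text \<open>The essential supremum is obtained by exhausting, for every rational level \<open>c\<close>, the sets where
  a member exceeds \<open>c\<close>.\<close>

lemma (in prob_space) esssup_exists:
  fixes F :: "('a \<Rightarrow> ereal) set"
  assumes F: "F \<subseteq> borel_measurable M"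
  shows "\<exists>C\<subseteq>F. countable C \<and> is_esssup M F (\<lambda>w. SUP f\<in>C. f w)"
proof -
  let ?L = "\<lambda>c f. {w \<in> space M. ereal (of_rat c) < f w}"
  have level: "\<exists>C\<subseteq>F. countable C \<and> (\<forall>f\<in>F. AE w in M. w \<in> ?L c f \<longrightarrow> (\<exists>g\<in>C. w \<in> ?L c g))" for c :: rat
  proof -
    have "\<exists>\<C>\<subseteq>?L c ` F. countable \<C> \<and> (\<forall>A\<in>?L c ` F. AE w in M. w \<in> A \<longrightarrow> w \<in> \<Union>\<C>)"
      by (rule countable_essential_union) (use F in auto)
    then obtain \<C> where \<C>: "\<C> \<subseteq> ?L c ` F" "countable \<C>"
      "\<forall>A\<in>?L c ` F. AE w in M. w \<in> A \<longrightarrow> w \<in> \<Union>\<C>"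
      by (elim exE conjE)
    obtain C where C: "C \<subseteq> F" "countable C" "\<C> = ?L c ` C"
      using \<C>(1,2) countable_subset_image[of \<C> "?L c" F] by auto
    then show ?thesis using \<C>(3) by (intro exI[of _ C]) auto
  qed
  have "\<exists>C. \<forall>c. C c \<subseteq> F \<and> countable (C c) \<and>
      (\<forall>f\<in>F. AE w in M. w \<in> ?L c f \<longrightarrow> (\<exists>g\<in>C c. w \<in> ?L c g))"
    by (rule choice) (intro allI level)
  then obtain C where "\<forall>c. C c \<subseteq> F \<and> countable (C c) \<and>
      (\<forall>f\<in>F. AE w in M. w \<in> ?L c f \<longrightarrow> (\<exists>g\<in>C c. w \<in> ?L c g))" ..
  then have C: "\<And>c. C c \<subseteq> F" "\<And>c. countable (C c)"
    "\<And>c f. f \<in> F \<Longrightarrow> AE w in M. w \<in> ?L c f \<longrightarrow> (\<exists>g\<in>C c. w \<in> ?L c g)"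
    by simp_all
  define D where "D = (\<Union>c::rat. C c)"
  have D: "D \<subseteq> F" "countable D" using C by (auto simp: D_def)
  let ?s = "\<lambda>w. SUP f\<in>D. f w"
  have s: "?s \<in> borel_measurable M"
    using D F by (intro borel_measurable_SUP) auto
  have "AE w in M. f w \<le> ?s w" if f: "f \<in> F" for f
  proof -
    have "AE w in M. \<forall>c::rat. w \<in> ?L c f \<longrightarrow> (\<exists>g\<in>C c. w \<in> ?L c g)"
      unfolding AE_all_countable using C(3)[OF f] by blast
    then show ?thesis
    proof (rule AE_mp, intro AE_I2 impI)
      fix w assume w: "w \<in> space M" and *: "\<forall>c::rat. w \<in> ?L c f \<longrightarrow> (\<exists>g\<in>C c. w \<in> ?L c g)"
      show "f w \<le> ?s w"
      proof (rule ccontr)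
        assume "\<not> f w \<le> ?s w"
        then obtain a where a: "?s w < a" "a < f w" by (meson dense not_le)
        obtain c :: rat where c: "?s w < ereal (of_rat c)" "ereal (of_rat c) < f w"
        proof -
          obtain r1 where r1: "?s w < ereal r1" "ereal r1 < a" using ereal_dense2[OF a(1)] by blast
          have "ereal r1 < f w" using r1(2) a(2) by simp
          then obtain r2 where r2: "ereal r1 < ereal r2" "ereal r2 < f w" using ereal_dense2 by blast
          obtain c where c: "r1 < of_rat c" "of_rat c < r2" using of_rat_dense[of r1 r2] r2(1) by auto
          have "?s w < ereal (of_rat c)" using r1(1) c(1) by (meson less_ereal.simps(1) less_trans)
          moreover have "ereal (of_rat c) < f w" using r2(2) c(2) by (meson less_ereal.simps(1) less_trans)
          ultimately show thesis by (rule that)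
        qed
        then obtain g where g: "g \<in> C c" "ereal (of_rat c) < g w" using * w by blast
        have "g w \<le> ?s w" using g(1) by (intro SUP_upper) (auto simp: D_def)
        then show False using c(1) g(2) by simp
      qed
    qed
  qed
  moreover have "AE w in M. ?s w \<le> t w" if "\<forall>f\<in>F. AE w in M. f w \<le> t w" for t
  proof -
    have "AE w in M. \<forall>f\<in>D. f w \<le> t w"
      using D that by (simp add: AE_ball_countable subset_iff)
    then show ?thesis by eventually_elim (auto intro: SUP_least)
  qed
  ultimately have "is_esssup M F ?s" using s by (auto simp: is_esssup_def)
  with D show ?thesis by blast
qed

lemma L0_le_antisym:
  assumes "a \<in> L0 M" "b \<in> L0 M" "L0_le M a b" "L0_le M b a"
  shows "a = (b :: ('w \<Rightarrow> ereal) set)"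
proof -
  obtain f g where fg: "f \<in> borel_measurable M" "a = L0_class M f" "g \<in> borel_measurable M" "b = L0_class M g"
    using assms by (auto simp: L0_def)
  then have "AE w in M. f w \<le> g w" "AE w in M. g w \<le> f w"
    using assms by (simp_all add: L0_le_class_iff)
  then have "AE w in M. f w = g w" by eventually_elim simp
  then show ?thesis using fg by (simp add: L0_class_eq_iff)
qed

lemma L0bar_sup_eq:
  assumes F: "F \<subseteq> borel_measurable M" and s: "is_esssup M F s"
  shows "\<Squnion>\<^bsub>L0bar M\<^esub> (L0_class M ` F) = L0_class M s"
proof -
  have sm: "s \<in> borel_measurable M" using s by (simp add: is_esssup_def)
  have least: "least (L0bar M) (L0_class M s) (Upper (L0bar M) (L0_class M ` F))"
    unfolding least_def
  proof (intro conjI ballI)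
    show "L0_class M s \<in> Upper (L0bar M) (L0_class M ` F)"
      using s F by (auto simp: Upper_def L0bar_def L0_class_in_L0 is_esssup_def L0_le_class_iff subset_iff)
    fix u assume "u \<in> Upper (L0bar M) (L0_class M ` F)"
    then obtain t where t: "t \<in> borel_measurable M" "u = L0_class M t"
      "\<And>f. f \<in> F \<Longrightarrow> L0_le M (L0_class M f) u"
      using F by (auto simp: Upper_def L0bar_def L0_def)
    then have "\<forall>f\<in>F. AE w in M. f w \<le> t w" using F by (auto simp: L0_le_class_iff subset_iff)
    then have "AE w in M. s w \<le> t w" using s t by (simp add: is_esssup_def)
    then show "L0_class M s \<sqsubseteq>\<^bsub>L0bar M\<^esub> u" using t sm by (simp add: L0bar_def L0_le_class_iff)
  qed (auto simp: Upper_def)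
  moreover have "x = L0_class M s" if x: "least (L0bar M) x (Upper (L0bar M) (L0_class M ` F))" for x
    using x least by (intro L0_le_antisym[of _ M]) (auto simp: least_def L0bar_def Upper_def)
  ultimately show ?thesis unfolding Lattice.sup_def by (intro some_equality)
qed

lemma L0bar_inf_eq:
  assumes F: "F \<subseteq> borel_measurable M" and s: "s \<in> F" "\<And>f. f \<in> F \<Longrightarrow> AE w in M. s w \<le> f w"
  shows "\<Sqinter>\<^bsub>L0bar M\<^esub> (L0_class M ` F) = L0_class M s"
proof -
  have greatest: "greatest (L0bar M) (L0_class M s) (Lower (L0bar M) (L0_class M ` F))"
    using F s by (auto simp: greatest_def Lower_def L0bar_def L0_class_in_L0 L0_le_class_iff subset_iff)
  moreover have "x = L0_class M s" if x: "greatest (L0bar M) x (Lower (L0bar M) (L0_class M ` F))" for x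
    using x greatest by (intro L0_le_antisym[of _ M]) (auto simp: greatest_def L0bar_def Lower_def)
  ultimately show ?thesis unfolding Lattice.inf_def by (intro some_equality)
qed

context random_normed_module
begin

definition rad :: "'e set \<Rightarrow> 'e \<Rightarrow> 'w \<Rightarrow> ereal" where
  "rad H x = (SOME s. is_esssup M ((\<lambda>y w. ereal (nrm (x \<ominus>\<^bsub>E\<^esub> y) w)) ` H) s)"

lemma is_esssup_rad:
  assumes "H \<subseteq> carrier E" "x \<in> carrier E"
  shows "is_esssup M ((\<lambda>y w. ereal (nrm (x \<ominus>\<^bsub>E\<^esub> y) w)) ` H) (rad H x)"
proof -
  have "(\<lambda>y w. ereal (nrm (x \<ominus>\<^bsub>E\<^esub> y) w)) ` H \<subseteq> borel_measurable M"
    using assms by auto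
  then have "\<exists>s. is_esssup M ((\<lambda>y w. ereal (nrm (x \<ominus>\<^bsub>E\<^esub> y) w)) ` H) s"
    using esssup_exists by blast
  then show ?thesis unfolding rad_def by (rule someI_ex)
qed

lemma rad:
  assumes "H \<subseteq> carrier E" "x \<in> carrier E"
  shows rad_measurable: "rad H x \<in> borel_measurable M"
    and rad_upper: "y \<in> H \<Longrightarrow> AE w in M. ereal (nrm (x \<ominus>\<^bsub>E\<^esub> y) w) \<le> rad H x w"
    and rad_least: "t \<in> borel_measurable M \<Longrightarrow> (\<And>y. y \<in> H \<Longrightarrow> AE w in M. ereal (nrm (x \<ominus>\<^bsub>E\<^esub> y) w) \<le> t w)
      \<Longrightarrow> AE w in M. rad H x w \<le> t w"
  using is_esssup_rad[OF assms] by (auto simp: is_esssup_def)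

lemma rdist_eq:
  assumes "x \<in> carrier E" "y \<in> carrier E"
  shows "rdist M E x y = L0_class M (\<lambda>w. ereal (nrm (x \<ominus>\<^bsub>E\<^esub> y) w))"
  using assms by (simp add: rdist_def rnorm_nrm L0_map_class)

lemma radius_at_eq:
  assumes "H \<subseteq> carrier E" "x \<in> carrier E"
  shows "radius_at M E H x = L0_class M (rad H x)"
proof -
  have "{rdist M E x y |y. y \<in> H} = L0_class M ` ((\<lambda>y w. ereal (nrm (x \<ominus>\<^bsub>E\<^esub> y) w)) ` H)"
    unfolding Setcompr_eq_image image_image
    by (rule image_cong) (use assms in \<open>auto simp: rdist_eq subset_iff\<close>)
  moreover have "(\<lambda>y w. ereal (nrm (x \<ominus>\<^bsub>E\<^esub> y) w)) ` H \<subseteq> borel_measurable M"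
    using assms by auto
  ultimately show ?thesis
    unfolding radius_at_def using L0bar_sup_eq is_esssup_rad[OF assms] by metis
qed

lemma diam_eq:
  assumes H: "H \<subseteq> carrier E"
  shows "\<exists>d. is_esssup M ((\<lambda>(x, y) w. ereal (nrm (x \<ominus>\<^bsub>E\<^esub> y) w)) ` (H \<times> H)) d
    \<and> diam M E H = L0_class M d"
proof -
  let ?F = "(\<lambda>(x, y) w. ereal (nrm (x \<ominus>\<^bsub>E\<^esub> y) w)) ` (H \<times> H)"
  have F: "?F \<subseteq> borel_measurable M" using H by (auto simp: subset_iff)
  then obtain d where d: "is_esssup M ?F d" using esssup_exists by blast
  have "{rdist M E x y |x y. x \<in> H \<and> y \<in> H} = (\<lambda>(x, y). rdist M E x y) ` (H \<times> H)" by auto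
  also have "\<dots> = L0_class M ` ?F"
    unfolding image_image by (rule image_cong) (use H in \<open>auto simp: rdist_eq subset_iff\<close>)
  finally have "diam M E H = L0_class M d"
    unfolding diam_def using L0bar_sup_eq[OF F d] by simp
  with d show ?thesis by blast
qed

lemma chebyshev_centerI:
  assumes G: "G \<subseteq> carrier E" and x: "x \<in> G" and min: "\<And>y. y \<in> G \<Longrightarrow> AE w in M. rad G x w \<le> rad G y w"
  shows "x \<in> chebyshev_center M E G G"
proof -
  have "{radius_at M E G y |y. y \<in> G} = L0_class M ` (rad G ` G)"
    unfolding Setcompr_eq_image image_image
    by (rule image_cong) (use G in \<open>auto simp: radius_at_eq subset_iff\<close>)
  moreover have "rad G ` G \<subseteq> borel_measurable M" using rad_measurable G by blast
  then have "\<Sqinter>\<^bsub>L0bar M\<^esub> (L0_class M ` (rad G ` G)) = L0_class M (rad G x)"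
    by (rule L0bar_inf_eq) (use x min in auto)
  ultimately have "radius M E G G = L0_class M (rad G x)" by (simp add: radius_def)
  moreover have "radius_at M E G x = L0_class M (rad G x)" using G x by (intro radius_at_eq) auto
  ultimately show ?thesis using x by (simp add: chebyshev_center_def)
qed

text \<open>By mixing with the indicator of the set where \<open>nrm y \<le> nrm x\<close>, the norms of the elements of an
  \<open>L0\<close>-convex set form an upward directed family. This is why boundedness in probability, which
  bounds one element at a time, already bounds the essential supremum.\<close>

lemma L0_convex_nrm_directed:
  assumes G: "L0_convex M E G" "G \<subseteq> carrier E" and xy: "x \<in> G" "y \<in> G"
  obtains z where "z \<in> G" "AE w in M. nrm x w \<le> nrm z w \<and> nrm y w \<le> nrm z w"
proof -
  have E: "x \<in> carrier E" "y \<in> carrier E" using xy G by auto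
  note [measurable] = nrm_measurable[OF E(1)] nrm_measurable[OF E(2)]
  define f :: "'w \<Rightarrow> real" where "f = indicator {w \<in> space M. nrm y w \<le> nrm x w}"
  have f: "f \<in> borel_measurable M" "\<And>w. 0 \<le> f w \<and> f w \<le> 1"
    by (auto simp: f_def indicator_def)
  define z where "z = mix f x y"
  have z: "z \<in> G" "z \<in> carrier E" using L0_convexD[OF G(1) xy f(1)] f G by (auto simp: z_def)
  have "mix f x y \<ominus>\<^bsub>E\<^esub> mix f x x = mix f (x \<ominus>\<^bsub>E\<^esub> x) (y \<ominus>\<^bsub>E\<^esub> x)"
    "mix f x y \<ominus>\<^bsub>E\<^esub> mix f y y = mix f (x \<ominus>\<^bsub>E\<^esub> y) (y \<ominus>\<^bsub>E\<^esub> y)"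
    using E f by (intro mix_minus_mix; simp)+
  then have diff: "z \<ominus>\<^bsub>E\<^esub> x = mix f \<zero>\<^bsub>E\<^esub> (y \<ominus>\<^bsub>E\<^esub> x)" "z \<ominus>\<^bsub>E\<^esub> y = mix f (x \<ominus>\<^bsub>E\<^esub> y) \<zero>\<^bsub>E\<^esub>"
    using E f by (simp_all add: z_def a_minus_def M.r_neg)
  have *: "AE w in M. nrm a w \<le> nrm z w + nrm (z \<ominus>\<^bsub>E\<^esub> a) w" if a: "a \<in> carrier E" for a
  proof -
    have "z \<oplus>\<^bsub>E\<^esub> (a \<ominus>\<^bsub>E\<^esub> z) = a" using a z by (simp add: a_minus_def M.a_lcomm M.r_neg)
    then have "AE w in M. nrm a w \<le> nrm z w + nrm (a \<ominus>\<^bsub>E\<^esub> z) w"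
      using nrm_add_le[of z "a \<ominus>\<^bsub>E\<^esub> z"] a z by simp
    moreover have "AE w in M. nrm (a \<ominus>\<^bsub>E\<^esub> z) w = nrm (z \<ominus>\<^bsub>E\<^esub> a) w"
      using a z by (intro nrm_minus_commute)
    ultimately show ?thesis by eventually_elim simp
  qed
  have "AE w in M. nrm (z \<ominus>\<^bsub>E\<^esub> x) w \<le> f w * nrm \<zero>\<^bsub>E\<^esub> w + (1 - f w) * nrm (y \<ominus>\<^bsub>E\<^esub> x) w"
    unfolding diff using E f by (intro nrm_mix_le) auto
  moreover have "AE w in M. nrm (z \<ominus>\<^bsub>E\<^esub> y) w \<le> f w * nrm (x \<ominus>\<^bsub>E\<^esub> y) w + (1 - f w) * nrm \<zero>\<^bsub>E\<^esub> w"
    unfolding diff using E f by (intro nrm_mix_le) auto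
  ultimately have "AE w in M. nrm x w \<le> nrm z w \<and> nrm y w \<le> nrm z w"
    using *[OF E(1)] *[OF E(2)] nrm_zero AE_space
  proof eventually_elim
    case (elim w)
    then show ?case by (cases "nrm y w \<le> nrm x w") (auto simp: f_def indicator_def)
  qed
  with z show thesis using that by blast
qed

text \<open>The essential supremum of the norms is the supremum of countably many of them. Finitely many of
  these are dominated by the norm of a single element of \<open>G\<close>, for which Markov's inequality bounds the
  probability of large values. This bound passes to the limit.\<close>

lemma as_boundedI:
  assumes G: "L0_convex M E G" "G \<subseteq> carrier E" "G \<noteq> {}"
    and small: "\<And>e. 0 < e \<Longrightarrow> \<exists>c>0. \<forall>g\<in>G. gauge c g \<le> e"
  shows "as_bounded M E G"
proof -
  let ?F = "(\<lambda>g w. ereal (nrm g w)) ` G"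
  have F: "?F \<subseteq> borel_measurable M" using G by auto
  obtain C where C: "C \<subseteq> ?F" "countable C" "is_esssup M ?F (\<lambda>w. SUP f\<in>C. f w)"
    using esssup_exists[OF F] by blast
  define s where "s w = (SUP f\<in>C. f w)" for w
  have s: "is_esssup M ?F s" using C by (simp add: s_def[abs_def])
  have [measurable]: "s \<in> borel_measurable M" using s by (simp add: is_esssup_def)
  have s_nonneg: "AE w in M. 0 \<le> s w"
  proof -
    obtain g where g: "g \<in> G" using G by auto
    then have "AE w in M. ereal (nrm g w) \<le> s w" using s by (auto simp: is_esssup_def)
    then show ?thesis
    proof eventually_elim
      case (elim w)
      have "ereal 0 \<le> ereal (nrm g w)" using nrm_nonneg[of g] g G by auto
      then show ?case using elim by (metis order_trans zero_ereal_def)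
    qed
  qed
  have "AE w in M. s w \<noteq> \<infinity>"
  proof (cases "C = {}")
    case True
    then show ?thesis by (simp add: s_def bot_ereal_def)
  next
    case False
    obtain D where D: "D \<subseteq> G" "countable D" "C = (\<lambda>g w. ereal (nrm g w)) ` D"
      using C(1,2) by (metis countable_subset_image)
    then obtain d :: "nat \<Rightarrow> 'e" where d: "range d = D"
      using False uncountable_def by (metis image_is_empty)
    have dG: "d n \<in> G" for n using d D by auto
    have dE: "d n \<in> carrier E" for n using dG G by auto
    note [measurable] = nrm_measurable[OF dE]
    have dir: "\<exists>h\<in>G. AE w in M. \<forall>k\<le>n. nrm (d k) w \<le> nrm h w" for n
    proof (induction n)
      case 0
      show ?case using dG by (intro bexI[of _ "d 0"]) auto
    next
      case (Suc n)
      then obtain h where h: "h \<in> G" "AE w in M. \<forall>k\<le>n. nrm (d k) w \<le> nrm h w" by blast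
      obtain z where z: "z \<in> G" "AE w in M. nrm h w \<le> nrm z w \<and> nrm (d (Suc n)) w \<le> nrm z w"
        using L0_convex_nrm_directed[OF G(1,2) h(1) dG] by blast
      have "AE w in M. \<forall>k\<le>Suc n. nrm (d k) w \<le> nrm z w"
        using h(2) z(2) by eventually_elim (auto simp: le_Suc_eq intro: order_trans)
      with z show ?case by blast
    qed
    have "prob {w \<in> space M. s w = \<infinity>} \<le> 0"
    proof (rule field_le_epsilon)
      fix e :: real assume "0 < e"
      then obtain c where c: "0 < c" "\<And>g. g \<in> G \<Longrightarrow> gauge c g \<le> e" using small by blast
      define B where "B n = {w \<in> space M. \<exists>k\<le>n. 1 \<le> c * nrm (d k) w}" for n
      have [measurable]: "B n \<in> events" for n unfolding B_def by measurable
      have "prob (B n) \<le> e" for n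
      proof -
        obtain h where h: "h \<in> G" "AE w in M. \<forall>k\<le>n. nrm (d k) w \<le> nrm h w" using dir by blast
        have hE: "h \<in> carrier E" using h G by auto
        note [measurable] = nrm_measurable[OF hE]
        have "prob (B n) \<le> prob {w \<in> space M. 1 \<le> c * nrm h w}"
        proof (rule finite_measure_mono_AE)
          show "AE w in M. w \<in> B n \<longrightarrow> w \<in> {w \<in> space M. 1 \<le> c * nrm h w}"
            using h(2)
          proof eventually_elim
            case (elim w)
            show ?case
            proof
              assume "w \<in> B n"
              then obtain k where k: "w \<in> space M" "k \<le> n" "1 \<le> c * nrm (d k) w" by (auto simp: B_def)
              then have "c * nrm (d k) w \<le> c * nrm h w" using elim c(1) by (intro mult_left_mono) auto
              then show "w \<in> {w \<in> space M. 1 \<le> c * nrm h w}" using k by simp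
            qed
          qed
        qed measurable
        also have "\<dots> \<le> gauge c h" using prob_nrm_ge_le_gauge[OF hE, of 1 c] c by simp
        also have "\<dots> \<le> e" using c h by simp
        finally show ?thesis .
      qed
      moreover have "(\<lambda>n. prob (B n)) \<longlonglongrightarrow> prob (\<Union>n. B n)"
        by (rule finite_Lim_measure_incseq) (auto simp: incseq_def B_def intro: order_trans)
      ultimately have "prob (\<Union>n. B n) \<le> e" by (intro LIMSEQ_le_const2) auto
      moreover have "{w \<in> space M. s w = \<infinity>} \<subseteq> (\<Union>n. B n)"
      proof
        fix w assume w: "w \<in> {w \<in> space M. s w = \<infinity>}"
        then have "ereal (1 / c) < (SUP f\<in>C. f w)" by (simp add: s_def)
        then obtain n where "ereal (1 / c) < ereal (nrm (d n) w)"
          unfolding less_SUP_iff D(3) d[symmetric] by blast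
        then have "1 \<le> c * nrm (d n) w" using c(1) by (simp add: field_simps)
        then show "w \<in> (\<Union>n. B n)" using w by (auto simp: B_def)
      qed
      then have "prob {w \<in> space M. s w = \<infinity>} \<le> prob (\<Union>n. B n)" by (intro finite_measure_mono) auto
      ultimately show "prob {w \<in> space M. s w = \<infinity>} \<le> 0 + e" by simp
    qed
    then have "prob {w \<in> space M. s w = \<infinity>} = 0" by (simp add: measure_le_0_iff)
    then have "AE w in M. w \<notin> {w \<in> space M. s w = \<infinity>}" by (subst (asm) prob_eq_0) auto
    with AE_space show ?thesis by eventually_elim auto
  qed
  with s_nonneg have fin: "AE w in M. s w = ereal (real_of_ereal (s w))"
  proof eventually_elim
    case (elim w)
    then show ?case by (cases "s w") auto
  qed
  have "(\<lambda>g. L0_map M ereal (rnorm E g)) ` G = L0_class M ` ?F"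
    unfolding image_image
  proof (rule image_cong[OF refl])
    fix g assume "g \<in> G"
    then have "g \<in> carrier E" using G by auto
    then show "L0_map M ereal (rnorm E g) = L0_class M (\<lambda>w. ereal (nrm g w))"
      by (simp add: rnorm_nrm L0_map_class)
  qed
  then have "\<Squnion>\<^bsub>L0bar M\<^esub> ((\<lambda>g. L0_map M ereal (rnorm E g)) ` G) = L0_class M s"
    using L0bar_sup_eq[OF F s] by simp
  also have "\<dots> = L0_class M (\<lambda>w. ereal (real_of_ereal (s w)))" by (rule L0_class_cong[OF fin])
  also have "\<dots> = L0_map M ereal (L0_class M (\<lambda>w. real_of_ereal (s w)))" by (simp add: L0_map_class)
  also have "\<dots> \<in> L0_map M ereal ` L0_plus M"
    using s_nonneg by (intro imageI L0_class_in_L0_plus) (auto simp: real_of_ereal_pos)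
  finally show ?thesis unfolding as_bounded_def .
qed

end

section \<open>Convexly compact sets are bounded\<close>

context random_normed_module
begin

lemma add_minus_cancel:
  assumes "x \<in> carrier E" "y \<in> carrier E"
  shows "x \<oplus>\<^bsub>E\<^esub> (y \<ominus>\<^bsub>E\<^esub> x) = y" "(x \<oplus>\<^bsub>E\<^esub> y) \<ominus>\<^bsub>E\<^esub> x = y"
proof -
  have "x \<oplus>\<^bsub>E\<^esub> (y \<ominus>\<^bsub>E\<^esub> x) = x \<oplus>\<^bsub>E\<^esub> (\<ominus>\<^bsub>E\<^esub> x \<oplus>\<^bsub>E\<^esub> y)"
    using assms by (simp add: a_minus_def M.a_comm[of y])
  then show "x \<oplus>\<^bsub>E\<^esub> (y \<ominus>\<^bsub>E\<^esub> x) = y" using assms by (simp add: M.r_neg2)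
  then show "(x \<oplus>\<^bsub>E\<^esub> y) \<ominus>\<^bsub>E\<^esub> x = y" using assms by (simp add: a_minus_def M.a_assoc)
qed

lemma gauge_scale_le:
  assumes "0 \<le> c" "x \<in> carrier E"
  shows "gauge c x \<le> max 1 c * gauge 1 x"
proof -
  have [measurable]: "nrm x \<in> borel_measurable M" using assms by simp
  have int: "integrable M (\<lambda>w. min 1 (d * nrm x w))" if "0 \<le> d" for d
    by (rule integrable_const_bound[of _ 1]) (use assms nrm_nonneg[of x] that in auto)
  have "gauge c x \<le> expectation (\<lambda>w. max 1 c * min 1 (1 * nrm x w))"
    unfolding gauge_def
  proof (rule integral_mono)
    fix w
    show "min 1 (c * nrm x w) \<le> max 1 c * min 1 (1 * nrm x w)"
    proof (cases "nrm x w \<le> 1")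
      case True
      have "c * nrm x w \<le> max 1 c * nrm x w"
        using nrm_nonneg[OF assms(2)] by (intro mult_right_mono) auto
      with True show ?thesis by (simp add: min_def)
    next
      case False
      have "min 1 (c * nrm x w) \<le> 1" by simp
      also have "\<dots> \<le> max 1 c * min 1 (1 * nrm x w)" using False by (simp add: min_def)
      finally show ?thesis .
    qed
  qed (use int[OF assms(1)] int[of 1] in auto)
  then show ?thesis by (simp add: gauge_def)
qed

definition affine_image :: "'e \<Rightarrow> real \<Rightarrow> 'e set \<Rightarrow> 'e set" where
  "affine_image x t G = (\<lambda>g. x \<oplus>\<^bsub>E\<^esub> scale (\<lambda>_. t) g) ` G"

lemma add_scale_minus:
  assumes "x \<in> carrier E" "g \<in> carrier E" "h \<in> carrier E" "f \<in> borel_measurable M"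
  shows "(x \<oplus>\<^bsub>E\<^esub> scale f g) \<ominus>\<^bsub>E\<^esub> (x \<oplus>\<^bsub>E\<^esub> scale f h) = scale f (g \<ominus>\<^bsub>E\<^esub> h)"
proof -
  have "x \<ominus>\<^bsub>E\<^esub> x = \<zero>\<^bsub>E\<^esub>" using assms by (simp add: a_minus_def M.r_neg)
  then show ?thesis using assms by (simp add: add_minus_add scale_minus_right)
qed

lemma closedin_affine_image:
  assumes G: "closedin (eps_lambda_topology M E) G" and x: "x \<in> carrier E" and t: "0 < t"
  shows "closedin (eps_lambda_topology M E) (affine_image x t G)"
proof -
  have GE: "G \<subseteq> carrier E" and clG: "cl G \<subseteq> G" using G by (auto simp: closedin_iff_cl)
  have "y \<in> affine_image x t G" if y: "y \<in> cl (affine_image x t G)" for y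
  proof -
    have yE: "y \<in> carrier E" using y by (simp add: cl_def)
    define u where "u = scale (\<lambda>_. 1 / t) (y \<ominus>\<^bsub>E\<^esub> x)"
    have uE: "u \<in> carrier E" using yE x by (simp add: u_def)
    have "scale (\<lambda>_. t) u = y \<ominus>\<^bsub>E\<^esub> x"
      using t yE x by (simp add: u_def scale_scale)
    then have yu: "y = x \<oplus>\<^bsub>E\<^esub> scale (\<lambda>_. t) u"
      using x yE by (simp add: add_minus_cancel)
    have "\<exists>g\<in>G. gauge 1 (u \<ominus>\<^bsub>E\<^esub> g) < e" if e: "0 < e" for e
    proof -
      have "0 < e / max 1 (1 / t)" using e by simp
      then obtain a where "a \<in> affine_image x t G" and a: "gauge 1 (y \<ominus>\<^bsub>E\<^esub> a) < e / max 1 (1 / t)"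
        using y unfolding cl_def by blast
      then obtain g where g: "g \<in> G" "a = x \<oplus>\<^bsub>E\<^esub> scale (\<lambda>_. t) g" by (auto simp: affine_image_def)
      have E: "g \<in> carrier E" "a \<in> carrier E" using g GE x by auto
      have ya: "y \<ominus>\<^bsub>E\<^esub> a = scale (\<lambda>_. t) (u \<ominus>\<^bsub>E\<^esub> g)"
        unfolding yu g(2) using x E uE by (intro add_scale_minus) auto
      have "AE w in M. nrm (y \<ominus>\<^bsub>E\<^esub> a) w = \<bar>t\<bar> * nrm (u \<ominus>\<^bsub>E\<^esub> g) w"
        unfolding ya using E uE by (intro nrm_scale) auto
      then have "AE w in M. 1 * nrm (u \<ominus>\<^bsub>E\<^esub> g) w \<le> (1 / t) * nrm (y \<ominus>\<^bsub>E\<^esub> a) w"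
        by eventually_elim (use t in simp)
      then have "gauge 1 (u \<ominus>\<^bsub>E\<^esub> g) \<le> gauge (1 / t) (y \<ominus>\<^bsub>E\<^esub> a)"
        using E uE yE t by (intro gauge_le) auto
      also have "\<dots> \<le> max 1 (1 / t) * gauge 1 (y \<ominus>\<^bsub>E\<^esub> a)"
        using E yE t by (intro gauge_scale_le) auto
      also have "\<dots> < e" using a by (simp add: field_simps)
      finally show ?thesis using g by blast
    qed
    then have "u \<in> cl G" using uE by (simp add: cl_def)
    then show ?thesis using yu clG by (auto simp: affine_image_def)
  qed
  moreover have "affine_image x t G \<subseteq> carrier E" using GE x by (auto simp: affine_image_def)
  ultimately show ?thesis by (simp add: closedin_iff_cl subset_iff)
qed

lemma mix_add_scale:
  assumes "x \<in> carrier E" "g \<in> carrier E" "h \<in> carrier E" "f \<in> borel_measurable M"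
    "a \<in> borel_measurable M" "b \<in> borel_measurable M"
  shows "mix f (x \<oplus>\<^bsub>E\<^esub> scale a g) (x \<oplus>\<^bsub>E\<^esub> scale b h)
    = x \<oplus>\<^bsub>E\<^esub> (scale (\<lambda>w. f w * a w) g \<oplus>\<^bsub>E\<^esub> scale (\<lambda>w. (1 - f w) * b w) h)"
proof -
  have m: "(\<lambda>w. 1 - f w) \<in> borel_measurable M" "(\<lambda>w. f w * a w) \<in> borel_measurable M"
    "(\<lambda>w. (1 - f w) * b w) \<in> borel_measurable M" using assms by auto
  have "mix f (x \<oplus>\<^bsub>E\<^esub> scale a g) (x \<oplus>\<^bsub>E\<^esub> scale b h)
      = mix f x x \<oplus>\<^bsub>E\<^esub> (scale (\<lambda>w. f w * a w) g \<oplus>\<^bsub>E\<^esub> scale (\<lambda>w. (1 - f w) * b w) h)"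
    unfolding mix_def using assms m by (simp add: scale_distrib_right scale_scale M.a_ac)
  then show ?thesis using assms by simp
qed

lemma L0_convex_affine_image:
  assumes G: "L0_convex M E G" "G \<subseteq> carrier E" and x: "x \<in> carrier E"
  shows "L0_convex M E (affine_image x t G)"
proof (rule L0_convexI)
  show "affine_image x t G \<subseteq> carrier E" using G(2) x by (auto simp: affine_image_def)
  fix a b and f :: "'w \<Rightarrow> real"
  assume ab: "a \<in> affine_image x t G" "b \<in> affine_image x t G"
    and f: "f \<in> borel_measurable M" "\<And>w. 0 \<le> f w \<and> f w \<le> 1"
  obtain g h where gh: "g \<in> G" "h \<in> G" "a = x \<oplus>\<^bsub>E\<^esub> scale (\<lambda>_. t) g" "b = x \<oplus>\<^bsub>E\<^esub> scale (\<lambda>_. t) h"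
    using ab by (auto simp: affine_image_def)
  have E: "g \<in> carrier E" "h \<in> carrier E" using gh G by auto
  have m: "(\<lambda>w. 1 - f w) \<in> borel_measurable M" using f by auto
  have "mix f a b = x \<oplus>\<^bsub>E\<^esub> (scale (\<lambda>w. f w * t) g \<oplus>\<^bsub>E\<^esub> scale (\<lambda>w. (1 - f w) * t) h)"
    unfolding gh using x E f by (intro mix_add_scale) auto
  also have "\<dots> = x \<oplus>\<^bsub>E\<^esub> scale (\<lambda>_. t) (mix f g h)"
    using E f m by (simp add: mix_def scale_distrib_right scale_scale mult.commute)
  finally show "mix f a b \<in> affine_image x t G"
    using L0_convexD[OF G(1) gh(1,2) f(1)] f(2) by (auto simp: affine_image_def)
qed

text \<open>A Baire category argument in which convex compactness replaces completeness: nested shrunken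
  copies \<open>x + t G\<close> of \<open>G\<close> have a common point, so they cannot avoid all the neighbourhoods
  \<open>{z. gauge (1 / n) z \<le> e / 2}\<close>, which exhaust the module. Hence some copy meets one of these
  neighbourhoods densely, in the sense that all its shrunken subcopies meet it; rescaling that copy
  gives the claim.\<close>

lemma convexly_compact_Baire:
  assumes G: "L0_convexly_compact M E G" and e: "0 < e"
  shows "\<exists>k>0. k \<le> 1 \<and> (\<forall>g\<in>G. \<forall>d. 0 < d \<longrightarrow> d \<le> 1 \<longrightarrow> (\<exists>h\<in>G. gauge k (mix (\<lambda>_. d) h g) \<le> e))"
proof (rule ccontr)
  assume neg: "\<not> ?thesis"
  have GE: "G \<subseteq> carrier E" using G by (rule convexly_compact_carrier)
  have Gc: "closedin (eps_lambda_topology M E) G" "L0_convex M E G" "G \<noteq> {}"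
    using G by (auto simp: L0_convexly_compact_def)
  let ?A = "\<lambda>p. affine_image (fst p) (snd p) G"
  let ?P = "\<lambda>p. fst p \<in> carrier E \<and> 0 < snd p \<and> ?A p \<subseteq> G"
  let ?Q = "\<lambda>n p q. ?A q \<subseteq> ?A p \<and> (\<forall>z\<in>?A q. e / 2 < gauge (1 / real (Suc n)) z)"
  have "\<exists>f. \<forall>n. ?P (f n) \<and> ?Q n (f n) (f (Suc n))"
  proof (rule dependent_nat_choice)
    have "affine_image \<zero>\<^bsub>E\<^esub> 1 G = G" using GE by (force simp: affine_image_def subset_iff)
    then show "\<exists>p. ?P p" by (intro exI[of _ "(\<zero>\<^bsub>E\<^esub>, 1)"]) auto
  next
    fix p n assume p: "?P p"
    obtain x t where xt: "p = (x, t)" by (cases p)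
    have x: "x \<in> carrier E" "0 < t" using p xt by auto
    have "(\<lambda>n. gauge (1 / real n) x) \<longlonglongrightarrow> 0"
      using x by (intro gauge_tendsto_0 lim_1_over_n) auto
    then have "\<forall>\<^sub>F n in sequentially. gauge (1 / real n) x < e / 2"
      by (rule order_tendstoD(2)) (use e in simp)
    then obtain N where N: "\<And>m. m \<ge> N \<Longrightarrow> gauge (1 / real m) x < e / 2"
      unfolding eventually_sequentially by blast
    define m where "m = max N (Suc n)"
    have m: "0 < m" "gauge (1 / real m) x < e / 2" "Suc n \<le> m" using N[of m] by (auto simp: m_def)
    \<comment> \<open>Chosen so that a bound of \<open>x + t v\<close> by the neighbourhood of level \<open>1 / m\<close>, which contains \<open>x\<close>,
      gives a bound of \<open>k v\<close>.\<close>
    define k where "k = min 1 (t / real m)"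
    have k: "0 < k" "k \<le> 1" "k \<le> t / real m" using x m by (auto simp: k_def)
    obtain g d where g: "g \<in> G" and d: "0 < d" "d \<le> 1"
      and far: "\<And>h. h \<in> G \<Longrightarrow> e < gauge k (mix (\<lambda>_. d) h g)"
      using neg k(1,2) by (meson not_le)
    have gE: "g \<in> carrier E" using g GE by auto
    define x' where "x' = x \<oplus>\<^bsub>E\<^esub> scale (\<lambda>_. t * (1 - d)) g"
    have x'E: "x' \<in> carrier E" using x gE by (simp add: x'_def)
    have eq: "x' \<oplus>\<^bsub>E\<^esub> scale (\<lambda>_. t * d) h = x \<oplus>\<^bsub>E\<^esub> scale (\<lambda>_. t) (mix (\<lambda>_. d) h g)"
      if "h \<in> G" for h
    proof -
      have "h \<in> carrier E" using that GE by auto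
      then show ?thesis using x gE
        by (simp add: x'_def mix_def scale_distrib_right scale_scale M.a_ac)
    qed
    have mixG: "mix (\<lambda>_. d) h g \<in> G" if "h \<in> G" for h
      using L0_convexD[OF Gc(2) that g, of "\<lambda>_. d"] d by auto
    have sub: "affine_image x' (t * d) G \<subseteq> affine_image x t G"
      using eq mixG by (auto simp: affine_image_def)
    moreover have "e / 2 < gauge (1 / real (Suc n)) z" if z: "z \<in> affine_image x' (t * d) G" for z
    proof -
      obtain h where h: "h \<in> G" "z = x \<oplus>\<^bsub>E\<^esub> scale (\<lambda>_. t) (mix (\<lambda>_. d) h g)"
        using z eq by (auto simp: affine_image_def)
      define v where "v = mix (\<lambda>_. d) h g"
      have vE: "v \<in> carrier E" using mixG h GE by (auto simp: v_def)
      have zE: "z \<in> carrier E" using h vE x by (simp add: v_def)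
      have "x \<oplus>\<^bsub>E\<^esub> scale (\<lambda>_. t) v \<ominus>\<^bsub>E\<^esub> x = scale (\<lambda>_. t) v"
        using vE x by (simp add: add_minus_cancel)
      then have tv: "z \<ominus>\<^bsub>E\<^esub> x = scale (\<lambda>_. t) v" using h by (simp add: v_def)
      have "AE w in M. nrm (scale (\<lambda>_. t) v) w \<le> nrm z w + nrm (\<ominus>\<^bsub>E\<^esub> x) w"
        using nrm_add_le[of z "\<ominus>\<^bsub>E\<^esub> x"] zE x tv by (simp add: a_minus_def)
      moreover have "AE w in M. nrm (scale (\<lambda>_. t) v) w = \<bar>t\<bar> * nrm v w"
        using vE by (intro nrm_scale) auto
      moreover have "AE w in M. nrm (\<ominus>\<^bsub>E\<^esub> x) w = nrm x w" using x by (intro nrm_uminus)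
      ultimately have "AE w in M. k * nrm v w \<le> (1 / real m) * nrm z w + (1 / real m) * nrm x w"
      proof eventually_elim
        case (elim w)
        have "k * nrm v w \<le> t / real m * nrm v w" using k(3) nrm_nonneg[OF vE] by (intro mult_right_mono)
        also have "\<dots> = (t * nrm v w) / real m" by simp
        also have "\<dots> \<le> (nrm z w + nrm x w) / real m"
          using elim x by (intro divide_right_mono) auto
        finally show ?case by (simp add: add_divide_distrib)
      qed
      then have "gauge k v \<le> gauge (1 / real m) z + gauge (1 / real m) x"
        using vE zE x k by (intro gauge_le_add) auto
      with far[OF h(1)] m(2) have "e / 2 < gauge (1 / real m) z" by (simp add: v_def)
      also have "\<dots> \<le> gauge (1 / real (Suc n)) z"
        using zE m by (intro gauge_le AE_I2 mult_right_mono) (auto simp: nrm_nonneg frac_le)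
      finally show ?thesis .
    qed
    ultimately show "\<exists>q. ?P q \<and> ?Q n p q"
      using p xt x'E x d by (intro exI[of _ "(x', t * d)"]) auto
  qed
  then obtain f where P: "\<And>n. ?P (f n)" and Q: "\<And>n. ?Q n (f n) (f (Suc n))" by blast
  have dec: "?A (f n) \<subseteq> ?A (f m)" if "m \<le> n" for m n
    using that by (induction rule: dec_induct) (use Q in blast)+
  have "\<Inter>(range (\<lambda>n. ?A (f n))) \<noteq> {}"
  proof (rule convexly_compact_directed_Inter[OF G])
    fix A assume "A \<in> range (\<lambda>n. ?A (f n))"
    then obtain n where n: "A = ?A (f n)" by blast
    have "?A (f n) \<noteq> {}" using Gc(3) by (simp add: affine_image_def)
    moreover have "closedin (eps_lambda_topology M E) (?A (f n))"
      using P[of n] Gc by (intro closedin_affine_image) auto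
    moreover have "L0_convex M E (?A (f n))"
      using P[of n] Gc GE by (intro L0_convex_affine_image) auto
    ultimately show "A \<noteq> {} \<and> A \<subseteq> G \<and> closedin (eps_lambda_topology M E) A \<and> L0_convex M E A"
      using P[of n] n by simp
  next
    fix A B assume "A \<in> range (\<lambda>n. ?A (f n))" "B \<in> range (\<lambda>n. ?A (f n))"
    then obtain m n where mn: "A = ?A (f m)" "B = ?A (f n)" by blast
    have "?A (f (max m n)) \<subseteq> A \<inter> B" using dec[of m "max m n"] dec[of n "max m n"] mn by auto
    then show "\<exists>C\<in>range (\<lambda>n. ?A (f n)). C \<subseteq> A \<inter> B" by blast
  qed
  then obtain z where z: "\<And>n. z \<in> ?A (f n)" by blast
  then have zE: "z \<in> carrier E" using P GE by blast
  have "(\<lambda>n. gauge (1 / real (Suc n)) z) \<longlonglongrightarrow> 0"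
    using zE by (intro gauge_tendsto_0 LIMSEQ_Suc[OF lim_1_over_n]) auto
  moreover have "e / 2 < gauge (1 / real (Suc n)) z" for n using Q[of n] z[of "Suc n"] by blast
  ultimately have "e / 2 \<le> 0" by (intro LIMSEQ_le_const) (auto intro: less_imp_le)
  with e show False by simp
qed

text \<open>If \<open>G\<close> contained a ray from \<open>p\<close> in direction \<open>y\<close>, it would contain \<open>p + \<xi> y\<close> for all bounded
  random \<open>\<xi> \<ge> 0\<close>. A point common to the closures of the sets \<open>{p + \<xi> y | \<xi> \<ge> n}\<close> has distance at least
  \<open>n nrm y\<close> from \<open>p\<close> for every \<open>n\<close>.\<close>

lemma convexly_compact_no_ray:
  assumes G: "L0_convexly_compact M E G" and p: "p \<in> G" and y: "y \<in> carrier E"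
    and ray: "\<And>m::real. \<exists>t\<ge>m. p \<oplus>\<^bsub>E\<^esub> scale (\<lambda>_. t) y \<in> G"
  shows "y = \<zero>\<^bsub>E\<^esub>"
proof -
  have GE: "G \<subseteq> carrier E" using G by (rule convexly_compact_carrier)
  have Gc: "closedin (eps_lambda_topology M E) G" "L0_convex M E G"
    using G by (auto simp: L0_convexly_compact_def)
  have pE: "p \<in> carrier E" using p GE by auto
  define X :: "nat \<Rightarrow> ('w \<Rightarrow> real) set"
    where "X n = {\<xi> \<in> borel_measurable M. \<exists>m. \<forall>w. real n \<le> \<xi> w \<and> \<xi> w \<le> m}" for n
  define B where "B n = (\<lambda>\<xi>. p \<oplus>\<^bsub>E\<^esub> scale \<xi> y) ` X n" for n
  have BG: "B n \<subseteq> G" for n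
  proof
    fix a assume "a \<in> B n"
    then obtain \<xi> m where \<xi>: "\<xi> \<in> borel_measurable M" "\<And>w. real n \<le> \<xi> w \<and> \<xi> w \<le> m"
      "a = p \<oplus>\<^bsub>E\<^esub> scale \<xi> y" by (auto simp: B_def X_def)
    \<comment> \<open>A point of the ray beyond the upper bound of \<open>\<xi>\<close>, so that \<open>\<xi> / t\<close> is a convex coefficient.\<close>
    obtain t where t: "max m 1 \<le> t" "p \<oplus>\<^bsub>E\<^esub> scale (\<lambda>_. t) y \<in> G" using ray by blast
    define f where "f w = \<xi> w / t" for w
    have f: "f \<in> borel_measurable M" unfolding f_def using \<xi>(1) by simp
    have f01: "0 \<le> f w \<and> f w \<le> 1" for w
    proof -
      have "real n \<le> \<xi> w" "\<xi> w \<le> m" using \<xi>(2) by auto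
      then have "0 \<le> \<xi> w" "\<xi> w \<le> t" using t(1) by auto
      then show ?thesis using t(1) by (auto simp: f_def)
    qed
    have "mix f (p \<oplus>\<^bsub>E\<^esub> scale (\<lambda>_. t) y) (p \<oplus>\<^bsub>E\<^esub> scale (\<lambda>_. 0) y)
        = p \<oplus>\<^bsub>E\<^esub> (scale (\<lambda>w. f w * t) y \<oplus>\<^bsub>E\<^esub> scale (\<lambda>w. (1 - f w) * 0) y)"
      using pE y f by (intro mix_add_scale) auto
    moreover have "(\<lambda>w. f w * t) = \<xi>" using t(1) by (auto simp: f_def)
    ultimately have "mix f (p \<oplus>\<^bsub>E\<^esub> scale (\<lambda>_. t) y) p = a" using \<xi> pE y by simp
    then show "a \<in> G" using L0_convexD[OF Gc(2) t(2) p f] f01 by auto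
  qed
  have BE: "B n \<subseteq> carrier E" for n using BG GE by blast
  have Bconv: "L0_convex M E (B n)" for n
  proof (rule L0_convexI[OF BE])
    fix a b and f :: "'w \<Rightarrow> real"
    assume ab: "a \<in> B n" "b \<in> B n" and f: "f \<in> borel_measurable M" "\<And>w. 0 \<le> f w \<and> f w \<le> 1"
    obtain \<xi> \<eta> m l where \<xi>: "\<xi> \<in> borel_measurable M" "\<eta> \<in> borel_measurable M"
      "\<And>w. real n \<le> \<xi> w \<and> \<xi> w \<le> m" "\<And>w. real n \<le> \<eta> w \<and> \<eta> w \<le> l"
      "a = p \<oplus>\<^bsub>E\<^esub> scale \<xi> y" "b = p \<oplus>\<^bsub>E\<^esub> scale \<eta> y"
      using ab by (auto simp: B_def X_def)
    define \<zeta> where "\<zeta> w = f w * \<xi> w + (1 - f w) * \<eta> w" for w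
    have "real n \<le> \<zeta> w \<and> \<zeta> w \<le> max m l" for w
    proof
      have "- \<zeta> w = f w * (- \<xi> w) + (1 - f w) * (- \<eta> w)" by (simp add: \<zeta>_def)
      also have "\<dots> \<le> - real n" using \<xi>(3)[of w] \<xi>(4)[of w] f(2)[of w] by (intro convex_bound_le) auto
      finally show "real n \<le> \<zeta> w" by simp
      show "\<zeta> w \<le> max m l"
        unfolding \<zeta>_def using \<xi>(3)[of w] \<xi>(4)[of w] f(2)[of w] by (intro convex_bound_le) auto
    qed
    moreover have "\<zeta> \<in> borel_measurable M" unfolding \<zeta>_def using f \<xi> by measurable
    ultimately have "\<zeta> \<in> X n" by (auto simp: X_def)
    moreover have "mix f a b = p \<oplus>\<^bsub>E\<^esub> (scale (\<lambda>w. f w * \<xi> w) y \<oplus>\<^bsub>E\<^esub> scale (\<lambda>w. (1 - f w) * \<eta> w) y)"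
      unfolding \<xi>(5,6) using pE y f \<xi> by (intro mix_add_scale) auto
    then have "mix f a b = p \<oplus>\<^bsub>E\<^esub> scale \<zeta> y"
      unfolding \<zeta>_def using f \<xi> y by (subst scale_distrib_left) auto
    ultimately show "mix f a b \<in> B n" by (auto simp: B_def)
  qed
  have "\<Inter>(range (\<lambda>n. cl (B n))) \<noteq> {}"
  proof (rule convexly_compact_directed_Inter[OF G])
    fix A assume "A \<in> range (\<lambda>n. cl (B n))"
    then obtain n where n: "A = cl (B n)" by blast
    have "(\<lambda>_. real n) \<in> X n" by (auto simp: X_def)
    then have "cl (B n) \<noteq> {}" using cl_superset[OF BE[of n]] by (auto simp: B_def)
    then show "A \<noteq> {} \<and> A \<subseteq> G \<and> closedin (eps_lambda_topology M E) A \<and> L0_convex M E A"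
      unfolding n using cl_minimal[OF BG Gc(1)] closedin_cl[OF BE] L0_convex_cl[OF BE Bconv] by blast
  next
    fix A B' assume "A \<in> range (\<lambda>n. cl (B n))" "B' \<in> range (\<lambda>n. cl (B n))"
    then obtain m n where mn: "A = cl (B m)" "B' = cl (B n)" by blast
    have sub: "X i \<subseteq> X j" if "j \<le> i" for i j
    proof
      fix \<xi> assume "\<xi> \<in> X i"
      then obtain l where "\<xi> \<in> borel_measurable M" "\<forall>w. real i \<le> \<xi> w \<and> \<xi> w \<le> l" by (auto simp: X_def)
      moreover have "real j \<le> real i" using that by simp
      ultimately have "\<xi> \<in> borel_measurable M" "\<forall>w. real j \<le> \<xi> w \<and> \<xi> w \<le> l"
        by (meson order_trans)+
      then show "\<xi> \<in> X j" unfolding X_def by auto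
    qed
    have "B (max m n) \<subseteq> B m" "B (max m n) \<subseteq> B n" 
      unfolding B_def by (intro image_mono sub; simp)+
    then have "cl (B (max m n)) \<subseteq> A \<inter> B'" unfolding mn cl_def by blast
    then show "\<exists>C\<in>range (\<lambda>n. cl (B n)). C \<subseteq> A \<inter> B'" by blast
  qed
  then obtain z where z: "\<And>n. z \<in> cl (B n)" by blast
  have zE: "z \<in> carrier E" using z[of 0] by (simp add: cl_def)
  note [measurable] = nrm_measurable[OF y]
  have meas: "nrm (z \<ominus>\<^bsub>E\<^esub> p) \<in> borel_measurable M" using zE pE by simp
  have far: "AE w in M. ereal (real n * nrm y w) \<le> ereal (nrm (z \<ominus>\<^bsub>E\<^esub> p) w)" for n
  proof (rule AE_le_if_le_add_small)
    fix e :: real assume "0 < e"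
    then obtain a where a: "a \<in> B n" "gauge 1 (z \<ominus>\<^bsub>E\<^esub> a) < e" using z[of n] by (auto simp: cl_def)
    then obtain \<xi> where \<xi>: "\<xi> \<in> borel_measurable M" "\<And>w. real n \<le> \<xi> w" "a = p \<oplus>\<^bsub>E\<^esub> scale \<xi> y"
      by (auto simp: B_def X_def)
    have aE: "a \<in> carrier E" using a BE by auto
    have ap: "a \<ominus>\<^bsub>E\<^esub> p = scale \<xi> y"
      using pE y \<xi> by (simp add: add_minus_cancel)
    have "AE w in M. nrm (scale \<xi> y) w = \<bar>\<xi> w\<bar> * nrm y w" using \<xi> y by (intro nrm_scale)
    moreover have "AE w in M. nrm (a \<ominus>\<^bsub>E\<^esub> p) w \<le> nrm (a \<ominus>\<^bsub>E\<^esub> z) w + nrm (z \<ominus>\<^bsub>E\<^esub> p) w"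
      using aE zE pE by (intro nrm_minus_triangle)
    moreover have "AE w in M. nrm (a \<ominus>\<^bsub>E\<^esub> z) w = nrm (z \<ominus>\<^bsub>E\<^esub> a) w"
      using aE zE by (intro nrm_minus_commute)
    ultimately have "AE w in M. ereal (real n * nrm y w) \<le> ereal (nrm (z \<ominus>\<^bsub>E\<^esub> p) w) + ereal (nrm (z \<ominus>\<^bsub>E\<^esub> a) w)"
    proof eventually_elim
      case (elim w)
      have "real n * nrm y w \<le> \<bar>\<xi> w\<bar> * nrm y w"
        using \<xi>(2)[of w] nrm_nonneg[OF y] by (intro mult_right_mono) auto
      then show ?case using elim ap by simp
    qed
    then show "\<exists>u\<in>borel_measurable M. (\<forall>w. 0 \<le> u w) \<and> expectation (\<lambda>w. min 1 (u w)) < e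
        \<and> (AE w in M. ereal (real n * nrm y w) \<le> ereal (nrm (z \<ominus>\<^bsub>E\<^esub> p) w) + ereal (u w))"
      using a zE aE by (intro bexI[of _ "nrm (z \<ominus>\<^bsub>E\<^esub> a)"]) (auto simp: nrm_nonneg gauge_def)
  qed (use meas in auto)
  have "AE w in M. \<forall>n. real n * nrm y w \<le> nrm (z \<ominus>\<^bsub>E\<^esub> p) w"
    unfolding AE_all_countable using far by simp
  then have "AE w in M. nrm y w = 0"
  proof eventually_elim
    case (elim w)
    show ?case
    proof (rule ccontr)
      assume "nrm y w \<noteq> 0"
      then have "0 < nrm y w" using nrm_nonneg[OF y, of w] by simp
      then obtain n where "nrm (z \<ominus>\<^bsub>E\<^esub> p) w < real n * nrm y w" using reals_Archimedean3 by blast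
      then show False using elim by (simp add: not_le[symmetric])
    qed
  qed
  then show ?thesis using y by (rule nrm_eq_zero[rotated])
qed

lemma gauge_telescope:
  fixes s :: "nat \<Rightarrow> 'e"
  assumes s: "\<And>j. s j \<in> carrier E" and k: "0 \<le> k"
    and step: "\<And>j. m \<le> j \<Longrightarrow> gauge k (s j \<ominus>\<^bsub>E\<^esub> s (Suc j)) \<le> e / 2 ^ Suc j" and n: "m \<le> n"
  shows "gauge k (s m \<ominus>\<^bsub>E\<^esub> s n) \<le> e / 2 ^ m - e / 2 ^ n"
  using n
proof (induction rule: dec_induct)
  case base
  have "s m \<ominus>\<^bsub>E\<^esub> s m = \<zero>\<^bsub>E\<^esub>" using s by (simp add: a_minus_def M.r_neg)
  then show ?case by (simp add: gauge_zero)
next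
  case (step n)
  have "gauge k (s m \<ominus>\<^bsub>E\<^esub> s (Suc n)) \<le> gauge k (s m \<ominus>\<^bsub>E\<^esub> s n) + gauge k (s n \<ominus>\<^bsub>E\<^esub> s (Suc n))"
    using s k by (intro gauge_minus_triangle)
  also have "\<dots> \<le> (e / 2 ^ m - e / 2 ^ n) + e / 2 ^ Suc n"
    using step.IH assms(3)[OF step.hyps(1)] by (rule add_mono)
  also have "\<dots> = e / 2 ^ m - e / 2 ^ Suc n" by (simp add: field_simps)
  finally show ?case .
qed


text \<open>The iteration of the open mapping theorem. The Baire argument turns \<open>g\<close> into a small vector
  plus a small negative multiple of another element of \<open>G\<close>, and this can be repeated. The small
  vectors add up to a vector with the required bound. The remainders \<open>b j * s j\<close>, with \<open>s j\<close> in
  \<open>G\<close> and \<open>b j\<close> of alternating sign, converge to some \<open>y\<close>, and \<open>G\<close> contains points arbitrarily far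
  out in direction \<open>y\<close>. So \<open>y\<close> is zero.\<close>

lemma convexly_compact_gauge_bounded:
  assumes complete: "rn_complete M E" and G: "L0_convexly_compact M E G" and e: "0 < e"
  shows "\<exists>c>0. \<forall>g\<in>G. gauge c g \<le> e"
proof -
  have GE: "G \<subseteq> carrier E" using G by (rule convexly_compact_carrier)
  have Gc: "closedin (eps_lambda_topology M E) G" "L0_convex M E G"
    using G by (auto simp: L0_convexly_compact_def)
  have clG: "cl G \<subseteq> G" using Gc by (simp add: closedin_iff_cl)
  have baire: "\<exists>k>0. k \<le> 1 \<and> (\<forall>g\<in>G. \<forall>d. 0 < d \<longrightarrow> d \<le> 1 \<longrightarrow>
      (\<exists>h\<in>G. gauge k (mix (\<lambda>_. d) h g) \<le> e / 2 ^ Suc j))" for j :: nat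
    by (rule convexly_compact_Baire[OF G]) (use e in simp)
  have "\<exists>\<kappa>. \<forall>j. 0 < \<kappa> j \<and> \<kappa> j \<le> 1 \<and> (\<forall>g\<in>G. \<forall>d. 0 < d \<longrightarrow> d \<le> 1 \<longrightarrow>
      (\<exists>h\<in>G. gauge (\<kappa> j) (mix (\<lambda>_. d) h g) \<le> e / 2 ^ Suc j))"
    by (rule choice) (intro allI baire)
  then obtain \<kappa> :: "nat \<Rightarrow> real" where \<kappa>: "\<And>j. 0 < \<kappa> j" "\<And>j. \<kappa> j \<le> 1"
    "\<And>j g d. g \<in> G \<Longrightarrow> 0 < d \<Longrightarrow> d \<le> 1 \<Longrightarrow> \<exists>h\<in>G. gauge (\<kappa> j) (mix (\<lambda>_. d) h g) \<le> e / 2 ^ Suc j"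
    by blast
  \<comment> \<open>Step \<open>j\<close> leaves a remainder with a factor of order \<open>\<delta> j\<close>, and step \<open>j + 1\<close> controls vectors only
    after multiplication by \<open>\<kappa> (j + 1)\<close>. So \<open>\<delta> j\<close> is chosen small relative to \<open>\<kappa> (j + 1)\<close>.\<close>
  define \<delta> where "\<delta> j = \<kappa> (Suc j) / 4" for j
  have \<delta>: "0 < \<delta> j" "\<delta> j \<le> 1 / 4" for j using \<kappa>(1,2)[of "Suc j"] by (auto simp: \<delta>_def)
  \<comment> \<open>Solving \<open>v = \<delta> j * s (j + 1) + (1 - \<delta> j) * s j\<close> for \<open>s j\<close> puts the factor \<open>- \<delta> j / (1 - \<delta> j)\<close> in
    front of \<open>s (j + 1)\<close>; \<open>b n\<close> is the product of these factors over the first \<open>n\<close> steps.\<close>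
  define b where "b = rec_nat 1 (\<lambda>j x. - x * (\<delta> j / (1 - \<delta> j)))"
  have b0: "b 0 = 1" and b_Suc: "b (Suc j) = - b j * (\<delta> j / (1 - \<delta> j))" for j
    by (simp_all add: b_def)
  have ratio: "0 < \<delta> j / (1 - \<delta> j)" "\<delta> j / (1 - \<delta> j) \<le> \<kappa> (Suc j) / 3" for j
  proof -
    have "0 < 1 - \<delta> j" using \<delta>(2)[of j] by simp
    then show "0 < \<delta> j / (1 - \<delta> j)" using \<delta>(1)[of j] by simp
    have "\<delta> j / (1 - \<delta> j) \<le> \<delta> j / (3 / 4)" using \<delta>[of j] by (intro divide_left_mono) auto
    then show "\<delta> j / (1 - \<delta> j) \<le> \<kappa> (Suc j) / 3" by (simp add: \<delta>_def)
  qed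
  have abs_b_Suc: "\<bar>b (Suc j)\<bar> \<le> \<bar>b j\<bar> * (\<kappa> (Suc j) / 3)" for j
  proof -
    have "\<bar>b (Suc j)\<bar> = \<bar>b j\<bar> * (\<delta> j / (1 - \<delta> j))"
      by (simp only: b_Suc abs_mult abs_minus_cancel abs_of_pos[OF ratio(1)])
    also have "\<dots> \<le> \<bar>b j\<bar> * (\<kappa> (Suc j) / 3)" by (intro mult_left_mono ratio) auto
    finally show ?thesis .
  qed
  have abs_b_third: "\<bar>b (Suc j)\<bar> \<le> \<bar>b j\<bar> / 3" for j
    using abs_b_Suc[of j] mult_left_mono[OF \<kappa>(2)[of "Suc j"], of "\<bar>b j\<bar>"] by simp
  have abs_b: "\<bar>b j\<bar> \<le> (1 / 3) ^ j" for j
  proof (induction j)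
    case (Suc j)
    then show ?case using abs_b_third[of j] by simp
  qed (simp add: b0)
  have b_even: "0 < b (2 * j)" for j
  proof (induction j)
    case (Suc j)
    have "b (2 * Suc j) = b (2 * j) * (\<delta> (2 * j) / (1 - \<delta> (2 * j))) * (\<delta> (Suc (2 * j)) / (1 - \<delta> (Suc (2 * j))))"
      by (simp add: b_Suc)
    then show ?case using Suc ratio(1)[of "2 * j"] ratio(1)[of "Suc (2 * j)"] by (metis mult_pos_pos)
  qed (simp add: b0)
  have b_decreasing: "\<bar>b n\<bar> \<le> \<bar>b m\<bar>" if "m \<le> n" for m n
    using that
  proof (induction rule: dec_induct)
    case (step n)
    have "\<bar>b (Suc n)\<bar> \<le> \<bar>b n\<bar>" using abs_b_third[of n] by simp
    then show ?case using step.IH by simp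
  qed simp
  have b_lim: "b \<longlonglongrightarrow> 0"
  proof (rule Lim_null_comparison)
    show "\<forall>\<^sub>F n in sequentially. norm (b n) \<le> (1 / 3) ^ n" using abs_b by simp
    show "(\<lambda>n. (1 / 3) ^ n :: real) \<longlonglongrightarrow> 0" by (rule LIMSEQ_power_zero) simp
  qed
  \<comment> \<open>The first small vector enters with the coefficient \<open>1 / (1 - \<delta> 0)\<close>, which is at most \<open>4 / 3 < 2\<close>.\<close>
  define c where "c = \<kappa> 0 / 2"
  have c: "0 < c" "c \<le> 1" using \<kappa>(1,2)[of 0] by (auto simp: c_def)
  have "gauge c g \<le> e" if g: "g \<in> G" for g
  proof -
    have "\<exists>s. \<forall>j. (s j \<in> G \<and> (j = 0 \<longrightarrow> s j = g))
        \<and> gauge (\<kappa> j) (mix (\<lambda>_. \<delta> j) (s (Suc j)) (s j)) \<le> e / 2 ^ Suc j"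
    proof (rule dependent_nat_choice)
      show "\<exists>x. x \<in> G \<and> (0 = 0 \<longrightarrow> x = g)" using g by blast
      fix x and j :: nat assume "x \<in> G \<and> (j = 0 \<longrightarrow> x = g)"
      then show "\<exists>y. (y \<in> G \<and> (Suc j = 0 \<longrightarrow> y = g)) \<and> gauge (\<kappa> j) (mix (\<lambda>_. \<delta> j) y x) \<le> e / 2 ^ Suc j"
        using \<kappa>(3)[of x "\<delta> j" j] \<delta>[of j] by auto
    qed
    then obtain s where s: "\<And>j. s j \<in> G" "s 0 = g"
      "\<And>j. gauge (\<kappa> j) (mix (\<lambda>_. \<delta> j) (s (Suc j)) (s j)) \<le> e / 2 ^ Suc j" by blast
    have sE: "s j \<in> carrier E" for j using s(1) GE by auto
    define r where "r j = scale (\<lambda>_. b j) (s j)" for j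
    have rE: "r j \<in> carrier E" for j using sE by (simp add: r_def)
    have diff: "r j \<ominus>\<^bsub>E\<^esub> r (Suc j) = scale (\<lambda>_. b j / (1 - \<delta> j)) (mix (\<lambda>_. \<delta> j) (s (Suc j)) (s j))" for j
    proof -
      have nz: "1 - \<delta> j \<noteq> 0" using \<delta>(2)[of j] by simp
      have "scale (\<lambda>_. b j / (1 - \<delta> j)) (mix (\<lambda>_. \<delta> j) (s (Suc j)) (s j))
          = scale (\<lambda>_. b j / (1 - \<delta> j) * \<delta> j) (s (Suc j)) \<oplus>\<^bsub>E\<^esub> scale (\<lambda>_. b j / (1 - \<delta> j) * (1 - \<delta> j)) (s j)"
        using sE by (simp only: mix_def) (simp add: scale_distrib_right scale_scale)
      also have "b j / (1 - \<delta> j) * \<delta> j = - b (Suc j)" by (simp add: b_Suc)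
      also have "b j / (1 - \<delta> j) * (1 - \<delta> j) = b j" using nz by simp
      also have "scale (\<lambda>_. - b (Suc j)) (s (Suc j)) \<oplus>\<^bsub>E\<^esub> scale (\<lambda>_. b j) (s j) = r j \<ominus>\<^bsub>E\<^esub> r (Suc j)"
        using sE scale_uminus[of "\<lambda>_. b (Suc j)" "s (Suc j)"] by (simp add: r_def a_minus_def M.a_comm)
      finally show ?thesis ..
    qed
    have gauge_diff: "gauge k (r j \<ominus>\<^bsub>E\<^esub> r (Suc j)) \<le> e / 2 ^ Suc j"
      if k: "0 \<le> k" "k * (\<bar>b j\<bar> * (4 / 3)) \<le> \<kappa> j" for j k
    proof -
      let ?v = "mix (\<lambda>_. \<delta> j) (s (Suc j)) (s j)"
      have vE: "?v \<in> carrier E" using sE by simp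
      have "1 / (1 - \<delta> j) \<le> 1 / (3 / 4)" using \<delta>(2)[of j] by (intro divide_left_mono) auto
      then have "\<bar>b j\<bar> * (1 / (1 - \<delta> j)) \<le> \<bar>b j\<bar> * (4 / 3)" by (intro mult_left_mono) auto
      moreover have "\<bar>b j / (1 - \<delta> j)\<bar> = \<bar>b j\<bar> * (1 / (1 - \<delta> j))" using \<delta>(2)[of j] by (simp add: abs_divide)
      ultimately have "k * \<bar>b j / (1 - \<delta> j)\<bar> \<le> k * (\<bar>b j\<bar> * (4 / 3))" using k by (intro mult_left_mono) auto
      then have le: "k * \<bar>b j / (1 - \<delta> j)\<bar> \<le> \<kappa> j" using k by linarith
      have "AE w in M. nrm (r j \<ominus>\<^bsub>E\<^esub> r (Suc j)) w = \<bar>b j / (1 - \<delta> j)\<bar> * nrm ?v w"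
        unfolding diff using vE by (intro nrm_scale) auto
      then have "AE w in M. k * nrm (r j \<ominus>\<^bsub>E\<^esub> r (Suc j)) w \<le> \<kappa> j * nrm ?v w"
      proof eventually_elim
        case (elim w)
        show ?case using mult_right_mono[OF le nrm_nonneg[OF vE, of w]] elim by (simp add: mult.assoc)
      qed
      then have "gauge k (r j \<ominus>\<^bsub>E\<^esub> r (Suc j)) \<le> gauge (\<kappa> j) ?v"
        using rE vE k \<kappa>(1)[of j] by (intro gauge_le) auto
      then show ?thesis using s(3)[of j] by linarith
    qed
    have b_kappa: "\<bar>b (Suc j)\<bar> * (4 / 3) \<le> \<kappa> (Suc j)" for j
    proof -
      have "\<bar>b j\<bar> \<le> 1" using b_decreasing[of 0 j] b0 by simp
      then have "\<bar>b j\<bar> * (\<kappa> (Suc j) / 3) \<le> 1 * (\<kappa> (Suc j) / 3)"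
        using \<kappa>(1)[of "Suc j"] by (intro mult_right_mono) auto
      then have "\<bar>b (Suc j)\<bar> \<le> \<kappa> (Suc j) / 3" using abs_b_Suc[of j] by linarith
      then show ?thesis using \<kappa>(1)[of "Suc j"] by linarith
    qed
    \<comment> \<open>At \<open>j = 0\<close> the coefficient is not small, and only \<open>gauge c\<close> is controlled. This does not affect
      convergence.\<close>
    have step1: "gauge 1 (r j \<ominus>\<^bsub>E\<^esub> r (Suc j)) \<le> e / 2 ^ Suc j" if "1 \<le> j" for j
      using that b_kappa[of "j - 1"] by (intro gauge_diff) auto
    have stepc: "gauge c (r j \<ominus>\<^bsub>E\<^esub> r (Suc j)) \<le> e / 2 ^ Suc j" for j
    proof (rule gauge_diff)
      show "c * (\<bar>b j\<bar> * (4 / 3)) \<le> \<kappa> j"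
      proof (cases j)
        case 0
        then show ?thesis using \<kappa>(1)[of 0] by (simp add: b0 c_def)
      next
        case (Suc i)
        have "c * (\<bar>b j\<bar> * (4 / 3)) \<le> 1 * (\<bar>b j\<bar> * (4 / 3))" using c by (intro mult_right_mono) auto
        then show ?thesis using b_kappa[of i] Suc by simp
      qed
    qed (use c in simp)
    have "\<exists>N. \<forall>m\<ge>N. \<forall>n\<ge>N. gauge 1 (r m \<ominus>\<^bsub>E\<^esub> r n) < \<epsilon>" if \<epsilon>: "0 < \<epsilon>" for \<epsilon>
    proof -
      have "(\<lambda>n. e * (1 / 2) ^ n) \<longlonglongrightarrow> e * 0" by (intro tendsto_intros) auto
      then have "\<forall>\<^sub>F n in sequentially. e * (1 / 2) ^ n < \<epsilon> / 2"
        by (intro order_tendstoD(2)[of _ "e * 0"]) (use \<epsilon> in auto)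
      then obtain N0 where N0: "\<And>n. n \<ge> N0 \<Longrightarrow> e * (1 / 2) ^ n < \<epsilon> / 2"
        unfolding eventually_sequentially by blast
      define N where "N = max 1 N0"
      have N: "1 \<le> N" "e / 2 ^ N < \<epsilon> / 2" using N0[of N] by (auto simp: N_def power_one_over)
      have near: "gauge 1 (r N \<ominus>\<^bsub>E\<^esub> r n) < \<epsilon> / 2" if "n \<ge> N" for n
      proof -
        have "gauge 1 (r N \<ominus>\<^bsub>E\<^esub> r n) \<le> e / 2 ^ N - e / 2 ^ n"
          using rE step1 N(1) that by (intro gauge_telescope) auto
        moreover have "0 \<le> e / 2 ^ n" using e by simp
        ultimately show ?thesis using N(2) by linarith
      qed
      have "gauge 1 (r m \<ominus>\<^bsub>E\<^esub> r n) < \<epsilon>" if "m \<ge> N" "n \<ge> N" for m n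
        using near[OF that(1)] near[OF that(2)] gauge_minus_commute[of "r N" "r m" 1]
          gauge_minus_triangle[of "r m" "r N" "r n" 1] rE by auto
      then show ?thesis by blast
    qed
    from gauge_complete[of r, OF complete rE this]
    obtain y where y: "y \<in> carrier E" "\<And>\<epsilon>. 0 < \<epsilon> \<Longrightarrow> \<exists>N. \<forall>n\<ge>N. gauge 1 (r n \<ominus>\<^bsub>E\<^esub> y) < \<epsilon>"
      by blast
    \<comment> \<open>Only even indices are used, because \<open>s n\<close> must enter with the positive factor
      \<open>b n / b (2 * j)\<close> to give a convex combination of \<open>s n\<close> and \<open>g\<close>.\<close>
    have ray: "g \<oplus>\<^bsub>E\<^esub> scale (\<lambda>_. 1 / b (2 * j)) y \<in> G" for j
    proof -
      define t where "t = 1 / b (2 * j)"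
      have t: "0 < t" using b_even[of j] by (simp add: t_def)
      have gE: "g \<in> carrier E" using g GE by auto
      have "\<exists>a\<in>G. gauge 1 ((g \<oplus>\<^bsub>E\<^esub> scale (\<lambda>_. t) y) \<ominus>\<^bsub>E\<^esub> a) < \<epsilon>" if \<epsilon>: "0 < \<epsilon>" for \<epsilon>
      proof -
        have lim: "(\<lambda>k. gauge \<bar>t * b k\<bar> g) \<longlonglongrightarrow> 0"
        proof (intro gauge_tendsto_0 gE)
          have "(\<lambda>k. \<bar>t * b k\<bar>) \<longlonglongrightarrow> \<bar>t * 0\<bar>" by (intro tendsto_intros b_lim)
          then show "(\<lambda>k. \<bar>t * b k\<bar>) \<longlonglongrightarrow> 0" by simp
        qed simp
        have "\<forall>\<^sub>F k in sequentially. gauge \<bar>t * b k\<bar> g < \<epsilon> / 2"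
          using order_tendstoD(2)[OF lim, of "\<epsilon> / 2"] \<epsilon> by simp
        then obtain N1 where N1: "\<And>k. k \<ge> N1 \<Longrightarrow> gauge \<bar>t * b k\<bar> g < \<epsilon> / 2"
          unfolding eventually_sequentially by blast
        have "0 < \<epsilon> / 2 / max 1 t" using \<epsilon> by simp
        then obtain N2 where N2: "\<And>k. k \<ge> N2 \<Longrightarrow> gauge 1 (r k \<ominus>\<^bsub>E\<^esub> y) < \<epsilon> / 2 / max 1 t"
          using y(2) by blast
        define k where "k = max j (max N1 N2)"
        have k: "j \<le> k" "N1 \<le> 2 * k" "N2 \<le> 2 * k" by (auto simp: k_def)
        define \<tau> where "\<tau> = t * b (2 * k)"
        have \<tau>: "0 < \<tau>" "\<tau> \<le> 1"
        proof -
          show "0 < \<tau>" using t b_even[of k] by (simp add: \<tau>_def)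
          have "b (2 * k) \<le> b (2 * j)"
            using b_decreasing[of "2 * j" "2 * k"] k(1) b_even[of k] b_even[of j] by simp
          then show "\<tau> \<le> 1" using b_even[of j] by (simp add: \<tau>_def t_def)
        qed
        define a where "a = mix (\<lambda>_. \<tau>) (s (2 * k)) g"
        have aG: "a \<in> G"
          unfolding a_def using \<tau> by (intro L0_convexD[OF Gc(2) s(1) g]) auto
        have aE: "a \<in> carrier E" using aG GE by auto
        let ?d = "y \<ominus>\<^bsub>E\<^esub> r (2 * k)"
        have dE: "?d \<in> carrier E" using y rE by simp
        have "scale (\<lambda>_. 1 - \<tau>) g \<oplus>\<^bsub>E\<^esub> scale (\<lambda>_. \<tau>) g = g"
          using scale_distrib_left[of "\<lambda>_. 1 - \<tau>" "\<lambda>_. \<tau>" g] gE by simp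
        then have "g \<oplus>\<^bsub>E\<^esub> scale (\<lambda>_. t) y = scale (\<lambda>_. 1 - \<tau>) g \<oplus>\<^bsub>E\<^esub> (scale (\<lambda>_. \<tau>) g \<oplus>\<^bsub>E\<^esub> scale (\<lambda>_. t) y)"
          using gE y by (simp add: M.a_assoc[symmetric])
        moreover have "a = scale (\<lambda>_. 1 - \<tau>) g \<oplus>\<^bsub>E\<^esub> (\<zero>\<^bsub>E\<^esub> \<oplus>\<^bsub>E\<^esub> scale (\<lambda>_. t) (r (2 * k)))"
          using gE sE by (simp add: a_def mix_def r_def scale_scale \<tau>_def M.a_comm)
        ultimately have eq: "(g \<oplus>\<^bsub>E\<^esub> scale (\<lambda>_. t) y) \<ominus>\<^bsub>E\<^esub> a = scale (\<lambda>_. \<tau>) g \<oplus>\<^bsub>E\<^esub> scale (\<lambda>_. t) ?d"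
          using gE y rE by (simp add: add_minus_add scale_minus_right) (simp add: a_minus_def M.r_neg M.a_assoc)
        have "gauge 1 (scale (\<lambda>_. \<tau>) g \<oplus>\<^bsub>E\<^esub> scale (\<lambda>_. t) ?d) \<le> gauge \<tau> g + gauge t ?d"
        proof (rule gauge_le_add)
          have "AE w in M. nrm (scale (\<lambda>_. \<tau>) g) w = \<bar>\<tau>\<bar> * nrm g w" "AE w in M. nrm (scale (\<lambda>_. t) ?d) w = \<bar>t\<bar> * nrm ?d w"
            "AE w in M. nrm (scale (\<lambda>_. \<tau>) g \<oplus>\<^bsub>E\<^esub> scale (\<lambda>_. t) ?d) w
              \<le> nrm (scale (\<lambda>_. \<tau>) g) w + nrm (scale (\<lambda>_. t) ?d) w"
            using gE dE by (intro nrm_scale nrm_add_le; simp)+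
          then show "AE w in M. 1 * nrm (scale (\<lambda>_. \<tau>) g \<oplus>\<^bsub>E\<^esub> scale (\<lambda>_. t) ?d) w \<le> \<tau> * nrm g w + t * nrm ?d w"
            by eventually_elim (use \<tau> t in simp)
        qed (use gE dE \<tau> t in auto)
        moreover have "gauge \<tau> g < \<epsilon> / 2" using N1[OF k(2)] \<tau> by (simp add: \<tau>_def)
        moreover have "gauge t ?d \<le> max 1 t * gauge 1 ?d" using t dE by (intro gauge_scale_le) auto
        moreover have "gauge 1 ?d < \<epsilon> / 2 / max 1 t"
          using N2[OF k(3)] gauge_minus_commute[of y "r (2 * k)" 1] y rE by simp
        then have "max 1 t * gauge 1 ?d < \<epsilon> / 2" by (simp add: pos_less_divide_eq mult.commute)
        ultimately show ?thesis using aG eq by (intro bexI[of _ a]) auto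
      qed
      then have "g \<oplus>\<^bsub>E\<^esub> scale (\<lambda>_. t) y \<in> cl G" using gE y by (simp add: cl_def)
      then show ?thesis using clG by (auto simp: t_def)
    qed
    have y0: "y = \<zero>\<^bsub>E\<^esub>"
    proof (rule convexly_compact_no_ray[OF G g y(1)])
      fix m :: real
      obtain j where j: "m < real j" using reals_Archimedean2 by blast
      have "\<bar>b (2 * j)\<bar> \<le> (1 / 3) ^ (2 * j)" by (rule abs_b)
      then have "3 ^ (2 * j) \<le> 1 / b (2 * j)"
        using b_even[of j] by (simp add: power_one_over field_simps)
      moreover have "real (2 * j) < 2 ^ (2 * j)" by (rule of_nat_less_two_power)
      moreover have "(2 :: real) ^ (2 * j) \<le> 3 ^ (2 * j)" by (intro power_mono) auto
      ultimately have "m \<le> 1 / b (2 * j)" using j by simp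
      then show "\<exists>t\<ge>m. g \<oplus>\<^bsub>E\<^esub> scale (\<lambda>_. t) y \<in> G" using ray by blast
    qed
    show "gauge c g \<le> e"
    proof (rule field_le_epsilon)
      fix \<epsilon> :: real assume "0 < \<epsilon>"
      then obtain n where n: "gauge 1 (r n \<ominus>\<^bsub>E\<^esub> y) < \<epsilon>" using y(2) by blast
      have r0: "r 0 = g" using s(2) g GE by (auto simp: r_def b0)
      have z: "x \<ominus>\<^bsub>E\<^esub> y = x" if "x \<in> carrier E" for x
        using that by (simp add: y0 a_minus_def)
      have "gauge c (r 0 \<ominus>\<^bsub>E\<^esub> y) \<le> gauge c (r 0 \<ominus>\<^bsub>E\<^esub> r n) + gauge c (r n \<ominus>\<^bsub>E\<^esub> y)"
        using rE y c by (intro gauge_minus_triangle) auto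
      moreover have "gauge c (r 0 \<ominus>\<^bsub>E\<^esub> r n) \<le> e / 2 ^ 0 - e / 2 ^ n"
        using rE stepc c by (intro gauge_telescope) auto
      moreover have "gauge c (r n \<ominus>\<^bsub>E\<^esub> y) \<le> gauge 1 (r n \<ominus>\<^bsub>E\<^esub> y)"
        using rE y c by (intro gauge_le AE_I2 mult_right_mono nrm_nonneg) auto
      moreover have "0 \<le> e / 2 ^ n" using e by simp
      ultimately show "gauge c g \<le> e + \<epsilon>" using n z[OF rE[of 0]] r0 by simp
    qed
  qed
  with c(1) show ?thesis by blast
qed

theorem convexly_compact_as_bounded:
  assumes "rn_complete M E" and G: "L0_convexly_compact M E G"
  shows "as_bounded M E G"
proof (rule as_boundedI)
  show "\<exists>c>0. \<forall>g\<in>G. gauge c g \<le> e" if "0 < e" for e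
    using assms that by (rule convexly_compact_gauge_bounded)
qed (use G convexly_compact_carrier in \<open>auto simp: L0_convexly_compact_def\<close>)

end

section \<open>Fixed points of nonexpansive maps\<close>

context random_normed_module
begin

text \<open>Kirk's argument. Let \<open>H\<close> be minimal among the nonempty closed convex \<open>T\<close>-invariant subsets
  of \<open>K\<close>. A ball about a point of \<open>H\<close> that contains \<open>T ` H\<close> meets \<open>H\<close> in an invariant set, so
  by minimality it contains \<open>H\<close>. Consequently the set of centers \<open>x \<in> H\<close> for which the ball of
  radius \<open>r\<close> about \<open>x\<close> contains \<open>H\<close> is itself invariant: such a ball, moved to the center \<open>T x\<close>,
  contains \<open>T ` H\<close>. By minimality again this set is empty or all of \<open>H\<close>. If \<open>r\<close> is the radius of
  \<open>H\<close> at the point given by normal structure, it is not empty, so \<open>r\<close> bounds the diameter, and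
  this is possible only for diameter zero.\<close>

theorem random_Kirk:
  assumes complete: "rn_complete M E" and G: "L0_convexly_compact M E G"
    and normal: "random_normal_structure M E G"
    and K: "K \<subseteq> G" "K \<noteq> {}" "closedin (eps_lambda_topology M E) K" "L0_convex M E K" "T \<in> K \<rightarrow> K"
    and nonexp: "\<And>x y. x \<in> K \<Longrightarrow> y \<in> K \<Longrightarrow>
      AE w in M. nrm (T x \<ominus>\<^bsub>E\<^esub> T y) w \<le> nrm (x \<ominus>\<^bsub>E\<^esub> y) w"
  shows "\<exists>x\<in>K. T x = x"
proof -
  have GE: "G \<subseteq> carrier E" using G by (rule convexly_compact_carrier)
  define invariant where "invariant H \<longleftrightarrow> H \<noteq> {} \<and> H \<subseteq> K \<and> closedin (eps_lambda_topology M E) H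
    \<and> L0_convex M E H \<and> T \<in> H \<rightarrow> H" for H
  \<comment> \<open>Zorn's lemma is applied to the complements, which turns minimal into maximal sets.\<close>
  obtain H where H: "invariant H" and minimal: "\<And>H'. invariant H' \<Longrightarrow> H' \<subseteq> H \<Longrightarrow> H' = H"
  proof -
    have "\<exists>A\<in>uminus ` Collect invariant. \<forall>B\<in>uminus ` Collect invariant. A \<subseteq> B \<longrightarrow> B = A"
    proof (rule subset_Zorn_nonempty)
      show "uminus ` Collect invariant \<noteq> {}" using K unfolding invariant_def by blast
      fix \<C> assume \<C>: "\<C> \<noteq> {}" "subset.chain (uminus ` Collect invariant) \<C>"
      define \<H> where "\<H> = uminus ` \<C>"
      have \<H>: "\<H> \<noteq> {}" "\<And>H. H \<in> \<H> \<Longrightarrow> invariant H" "\<And>A B. A \<in> \<H> \<Longrightarrow> B \<in> \<H> \<Longrightarrow> A \<subseteq> B \<or> B \<subseteq> A"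
        using \<C> by (auto simp: \<H>_def subset.chain_def)
      have "\<Inter>\<H> \<noteq> {}"
      proof (rule convexly_compact_directed_Inter[OF G])
        show "A \<noteq> {} \<and> A \<subseteq> G \<and> closedin (eps_lambda_topology M E) A \<and> L0_convex M E A"
          if "A \<in> \<H>" for A
          using \<H>(2)[OF that] K(1) by (auto simp: invariant_def)
        show "\<exists>C\<in>\<H>. C \<subseteq> A \<inter> B" if "A \<in> \<H>" "B \<in> \<H>" for A B
          using \<H>(3)[OF that] that by (metis inf.absorb_iff1 inf_commute subset_refl)
      qed
      moreover have "closedin (eps_lambda_topology M E) (\<Inter>\<H>)"
        using \<H> by (intro closedin_Inter_carrier) (auto simp: invariant_def)
      moreover have "L0_convex M E (\<Inter>\<H>)"
        using \<H> by (intro L0_convex_Inter) (auto simp: invariant_def)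
      moreover have "\<Inter>\<H> \<subseteq> K" using \<H>(1,2) by (auto simp: invariant_def)
      moreover have "T \<in> \<Inter>\<H> \<rightarrow> \<Inter>\<H>" using \<H>(2) by (auto simp: invariant_def Pi_iff)
      ultimately have "invariant (\<Inter>\<H>)" by (simp add: invariant_def)
      moreover have "\<Union>\<C> = - \<Inter>\<H>" by (auto simp: \<H>_def)
      ultimately show "\<Union>\<C> \<in> uminus ` Collect invariant" by simp
    qed
    then obtain A where A: "A \<in> uminus ` Collect invariant"
      "\<forall>B\<in>uminus ` Collect invariant. A \<subseteq> B \<longrightarrow> B = A" by (elim bexE)
    obtain H where H: "invariant H" "A = - H" using A(1) by auto
    show thesis
    proof (rule that[OF H(1)])
      fix H' assume "invariant H'" "H' \<subseteq> H"
      then have "- H' = - H" using A(2)[rule_format, of "- H'"] H(2) by auto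
      then show "H' = H" by simp
    qed
  qed
  have HK: "H \<subseteq> K" "H \<subseteq> G" and Hne: "H \<noteq> {}"
    and Hc: "closedin (eps_lambda_topology M E) H" "L0_convex M E H" and TH: "\<And>x. x \<in> H \<Longrightarrow> T x \<in> H"
    using H K(1) by (auto simp: invariant_def)
  have HE: "H \<subseteq> carrier E" using HK GE by blast
  have bounded: "as_bounded M E H"
    using complete convexly_compact_subset[OF G HK(2) Hne Hc] by (rule convexly_compact_as_bounded)
  obtain d where esssup_d: "is_esssup M ((\<lambda>(x, y) w. ereal (nrm (x \<ominus>\<^bsub>E\<^esub> y) w)) ` (H \<times> H)) d"
    and diam_d: "diam M E H = L0_class M d"
    using diam_eq[OF HE] by blast
  have d: "d \<in> borel_measurable M" "diam M E H = L0_class M d"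
    "\<And>x y. x \<in> H \<Longrightarrow> y \<in> H \<Longrightarrow> AE w in M. ereal (nrm (x \<ominus>\<^bsub>E\<^esub> y) w) \<le> d w"
    "\<And>t. t \<in> borel_measurable M \<Longrightarrow>
      (\<And>x y. x \<in> H \<Longrightarrow> y \<in> H \<Longrightarrow> AE w in M. ereal (nrm (x \<ominus>\<^bsub>E\<^esub> y) w) \<le> t w) \<Longrightarrow> AE w in M. d w \<le> t w"
    using esssup_d diam_d by (auto simp: is_esssup_def)
  have d0: "AE w in M. 0 \<le> d w"
  proof -
    obtain x where x: "x \<in> H" using Hne by blast
    have xE: "x \<ominus>\<^bsub>E\<^esub> x \<in> carrier E" using x HE by auto
    from d(3)[OF x x] show ?thesis
    proof eventually_elim
      case (elim w)
      have "0 \<le> ereal (nrm (x \<ominus>\<^bsub>E\<^esub> x) w)" using nrm_nonneg[OF xE] by simp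
      then show ?case using elim by (rule order_trans)
    qed
  qed
  have d_zero: "AE w in M. d w = 0"
  proof (rule ccontr)
    assume nz: "\<not> ?thesis"
    have "L0_class M (\<lambda>_. 0) \<sqsubset>\<^bsub>L0bar M\<^esub> diam M E H"
    proof -
      have "L0_class M (\<lambda>_. 0) \<noteq> L0_class M d"
      proof
        assume "L0_class M (\<lambda>_. 0) = L0_class M d"
        then have "AE w in M. 0 = d w" by (simp add: L0_class_eq_iff)
        then have "AE w in M. d w = 0" by eventually_elim simp
        with nz show False by contradiction
      qed
      then show ?thesis using d0 d(1,2) by (simp add: lless_def L0bar_def L0_le_class_iff)
    qed
    then obtain z where z: "z \<in> H" "\<forall>d\<in>diam M E H.
        L0_less_on M {w \<in> space M. 0 < d w} (radius_at M E H z) (diam M E H)"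
      using normal HK bounded Hc unfolding random_normal_structure_def by blast
    have zE: "z \<in> carrier E" using z HE by auto
    define r where "r = rad H z"
    have r: "r \<in> borel_measurable M" "\<And>y. y \<in> H \<Longrightarrow> AE w in M. ereal (nrm (z \<ominus>\<^bsub>E\<^esub> y) w) \<le> r w"
      using rad_measurable[OF HE zE] rad_upper[OF HE zE] by (auto simp: r_def)
    have "d \<in> L0_class M d" "r \<in> L0_class M r" using d r by (auto simp: L0_class_def)
    then have less: "AE w in M. w \<in> {w \<in> space M. 0 < d w} \<longrightarrow> r w < d w"
      using z(2) d(2) radius_at_eq[OF HE zE] unfolding L0_less_on_def r_def by fastforce
    define C where "C = H \<inter> \<Inter>((\<lambda>y. ball_in H y r) ` H)"
    have C_iff: "x \<in> C \<longleftrightarrow> x \<in> H \<and> (\<forall>y\<in>H. AE w in M. ereal (nrm (x \<ominus>\<^bsub>E\<^esub> y) w) \<le> r w)" for x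
      by (auto simp: C_def ball_in_def)
    have "T x \<in> C" if x: "x \<in> C" for x
    proof -
      have xH: "x \<in> H" using x by (simp add: C_iff)
      have TxE: "T x \<in> carrier E" using TH[OF xH] HE by auto
      have near: "T y \<in> ball_in H (T x) r" if y: "y \<in> H" for y
      proof -
        have E: "x \<in> carrier E" "y \<in> carrier E" "T y \<in> carrier E" using xH y TH[OF y] HE by auto
        have "AE w in M. ereal (nrm (x \<ominus>\<^bsub>E\<^esub> y) w) \<le> r w" using x y by (simp add: C_iff)
        moreover have "AE w in M. nrm (T x \<ominus>\<^bsub>E\<^esub> T y) w \<le> nrm (x \<ominus>\<^bsub>E\<^esub> y) w"
          using xH y HK by (intro nonexp) auto
        moreover have "AE w in M. nrm (T y \<ominus>\<^bsub>E\<^esub> T x) w = nrm (T x \<ominus>\<^bsub>E\<^esub> T y) w"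
          using E TxE by (intro nrm_minus_commute)
        ultimately have "AE w in M. ereal (nrm (T y \<ominus>\<^bsub>E\<^esub> T x) w) \<le> r w"
        proof eventually_elim
          case (elim w)
          have "ereal (nrm (T y \<ominus>\<^bsub>E\<^esub> T x) w) \<le> ereal (nrm (x \<ominus>\<^bsub>E\<^esub> y) w)" using elim by simp
          then show ?case using elim(1) by (rule order_trans)
        qed
        then show ?thesis using TH[OF y] by (simp add: ball_in_def)
      qed
      have "invariant (ball_in H (T x) r)"
        unfolding invariant_def
      proof (intro conjI)
        show "ball_in H (T x) r \<noteq> {}" using near xH by blast
        show "ball_in H (T x) r \<subseteq> K" using HK by (auto simp: ball_in_def)
        show "closedin (eps_lambda_topology M E) (ball_in H (T x) r)"
          using Hc TxE r by (intro closedin_ball_in)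
        show "L0_convex M E (ball_in H (T x) r)" using Hc HE TxE by (intro L0_convex_ball_in)
        show "T \<in> ball_in H (T x) r \<rightarrow> ball_in H (T x) r" using near by (auto simp: ball_in_def)
      qed
      then have eq: "ball_in H (T x) r = H" by (rule minimal) (auto simp: ball_in_def)
      have "AE w in M. ereal (nrm (T x \<ominus>\<^bsub>E\<^esub> y) w) \<le> r w" if y: "y \<in> H" for y
      proof -
        have yE: "y \<in> carrier E" using y HE by auto
        have "AE w in M. ereal (nrm (y \<ominus>\<^bsub>E\<^esub> T x) w) \<le> r w" using eq y by (auto simp: ball_in_def)
        moreover have "AE w in M. nrm (T x \<ominus>\<^bsub>E\<^esub> y) w = nrm (y \<ominus>\<^bsub>E\<^esub> T x) w"
          using TxE yE by (intro nrm_minus_commute)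
        ultimately show ?thesis by eventually_elim simp
      qed
      then show ?thesis using TH[OF xH] by (simp add: C_iff)
    qed
    then have TC: "T \<in> C \<rightarrow> C" by simp
    have Call: "C = \<Inter>(insert H ((\<lambda>y. ball_in H y r) ` H))" by (simp add: C_def)
    have "invariant C"
      unfolding invariant_def
    proof (intro conjI TC)
      have "z \<in> C" using z(1) r(2) by (simp add: C_iff)
      then show "C \<noteq> {}" by blast
      show "C \<subseteq> K" using HK by (auto simp: C_def)
      show "closedin (eps_lambda_topology M E) C"
        unfolding Call using Hc HE r by (intro closedin_Inter_carrier) (auto intro: closedin_ball_in)
      show "L0_convex M E C"
        unfolding Call using Hc HE by (intro L0_convex_Inter) (auto intro: L0_convex_ball_in)
    qed
    then have "C = H" by (rule minimal) (auto simp: C_def)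
    then have "AE w in M. ereal (nrm (x \<ominus>\<^bsub>E\<^esub> y) w) \<le> r w" if "x \<in> H" "y \<in> H" for x y
      using that C_iff by auto
    then have "AE w in M. d w \<le> r w" by (intro d(4) r) auto
    with less d0 AE_space have "AE w in M. d w = 0"
      by eventually_elim (auto simp: not_less[symmetric] order.order_iff_strict)
    with nz show False by contradiction
  qed
  obtain x where x: "x \<in> H" using Hne by blast
  have E: "x \<in> carrier E" "T x \<in> carrier E" using x TH[OF x] HE by auto
  have "T x \<ominus>\<^bsub>E\<^esub> x = \<zero>\<^bsub>E\<^esub>"
  proof (rule nrm_eq_zero)
    show xx: "T x \<ominus>\<^bsub>E\<^esub> x \<in> carrier E" using E by simp
    from d(3)[OF TH[OF x] x] d_zero show "AE w in M. nrm (T x \<ominus>\<^bsub>E\<^esub> x) w = 0"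
      by eventually_elim (use nrm_nonneg[OF xx] in \<open>auto intro: antisym\<close>)
  qed
  then have "T x = x" using add_minus_cancel(1)[OF E] E by simp
  then show ?thesis using x HK by blast
qed


section \<open>The random Chebyshev center\<close>

text \<open>Mixing \<open>x\<close> and \<open>y\<close> with the indicator of the set where \<open>rad G x \<le> rad G y\<close> shows that the
  radii \<open>rad G x\<close> with \<open>x \<in> G\<close> form a downward directed family, so compactness provides a point
  that belongs to all the sublevel sets. The radius there is a least element of the family, and so
  it is the infimum.\<close>

lemma chebyshev_center_nonempty:
  assumes G: "L0_convexly_compact M E G"
  obtains c where "c \<in> G" "\<And>x. x \<in> G \<Longrightarrow> AE w in M. rad G c w \<le> rad G x w"
proof -
  have GE: "G \<subseteq> carrier E" using G by (rule convexly_compact_carrier)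
  have Gc: "closedin (eps_lambda_topology M E) G" "L0_convex M E G" "G \<noteq> {}"
    using G by (auto simp: L0_convexly_compact_def)
  define S where "S x = G \<inter> \<Inter>((\<lambda>y. ball_in G y (rad G x)) ` G)" for x
  have S_iff: "u \<in> S x \<longleftrightarrow> u \<in> G \<and> (\<forall>y\<in>G. AE w in M. ereal (nrm (u \<ominus>\<^bsub>E\<^esub> y) w) \<le> rad G x w)" for u x
    by (auto simp: S_def ball_in_def)
  have S_mono: "S z \<subseteq> S x" if "AE w in M. rad G z w \<le> rad G x w" for x z
  proof
    fix u assume u: "u \<in> S z"
    have "AE w in M. ereal (nrm (u \<ominus>\<^bsub>E\<^esub> y) w) \<le> rad G x w" if "y \<in> G" for y
    proof -
      have "AE w in M. ereal (nrm (u \<ominus>\<^bsub>E\<^esub> y) w) \<le> rad G z w" using u that by (simp add: S_iff)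
      then show ?thesis using \<open>AE w in M. rad G z w \<le> rad G x w\<close>
        by eventually_elim (rule order_trans)
    qed
    then show "u \<in> S x" using u by (simp add: S_iff)
  qed
  have "\<Inter>(S ` G) \<noteq> {}"
  proof (rule convexly_compact_directed_Inter[OF G])
    fix A assume "A \<in> S ` G"
    then obtain x where x: "x \<in> G" "A = S x" by blast
    have xE: "x \<in> carrier E" using x GE by auto
    have Sall: "S x = \<Inter>(insert G ((\<lambda>y. ball_in G y (rad G x)) ` G))" by (simp add: S_def)
    have "x \<in> S x" using x rad_upper[OF GE xE] by (simp add: S_iff)
    moreover have "closedin (eps_lambda_topology M E) (S x)"
      unfolding Sall using Gc GE rad_measurable[OF GE xE]
      by (intro closedin_Inter_carrier) (auto intro: closedin_ball_in)
    moreover have "L0_convex M E (S x)"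
      unfolding Sall using Gc GE by (intro L0_convex_Inter) (auto intro: L0_convex_ball_in)
    moreover have "S x \<subseteq> G" by (auto simp: S_iff)
    ultimately show "A \<noteq> {} \<and> A \<subseteq> G \<and> closedin (eps_lambda_topology M E) A \<and> L0_convex M E A"
      using x(2) by blast
  next
    fix A B assume "A \<in> S ` G" "B \<in> S ` G"
    then obtain x y where xy: "x \<in> G" "A = S x" "y \<in> G" "B = S y" by blast
    have E: "x \<in> carrier E" "y \<in> carrier E" using xy GE by auto
    have rm [measurable]: "rad G x \<in> borel_measurable M" "rad G y \<in> borel_measurable M"
      using rad_measurable[OF GE] E by auto
    define f :: "'w \<Rightarrow> real" where "f = indicator {w \<in> space M. rad G x w \<le> rad G y w}"
    have f: "f \<in> borel_measurable M" "\<And>w. 0 \<le> f w \<and> f w \<le> 1"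
      by (auto simp: f_def indicator_def)
    define z where "z = mix f x y"
    have z: "z \<in> G" using L0_convexD[OF Gc(2) xy(1,3) f(1)] f(2) by (simp add: z_def)
    have zE: "z \<in> carrier E" using z GE by auto
    have "AE w in M. rad G z w \<le> min (rad G x w) (rad G y w)"
    proof (rule rad_least[OF GE zE])
      fix g assume g: "g \<in> G"
      have gE: "g \<in> carrier E" using g GE by auto
      have "z \<ominus>\<^bsub>E\<^esub> g = mix f (x \<ominus>\<^bsub>E\<^esub> g) (y \<ominus>\<^bsub>E\<^esub> g)"
        using mix_minus_mix[of f x y g g] f E gE by (simp add: z_def)
      then have "AE w in M. nrm (z \<ominus>\<^bsub>E\<^esub> g) w \<le> f w * nrm (x \<ominus>\<^bsub>E\<^esub> g) w + (1 - f w) * nrm (y \<ominus>\<^bsub>E\<^esub> g) w"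
        using nrm_mix_le[OF f, of "x \<ominus>\<^bsub>E\<^esub> g" "y \<ominus>\<^bsub>E\<^esub> g"] E gE by simp
      with rad_upper[OF GE E(1) g] rad_upper[OF GE E(2) g] AE_space
      show "AE w in M. ereal (nrm (z \<ominus>\<^bsub>E\<^esub> g) w) \<le> min (rad G x w) (rad G y w)"
      proof eventually_elim
        case (elim w)
        show ?case
        proof (cases "rad G x w \<le> rad G y w")
          case True
          then have "ereal (nrm (z \<ominus>\<^bsub>E\<^esub> g) w) \<le> ereal (nrm (x \<ominus>\<^bsub>E\<^esub> g) w)"
            using elim by (simp add: f_def)
          then have "ereal (nrm (z \<ominus>\<^bsub>E\<^esub> g) w) \<le> rad G x w" using elim(1) by (rule order_trans)
          then show ?thesis using True by (simp add: min_def)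
        next
          case False
          then have "ereal (nrm (z \<ominus>\<^bsub>E\<^esub> g) w) \<le> ereal (nrm (y \<ominus>\<^bsub>E\<^esub> g) w)"
            using elim by (simp add: f_def)
          then have "ereal (nrm (z \<ominus>\<^bsub>E\<^esub> g) w) \<le> rad G y w" using elim(2) by (rule order_trans)
          then show ?thesis using False by (simp add: min_def)
        qed
      qed
    qed measurable
    then have "AE w in M. rad G z w \<le> rad G x w" "AE w in M. rad G z w \<le> rad G y w"
      by (eventually_elim, simp)+
    then have "S z \<subseteq> A \<inter> B" using S_mono xy by blast
    then show "\<exists>C\<in>S ` G. C \<subseteq> A \<inter> B" using z by blast
  qed
  then obtain c where c: "\<And>x. x \<in> G \<Longrightarrow> c \<in> S x" by blast
  obtain x0 where "x0 \<in> G" using Gc by blast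
  then have cG: "c \<in> G" using c by (auto simp: S_iff)
  moreover have "AE w in M. rad G c w \<le> rad G x w" if x: "x \<in> G" for x
  proof (rule rad_least)
    show "rad G x \<in> borel_measurable M" using x GE by (intro rad_measurable) auto
    show "AE w in M. ereal (nrm (c \<ominus>\<^bsub>E\<^esub> y) w) \<le> rad G x w" if "y \<in> G" for y
      using c[OF x] that by (simp add: S_iff)
  qed (use GE cG in auto)
  ultimately show thesis using that by blast
qed

text \<open>As \<open>T\<close> need not map \<open>G\<close> onto \<open>G\<close>, the image under \<open>T\<close> of a point of the Chebyshev
  center is only known to be at distance at most \<open>r\<close> from the points of \<open>T ` G\<close>, where \<open>r\<close> is the minimal radius. Therefore one considers the points \<open>x\<close> for which \<open>(T ^^ n) ` G\<close> lies in the ball of radius \<open>r\<close>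
  about \<open>x\<close> for some \<open>n\<close>. These points form a
  convex \<open>T\<close>-invariant set, so Kirk's theorem gives a fixed point \<open>z\<close> in its closure. For a fixed
  point \<open>nrm (z - y) = nrm (z - (T ^^ n) y)\<close>, hence the ball of radius \<open>r\<close> about \<open>z\<close> contains all
  of \<open>G\<close>.\<close>

theorem isometry_fixed_point_in_center:
  assumes complete: "rn_complete M E" and G: "L0_convexly_compact M E G"
    and normal: "random_normal_structure M E G"
    and T: "T \<in> G \<rightarrow> G"
    and iso: "\<And>x y. x \<in> G \<Longrightarrow> y \<in> G \<Longrightarrow>
      AE w in M. nrm (T x \<ominus>\<^bsub>E\<^esub> T y) w = nrm (x \<ominus>\<^bsub>E\<^esub> y) w"
  shows "\<exists>x\<in>chebyshev_center M E G G. T x = x"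
proof -
  have GE: "G \<subseteq> carrier E" using G by (rule convexly_compact_carrier)
  have Gc: "closedin (eps_lambda_topology M E) G" "L0_convex M E G"
    using G by (auto simp: L0_convexly_compact_def)
  have TG: "T x \<in> G" if "x \<in> G" for x using T that by auto
  have TnG: "(T ^^ n) x \<in> G" if "x \<in> G" for x n
    by (induction n) (use that TG in auto)
  have Tn_iso: "AE w in M. nrm ((T ^^ n) x \<ominus>\<^bsub>E\<^esub> (T ^^ n) y) w = nrm (x \<ominus>\<^bsub>E\<^esub> y) w"
    if "x \<in> G" "y \<in> G" for x y n
  proof (induction n)
    case (Suc n)
    have "AE w in M. nrm ((T ^^ Suc n) x \<ominus>\<^bsub>E\<^esub> (T ^^ Suc n) y) w = nrm ((T ^^ n) x \<ominus>\<^bsub>E\<^esub> (T ^^ n) y) w"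
      using iso[OF TnG TnG] that by simp
    with Suc.IH show ?case by eventually_elim simp
  qed simp
  obtain c where c: "c \<in> G" "\<And>x. x \<in> G \<Longrightarrow> AE w in M. rad G c w \<le> rad G x w"
    using chebyshev_center_nonempty[OF G] by blast
  have cE: "c \<in> carrier E" using c GE by auto
  define r where "r = rad G c"
  have r [measurable]: "r \<in> borel_measurable M" using rad_measurable[OF GE cE] by (simp add: r_def)
  define C where "C n = G \<inter> \<Inter>((\<lambda>y. ball_in G ((T ^^ n) y) r) ` G)" for n
  have C_iff: "x \<in> C n \<longleftrightarrow> x \<in> G \<and> (\<forall>y\<in>G. AE w in M. ereal (nrm (x \<ominus>\<^bsub>E\<^esub> (T ^^ n) y) w) \<le> r w)" for x n
    by (auto simp: C_def ball_in_def)
  have C_Suc: "C n \<subseteq> C (Suc n)" for n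
  proof
    fix x assume x: "x \<in> C n"
    have "AE w in M. ereal (nrm (x \<ominus>\<^bsub>E\<^esub> (T ^^ Suc n) y) w) \<le> r w" if "y \<in> G" for y
      using x TG[OF that] by (simp add: C_iff funpow_swap1)
    then show "x \<in> C (Suc n)" using x by (simp add: C_iff)
  qed
  have C_mono: "C m \<subseteq> C n" if "m \<le> n" for m n
    using that by (induction rule: dec_induct) (use C_Suc in blast)+
  have T_C: "T x \<in> C (Suc n)" if x: "x \<in> C n" for x n
  proof -
    have xG: "x \<in> G" using x by (simp add: C_iff)
    have "AE w in M. ereal (nrm (T x \<ominus>\<^bsub>E\<^esub> (T ^^ Suc n) y) w) \<le> r w" if y: "y \<in> G" for y
    proof -
      have "AE w in M. ereal (nrm (x \<ominus>\<^bsub>E\<^esub> (T ^^ n) y) w) \<le> r w" using x y by (simp add: C_iff)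
      with iso[OF xG TnG[OF y, of n]] show ?thesis by eventually_elim simp
    qed
    then show ?thesis using TG[OF xG] by (simp add: C_iff)
  qed
  define U where "U = (\<Union>n. C n)"
  have UG: "U \<subseteq> G" by (auto simp: U_def C_iff)
  have UE: "U \<subseteq> carrier E" using UG GE by blast
  have C_convex: "L0_convex M E (C n)" for n
  proof -
    have Call: "C n = \<Inter>(insert G ((\<lambda>y. ball_in G ((T ^^ n) y) r) ` G))" by (simp add: C_def)
    show ?thesis
      unfolding Call using Gc GE TnG by (intro L0_convex_Inter) (auto intro!: L0_convex_ball_in)
  qed
  have U_convex: "L0_convex M E U"
  proof (rule L0_convexI[OF UE])
    fix x y and f :: "'w \<Rightarrow> real" assume "x \<in> U" "y \<in> U" and f: "f \<in> borel_measurable M" "\<And>w. 0 \<le> f w \<and> f w \<le> 1"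
    then obtain m n where "x \<in> C m" "y \<in> C n" by (auto simp: U_def)
    then have "x \<in> C (max m n)" "y \<in> C (max m n)"
      using C_mono[of m "max m n"] C_mono[of n "max m n"] by auto
    then have "mix f x y \<in> C (max m n)" using L0_convexD[OF C_convex _ _ f(1)] f(2) by blast
    then show "mix f x y \<in> U" by (auto simp: U_def)
  qed
  have "c \<in> C 0" using c(1) rad_upper[OF GE cE] by (simp add: C_iff r_def)
  then have Une: "U \<noteq> {}" by (auto simp: U_def)
  have clG: "cl U \<subseteq> G" using UG Gc(1) by (rule cl_minimal)
  have T_cl: "T \<in> cl U \<rightarrow> cl U"
  proof
    fix x assume x: "x \<in> cl U"
    have xG: "x \<in> G" using x clG by blast
    have "\<exists>a\<in>U. gauge 1 (T x \<ominus>\<^bsub>E\<^esub> a) < e" if e: "0 < e" for e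
    proof -
      obtain a where a: "a \<in> U" "gauge 1 (x \<ominus>\<^bsub>E\<^esub> a) < e" using x e by (auto simp: cl_def)
      have aG: "a \<in> G" using a UG by blast
      have E: "x \<in> carrier E" "a \<in> carrier E" "T x \<in> carrier E" "T a \<in> carrier E"
        using xG aG TG GE by blast+
      have "gauge 1 (T x \<ominus>\<^bsub>E\<^esub> T a) \<le> gauge 1 (x \<ominus>\<^bsub>E\<^esub> a)"
        using E iso[OF xG aG] by (intro gauge_le) auto
      moreover have "T a \<in> U" using a(1) T_C by (auto simp: U_def)
      ultimately show ?thesis using a(2) by (intro bexI[of _ "T a"]) auto
    qed
    then show "T x \<in> cl U" using TG[OF xG] GE by (auto simp: cl_def)
  qed
  have "\<exists>z\<in>cl U. T z = z"
  proof (rule random_Kirk[OF complete G normal clG _ closedin_cl[OF UE] L0_convex_cl[OF UE U_convex] T_cl])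
    show "AE w in M. nrm (T x \<ominus>\<^bsub>E\<^esub> T y) w \<le> nrm (x \<ominus>\<^bsub>E\<^esub> y) w" if "x \<in> cl U" "y \<in> cl U" for x y
    proof -
      have "x \<in> G" "y \<in> G" using that clG by auto
      from iso[OF this] show ?thesis by eventually_elim simp
    qed
    show "cl U \<noteq> {}" using Une cl_superset[OF UE] by blast
  qed
  then obtain z where z: "z \<in> cl U" "T z = z" by blast
  have zG: "z \<in> G" using z clG by blast
  have zE: "z \<in> carrier E" using zG GE by auto
  have Tnz: "(T ^^ n) z = z" for n by (induction n) (use z in auto)
  have near: "AE w in M. ereal (nrm (z \<ominus>\<^bsub>E\<^esub> y) w) \<le> r w" if y: "y \<in> G" for y
  proof (rule AE_le_if_le_add_small)
    have yE: "y \<in> carrier E" using y GE by auto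
    show "nrm (z \<ominus>\<^bsub>E\<^esub> y) \<in> borel_measurable M" using zE yE by simp
    fix e :: real assume "0 < e"
    then obtain a where a: "a \<in> U" "gauge 1 (z \<ominus>\<^bsub>E\<^esub> a) < e" using z(1) by (auto simp: cl_def)
    then obtain n where n: "a \<in> C n" by (auto simp: U_def)
    let ?y = "(T ^^ n) y"
    have E: "a \<in> carrier E" "?y \<in> carrier E" using a UE TnG[OF y] GE by auto
    have "AE w in M. ereal (nrm (a \<ominus>\<^bsub>E\<^esub> ?y) w) \<le> r w" using n y by (simp add: C_iff)
    moreover have "AE w in M. nrm (z \<ominus>\<^bsub>E\<^esub> ?y) w = nrm (z \<ominus>\<^bsub>E\<^esub> y) w"
      using Tn_iso[OF zG y, of n] by (simp add: Tnz)
    moreover have "AE w in M. nrm (z \<ominus>\<^bsub>E\<^esub> ?y) w \<le> nrm (z \<ominus>\<^bsub>E\<^esub> a) w + nrm (a \<ominus>\<^bsub>E\<^esub> ?y) w"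
      using zE E by (intro nrm_minus_triangle)
    ultimately have "AE w in M. ereal (nrm (z \<ominus>\<^bsub>E\<^esub> y) w) \<le> r w + ereal (nrm (z \<ominus>\<^bsub>E\<^esub> a) w)"
    proof eventually_elim
      case (elim w)
      then show ?case by (cases "r w") auto
    qed
    then show "\<exists>u\<in>borel_measurable M. (\<forall>w. 0 \<le> u w) \<and> expectation (\<lambda>w. min 1 (u w)) < e
        \<and> (AE w in M. ereal (nrm (z \<ominus>\<^bsub>E\<^esub> y) w) \<le> r w + ereal (u w))"
      using a(2) zE E by (intro bexI[of _ "nrm (z \<ominus>\<^bsub>E\<^esub> a)"]) (auto simp: nrm_nonneg gauge_def)
  qed (rule r)
  have "AE w in M. rad G z w \<le> r w" using near by (intro rad_least[OF GE zE] r)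
  have "z \<in> chebyshev_center M E G G"
  proof (rule chebyshev_centerI[OF GE zG])
    show "AE w in M. rad G z w \<le> rad G y w" if "y \<in> G" for y
      using \<open>AE w in M. rad G z w \<le> r w\<close> c(2)[OF that] by eventually_elim (simp add: r_def)
  qed
  with z(2) show ?thesis by blast
qed

end

theorem theorem1p16:
  fixes M :: "'w measure"
    and E :: "('w, 'k::{real_normed_field, second_countable_topology}, 'e) rn_module"
    and G :: "'e set" and T :: "'e \<Rightarrow> 'e"
  assumes "random_normed_module M E"
    and "rn_complete M E"
    and "L0_convexly_compact M E G"
    and "random_normal_structure M E G"
    and "T \<in> G \<rightarrow> G"
    and "\<forall>x\<in>G. \<forall>y\<in>G. rnorm E (T x \<ominus>\<^bsub>E\<^esub> T y) = rnorm E (x \<ominus>\<^bsub>E\<^esub> y)"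
  shows "\<exists>x \<in> chebyshev_center M E G G. T x = x"
proof -
  interpret random_normed_module M E by fact
  show ?thesis
  proof (rule isometry_fixed_point_in_center[OF assms(2-5)])
    fix x y assume xy: "x \<in> G" "y \<in> G"
    then have "x \<in> carrier E" "y \<in> carrier E" "T x \<in> carrier E" "T y \<in> carrier E"
      using convexly_compact_carrier[OF assms(3)] assms(5) by auto
    with xy show "AE w in M. nrm (T x \<ominus>\<^bsub>E\<^esub> T y) w = nrm (x \<ominus>\<^bsub>E\<^esub> y) w"
      using assms(6) rnorm_eq_iff[of "T x \<ominus>\<^bsub>E\<^esub> T y" "x \<ominus>\<^bsub>E\<^esub> y"] by simp
  qed
qed

end
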